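(* Let $m\in\mathbb{N}$ with $m\ge 1$ and let $p\in[1,\infty)$ be real. For $n \geq 2$, $B>0$ and $\ell \in \mathbb{N}$, there exist constants $c=c(m,n,B,\ell,p)>0$ and $s=s(m,n,B,\ell,p)>0$ such that for every $\Omega \in \mathcal{K}_{m,n}^{B,\ell}$ and every $0<\varepsilon<1/2$ there is a ReLU neural network $\Phi_\varepsilon^\Omega: \mathbb{R}^n \to [0,1]$ with \begin{itemize} \item $\|\Phi_\varepsilon^\Omega\|_{\max} \leq \varepsilon^{-s}$, \item $\mathrm{depth}(\Phi_\varepsilon^\Omega) \leq \lceil \log_2((\ell+1) n)\rceil+(3+\lceil \log_2(m)\rceil)(14+2m/n)$, \item $\mathrm{size}(\Phi_\varepsilon^\Omega) \leq c\cdot\varepsilon^{-p(n-1)/m}$, \end{itemize} such that $$\|\Phi_\varepsilon^\Omega-\chi_\Omega\|_{L^p(Q_n)} < \varepsilon .$$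
   Context: Notation: $\mathbb{N}=\{0,1,\dots\}$, $[n]=\{1,\dots,n\}$, $Q_n=[-1/2,1/2]^n$; $\mathbb{R}^0=Q_0=\{*\}$ is a singleton and a map on $\mathbb{R}^0$ is identified with its value. $\pi_{i}:\mathbb{R}^{i}\to\mathbb{R}^{i-1}$ is the projection onto the first $i-1$ coordinates. $\chi_\Omega$ is the characteristic function ($1$ on $\Omega$, $0$ off $\Omega$). $L^p(Q_n)$ is with respect to Lebesgue measure. A function $g:A\to\mathbb{R}$ on an arbitrary set $A\subseteq\mathbb{R}^n$ is $C^m$ if it is the restriction of a $C^m$ function defined on an open set containing $A$; every function on $\mathbb{R}^0$ is $C^m$. For a $C^m$ function $F:\mathbb{R}^{i}\to\mathbb{R}$, $\|F\|_{W^{m,\infty}(Q_i)}:=\max_{|\alpha|\le m}\|\partial^\alpha F\|_{L^\infty(Q_i)}$. For $f,g:A\to\mathbb{R}$, write $f<g$ if $f(x)<g(x)$ for all $x\in A$; then $(f,g)_A:=\{(x,y): x\in A,\ f(x)<y<g(x)\}$, and $(f,f)_A$ is the graph of $f$. Traceable sets: $A\subseteq\mathbb{R}^n$ is $m$-traceable if there exist sets $A_0,\dots,A_n$ and bounded $C^m$ maps $f_i,g_i:A_{i-1}\to\mathbb{R}$ such that for each $i\in[n]$: $A_i\subseteq\mathbb{R}^i$, $A_n=A$, $A_0=\{*\}$; $f_i<g_i$ or $f_i=g_i$; $\pi_i(A_i)=A_{i-1}$ and $A_i=(f_i,g_i)_{A_{i-1}}$. $\mathcal{K}_{m,n}^B$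 ($B>0$) is the set of all $m$-traceable $A\subseteq Q_n$ (where $A_0,\dots,A_n$ and $f_i,g_i:A_{i-1}\to\mathbb{R}$, $i\in[n]$, are the sets and bounded $C^m$ maps witnessing that $A$ is $m$-traceable) such that for each $i\in[n]$ there are $C^m$ functions $F_i,G_i:\mathbb{R}^{i-1}\to\mathbb{R}$ with $F_i|_{A_{i-1}}=f_i$, $G_i|_{A_{i-1}}=g_i$, $\|F_i\|_{W^{m,\infty}(Q_{i-1})}\le B$ and $\|G_i\|_{W^{m,\infty}(Q_{i-1})}\le B$. $\mathcal{K}_{m,n}^{B,\ell}$ is the set of all $\Omega\subseteq Q_n$ of the form $\Omega=A^1\cup\dots\cup A^l$ with $l\le\ell$ and $A^1,\dots,A^l\in\mathcal{K}_{m,n}^B$ pairwise disjoint ($l=0$ gives $\emptyset$). ReLU neural networks: a ReLU neural network $\Phi$ is a tuple $((W^{(0)},b^{(0)}),\ldots,(W^{(L)},b^{(L)}))$ with $L\ge1$, $W^{(i)}\in\mathbb{R}^{d_{i+1}\times d_i}$, $b^{(i)}\in\mathbb{R}^{d_{i+1}}$, all $d_i\ge 1$, identified with the function $\Phi:\mathbb{R}^{d_0}\to\mathbb{R}^{d_{L+1}}$ given by $x^{(0)}=x$, $x^{(i)}=\rho(W^{(i-1)}x^{(i-1)}+b^{(i-1)})$ for $i=1,\dots,L$, $\Phi(x)=W^{(L)}x^{(L)}+b^{(L)}$, where $\rho(t)=\max\{0,t\}$ acts componentwise. $\mathrm{depth}(\Phi)=L$, $\mathrm{size}(\Phi)$ is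 the number of non-zero entries of all $W^{(i)},b^{(i)}$, and $\|\Phi\|_{\max}$ is the maximal absolute value of these entries. *)

theory Defs
  imports "HOL-Probability.Essential_Supremum" "Jordan_Normal_Form.Matrix"
begin

hide_const (open) Finite_Cartesian_Product.vec
no_notation vec_nth (infixl \<open>$\<close> 90)
no_notation inner (infix \<open>\<bullet>\<close> 70)

text \<open>The sets below live in \<open>\<real>\<^sup>0, \<real>\<^sup>1, \<dots>, \<real>\<^sup>n\<close> at the same time, so a point of \<open>\<real>\<^sup>d\<close> is a
  function \<open>nat \<Rightarrow> real\<close> that is extensional on \<open>{..<d}\<close>. The space \<open>\<real>\<^sup>0\<close> is the singleton
  \<open>{\<lambda>_. undefined}\<close>. Coordinates are numbered from 0, so \<open>(x, y)\<close> with \<open>x \<in> \<real>\<^sup>d\<close> is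
  \<open>x(d := y)\<close>. The topology is the one of the product type, which induces the Euclidean
  topology on each \<open>\<real>\<^sup>d\<close>.\<close>

definition Rn :: "nat \<Rightarrow> (nat \<Rightarrow> real) set" where
  "Rn d = ({..<d} \<rightarrow>\<^sub>E UNIV)"

definition cube :: "nat \<Rightarrow> (nat \<Rightarrow> real) set" where
  "cube d = ({..<d} \<rightarrow>\<^sub>E {-1/2..1/2})"

definition cube_measure :: "nat \<Rightarrow> (nat \<Rightarrow> real) measure" where
  "cube_measure d = restrict_space (\<Pi>\<^sub>M i\<in>{..<d}. lborel) (cube d)"


subsection \<open>\<open>C\<^sup>m\<close> functions and norms\<close>

definition partial :: "nat \<Rightarrow> ((nat \<Rightarrow> real) \<Rightarrow> real) \<Rightarrow> (nat \<Rightarrow> real) \<Rightarrow> real" where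
  "partial j f x = deriv (\<lambda>t. f (x(j := t))) (x j)"

text \<open>All iterated partial derivatives of order at most \<open>m\<close> exist and are continuous on the
  set \<open>U\<close>, which is meant to be open in \<open>\<real>\<^sup>d\<close>.\<close>

primrec Cm_open :: "nat \<Rightarrow> nat \<Rightarrow> (nat \<Rightarrow> real) set \<Rightarrow> ((nat \<Rightarrow> real) \<Rightarrow> real) \<Rightarrow> bool" where
  "Cm_open 0 d U f \<longleftrightarrow> continuous_on U f"
| "Cm_open (Suc m) d U f \<longleftrightarrow> continuous_on U f \<and>
     (\<forall>j<d. (\<forall>x\<in>U. (\<lambda>t. f (x(j := t))) field_differentiable at (x j)) \<and>
            Cm_open m d U (partial j f))"

definition Cm_on :: "nat \<Rightarrow> nat \<Rightarrow> (nat \<Rightarrow> real) set \<Rightarrow> ((nat \<Rightarrow> real) \<Rightarrow> real) \<Rightarrow> bool" where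
  "Cm_on m d A g \<longleftrightarrow>
     (\<exists>U h. openin (top_of_set (Rn d)) U \<and> A \<subseteq> U \<and> Cm_open m d U h \<and> (\<forall>x\<in>A. h x = g x))"

text \<open>\<open>mpartial d \<alpha> f\<close> is \<open>\<partial>\<^sup>\<alpha> f\<close> for the multi-index \<open>(\<alpha> 0, \<dots>, \<alpha> (d - 1))\<close>.\<close>

primrec mpartial :: "nat \<Rightarrow> (nat \<Rightarrow> nat) \<Rightarrow> ((nat \<Rightarrow> real) \<Rightarrow> real) \<Rightarrow> (nat \<Rightarrow> real) \<Rightarrow> real" where
  "mpartial 0 \<alpha> f = f"
| "mpartial (Suc k) \<alpha> f = (partial k ^^ \<alpha> k) (mpartial k \<alpha> f)"

definition sobolev_norm :: "nat \<Rightarrow> nat \<Rightarrow> ((nat \<Rightarrow> real) \<Rightarrow> real) \<Rightarrow> ereal" where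
  "sobolev_norm m d F =
     Max ((\<lambda>\<alpha>. esssup (cube_measure d) (\<lambda>x. ereal \<bar>mpartial d \<alpha> F x\<bar>)) `
          {\<alpha> \<in> {..<d} \<rightarrow>\<^sub>E UNIV. (\<Sum>j<d. \<alpha> j) \<le> m})"

text \<open>The value is \<open>\<infinity>\<close> for functions outside \<open>L\<^sup>p\<close>, so that a finite bound on the norm
  includes membership in \<open>L\<^sup>p\<close>. Measurability refers to the given measure; for
  \<^const>\<open>cube_measure\<close> it is Borel measurability.\<close>

definition Lp_norm :: "real \<Rightarrow> 'a measure \<Rightarrow> ('a \<Rightarrow> real) \<Rightarrow> ereal" where
  "Lp_norm p M f =
     (if f \<in> borel_measurable M \<and> integrable M (\<lambda>x. \<bar>f x\<bar> powr p)
      then ereal ((\<integral>x. \<bar>f x\<bar> powr p \<partial>M) powr (1 / p)) else \<infinity>)"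


subsection \<open>Traceable sets\<close>

definition band :: "nat \<Rightarrow> ((nat \<Rightarrow> real) \<Rightarrow> real) \<Rightarrow> ((nat \<Rightarrow> real) \<Rightarrow> real) \<Rightarrow>
    (nat \<Rightarrow> real) set \<Rightarrow> (nat \<Rightarrow> real) set" where
  "band d f g A = {x(d := y) | x y. x \<in> A \<and> f x < y \<and> y < g x}"

definition graph_over :: "nat \<Rightarrow> ((nat \<Rightarrow> real) \<Rightarrow> real) \<Rightarrow> (nat \<Rightarrow> real) set \<Rightarrow> (nat \<Rightarrow> real) set" where
  "graph_over d f A = {x(d := f x) | x. x \<in> A}"

definition proj :: "nat \<Rightarrow> (nat \<Rightarrow> real) \<Rightarrow> (nat \<Rightarrow> real)" where
  "proj i x = restrict x {..<i - 1}"

text \<open>The sets \<open>As 0, \<dots>, As n\<close> and the functions \<open>f i, g i\<close> on \<open>As (i - 1)\<close> witness that \<open>A\<close>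
  is \<open>m\<close>-traceable. The set \<open>(f, f)\<^sub>A\<close> is by convention the graph of \<open>f\<close>.\<close>

definition traces :: "nat \<Rightarrow> nat \<Rightarrow> (nat \<Rightarrow> real) set \<Rightarrow> (nat \<Rightarrow> (nat \<Rightarrow> real) set) \<Rightarrow>
    (nat \<Rightarrow> (nat \<Rightarrow> real) \<Rightarrow> real) \<Rightarrow> (nat \<Rightarrow> (nat \<Rightarrow> real) \<Rightarrow> real) \<Rightarrow> bool" where
  "traces m n A As f g \<longleftrightarrow>
     As n = A \<and> As 0 = Rn 0 \<and>
     (\<forall>i\<in>{1..n}.
        As i \<subseteq> Rn i \<and>
        Cm_on m (i - 1) (As (i - 1)) (f i) \<and> bounded (f i ` As (i - 1)) \<and>
        Cm_on m (i - 1) (As (i - 1)) (g i) \<and> bounded (g i ` As (i - 1)) \<and>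
        proj i ` As i = As (i - 1) \<and>
        ((\<forall>x\<in>As (i - 1). f i x < g i x) \<and> As i = band (i - 1) (f i) (g i) (As (i - 1)) \<or>
         (\<forall>x\<in>As (i - 1). f i x = g i x) \<and> As i = graph_over (i - 1) (f i) (As (i - 1))))"

definition traceable :: "nat \<Rightarrow> nat \<Rightarrow> (nat \<Rightarrow> real) set \<Rightarrow> bool" where
  "traceable m n A \<longleftrightarrow> A \<subseteq> Rn n \<and> (\<exists>As f g. traces m n A As f g)"

definition K_cells :: "nat \<Rightarrow> nat \<Rightarrow> real \<Rightarrow> (nat \<Rightarrow> real) set set" where
  "K_cells m n B =
     {A. A \<subseteq> cube n \<and> traceable m n A \<and>
         (\<exists>As f g. traces m n A As f g \<and>
            (\<forall>i\<in>{1..n}. \<exists>F G.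
               Cm_open m (i - 1) (Rn (i - 1)) F \<and> Cm_open m (i - 1) (Rn (i - 1)) G \<and>
               (\<forall>x\<in>As (i - 1). F x = f i x) \<and> (\<forall>x\<in>As (i - 1). G x = g i x) \<and>
               sobolev_norm m (i - 1) F \<le> ereal B \<and> sobolev_norm m (i - 1) G \<le> ereal B))}"

definition K_unions :: "nat \<Rightarrow> nat \<Rightarrow> real \<Rightarrow> nat \<Rightarrow> (nat \<Rightarrow> real) set set" where
  "K_unions m n B ell =
     {\<Omega>. \<Omega> \<subseteq> cube n \<and>
         (\<exists>l\<le>ell. \<exists>A. (\<forall>k<l. A k \<in> K_cells m n B) \<and> disjoint_family_on A {..<l} \<and>
                    \<Omega> = (\<Union>k<l. A k))}"


subsection \<open>ReLU neural networks\<close>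

type_synonym relu_net = "(real mat \<times> real vec) list"

definition net_depth :: "relu_net \<Rightarrow> nat" where
  "net_depth \<Phi> = length \<Phi> - 1"

text \<open>\<open>\<Phi>\<close> is a network with input dimension \<open>din\<close> and output dimension \<open>dout\<close>; its entries
  are indexed by \<open>0, \<dots>, L\<close>.\<close>

definition is_relu_net :: "nat \<Rightarrow> nat \<Rightarrow> relu_net \<Rightarrow> bool" where
  "is_relu_net din dout \<Phi> \<longleftrightarrow>
     (\<exists>L d. L \<ge> 1 \<and> length \<Phi> = L + 1 \<and> d 0 = din \<and> d (L + 1) = dout \<and>
        (\<forall>i\<le>L + 1. d i \<ge> (1::nat)) \<and>
        (\<forall>i\<le>L. fst (\<Phi> ! i) \<in> carrier_mat (d (i + 1)) (d i) \<and>
                snd (\<Phi> ! i) \<in> carrier_vec (d (i + 1))))"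

primrec net_layer :: "relu_net \<Rightarrow> real vec \<Rightarrow> nat \<Rightarrow> real vec" where
  "net_layer \<Phi> x 0 = x"
| "net_layer \<Phi> x (Suc i) = map_vec (max 0) (fst (\<Phi> ! i) *\<^sub>v net_layer \<Phi> x i + snd (\<Phi> ! i))"

definition net_apply :: "relu_net \<Rightarrow> real vec \<Rightarrow> real vec" where
  "net_apply \<Phi> x =
     (let L = net_depth \<Phi> in fst (\<Phi> ! L) *\<^sub>v net_layer \<Phi> x L + snd (\<Phi> ! L))"

text \<open>The real-valued function on \<open>\<real>\<^sup>n\<close> given by a network with one-dimensional output.\<close>

definition net_fun :: "nat \<Rightarrow> relu_net \<Rightarrow> (nat \<Rightarrow> real) \<Rightarrow> real" where
  "net_fun n \<Phi> x = net_apply \<Phi> (vec n x) $ 0"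

definition net_size :: "relu_net \<Rightarrow> nat" where
  "net_size \<Phi> =
     (\<Sum>(W, b)\<leftarrow>\<Phi>. card {(i, j). i < dim_row W \<and> j < dim_col W \<and> W $$ (i, j) \<noteq> 0} +
                  card {i. i < dim_vec b \<and> b $ i \<noteq> 0})"

text \<open>Zero entries are included in the maximum, so that it is 0 for a network without
  non-zero entries.\<close>

definition net_max :: "relu_net \<Rightarrow> real" where
  "net_max \<Phi> = Max (abs ` (\<Union>(W, b)\<in>set \<Phi>. elements_mat W \<union> {b $ i | i. i < dim_vec b}))"

end

theory Submission
  imports Defs
begin

text \<open>A cell is either a null set, being contained in a graph, or it is cut out of the cube by \<open>2 n\<close> inequalities \<open>F\<^sub>i(x\<^sub>0, \<dots>, x\<^sub>i\<^sub>-\<^sub>1) < x\<^sub>i < G\<^sub>i(x\<^sub>0, \<dots>, x\<^sub>i\<^sub>-\<^sub>1)\<close>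
with \<open>C\<^sup>m\<close> functions \<open>F\<^sub>i, G\<^sub>i\<close> of at most \<open>n - 1\<close> variables. If \<open>A\<close> approximates \<open>F\<^sub>i\<close> up to \<open>c N\<^sup>-\<^sup>m\<close>, then the
ramp \<open>clamp01 (N\<^sup>m (x\<^sub>i - A))\<close> is exactly the truth value of \<open>F\<^sub>i < x\<^sub>i\<close> wherever
\<open>\<bar>x\<^sub>i - F\<^sub>i\<bar> > (c + 1) N\<^sup>-\<^sup>m\<close>. By Fubini the remaining layer around the graph has measure
\<open>O(N\<^sup>-\<^sup>m)\<close>. Conjunctions of exact truth values, and sums over disjoint cells, are one more ramp
each (\<open>approx_cell\<close>, \<open>approx_union_of_cells\<close>). The network thus takes values in \<open>[0,1]\<close> and equals the
indicator off a set of measure \<open>O(N\<^sup>-\<^sup>m)\<close>. Its \<open>L\<^sup>p\<close> error is at most the \<open>p\<close>-th root of that measure,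
so \<open>N\<close> of order \<open>\<epsilon>\<^sup>-\<^sup>p\<^sup>/\<^sup>m\<close> suffices, and \<open>N\<^sup>n\<^sup>-\<^sup>1\<close> is the order of the claimed size.

It remains to approximate a \<open>C\<^sup>m\<close> function of \<open>d < n\<close> variables up to \<open>O(N\<^sup>-\<^sup>m)\<close>, off a set of measure
\<open>O(N\<^sup>-\<^sup>m)\<close>, by networks of size \<open>O(N\<^sup>n\<^sup>-\<^sup>1)\<close> whose depth does not depend on \<open>N\<close> (\<open>approx_smooth\<close>). Divide the
cube into \<open>N\<^sup>d\<close> cubes of side \<open>1/N\<close> and use the Taylor polynomial at the corner of the cube that
contains the point (\<open>taylor_multi\<close>). Steep staircases compute the index of this cube, exactly off thin strips;
a piecewise linear function of the index looks up each Taylor coefficient. This costs \<open>O(N\<^sup>d)\<close> weights for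
each of the boundedly many coefficients. Each monomial is a product of at most \<open>m\<close> factors, one of
them looked up, so \<open>\<lceil>log\<^sub>2 m\<rceil>\<close> rounds of pairwise multiplication suffice.

Products reduce to squares. With \<open>w = N\<^sup>n\<^sup>-\<^sup>1\<close> teeth, a sawtooth \<open>T\<close> and the piecewise linear interpolant
\<open>J\<close> of the square satisfy \<open>z\<^sup>2 = J(z) - T(z)/w\<^sup>2 + T(z)\<^sup>2/w\<^sup>2\<close>. Iterating this identity \<open>q\<close> times leaves an
error \<open>w\<^sup>-\<^sup>2\<^sup>q\<close> (\<open>approx_square_error\<close>), which is at most \<open>N\<^sup>-\<^sup>m\<close> for \<open>q\<close> about \<open>m/(2(n-1))\<close>. This is the source of the
term \<open>2m/n\<close> in the depth bound.

All constants have to be uniform in \<open>N\<close> and \<open>\<Omega>\<close>. The constructions are therefore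
carried out for families of functions indexed by such data, and \<open>realized\<close> asserts bounds on
depth, size and weights that hold for all members of the family at once.\<close>

section \<open>Networks as layers of functions\<close>

text \<open>A layer is represented by the finite set of the functions of the input that its neurons compute. Two networks of the
same depth then run in parallel on the union of their layers; neurons that compute the same
function are merged, which can only make the network smaller. The number \<open>s\<close> bounds the number of weights
including the bias, which is counted even if it vanishes.\<close>

definition affine_comb ::
    "(('a \<Rightarrow> real) set) \<Rightarrow> real \<Rightarrow> nat \<Rightarrow> ('a \<Rightarrow> real) \<Rightarrow> bool" where
  "affine_comb F M s g \<longleftrightarrow>
     (\<exists>U w b. finite U \<and> U \<subseteq> F \<and> Suc (card U) \<le> s \<and> (\<forall>u\<in>U. \<bar>w u\<bar> \<le> M) \<and> \<bar>b\<bar> \<le> M \<and>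
              (\<forall>x. g x = (\<Sum>u\<in>U. w u * u x) + b))"

definition neuron ::
    "(('a \<Rightarrow> real) set) \<Rightarrow> real \<Rightarrow> nat \<Rightarrow> ('a \<Rightarrow> real) \<Rightarrow> bool" where
  "neuron F M s g \<longleftrightarrow> (\<exists>u. affine_comb F M s u \<and> g = (\<lambda>x. max 0 (u x)))"

text \<open>Layer 0 consists of the coordinate functions and costs nothing, so that parallel networks share their input. The
output layer is left out: as long as it is a separate affine combination, networks can be added and composed further.\<close>

inductive hidden ::
    "nat \<Rightarrow> real \<Rightarrow> nat \<Rightarrow> nat \<Rightarrow> ((nat \<Rightarrow> real) \<Rightarrow> real) set \<Rightarrow> bool"
  for n :: nat and M :: real where
  hidden_input: "hidden n M 0 0 ((\<lambda>j x. x j) ` {..<n})"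
| hidden_step: "\<lbrakk>hidden n M L S F; finite G; G \<noteq> {}; \<forall>g\<in>G. neuron F M (s g) g;
     S + (\<Sum>g\<in>G. s g) \<le> S'\<rbrakk> \<Longrightarrow> hidden n M (Suc L) S' G"

lemma affine_comb_mono:
  assumes "affine_comb F M s g" "F \<subseteq> F'" "M \<le> M'" "s \<le> s'"
  shows "affine_comb F' M' s' g"
proof -
  obtain U w b where U: "finite U" "U \<subseteq> F" "Suc (card U) \<le> s" "\<forall>u\<in>U. \<bar>w u\<bar> \<le> M" "\<bar>b\<bar> \<le> M"
      "\<forall>x. g x = (\<Sum>u\<in>U. w u * u x) + b"
    using assms(1) unfolding affine_comb_def by blast
  show ?thesis
    unfolding affine_comb_def
  proof (intro exI[of _ U] exI[of _ w] exI[of _ b] conjI)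
    show "U \<subseteq> F'" "Suc (card U) \<le> s'" "\<bar>b\<bar> \<le> M'" using U assms by auto
    show "\<forall>u\<in>U. \<bar>w u\<bar> \<le> M'" using U(4) assms(3) by force
  qed (use U in auto)
qed

lemma neuron_mono:
  "\<lbrakk>neuron F M s g; F \<subseteq> F'; M \<le> M'; s \<le> s'\<rbrakk> \<Longrightarrow> neuron F' M' s' g"
  unfolding neuron_def using affine_comb_mono by blast

text \<open>The functions \<open>g k\<close> may coincide, in which case their coefficients add up; hence the factor \<open>K\<close> in the
bound for the weights.\<close>

lemma affine_comb_sum:
  assumes "\<And>k. k < K \<Longrightarrow> g k \<in> F" and "\<And>k. k < K \<Longrightarrow> \<bar>a k\<bar> \<le> A" and "\<bar>b\<bar> \<le> real K * A + A"
    and "A \<ge> 0"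
  shows "affine_comb F (real K * A + A) (Suc K) (\<lambda>x. (\<Sum>k<K. a k * g k x) + b)"
proof -
  let ?U = "g ` {..<K}"
  let ?w = "\<lambda>u. \<Sum>k\<in>{k\<in>{..<K}. g k = u}. a k"
  have eq: "(\<Sum>k<K. a k * g k x) = (\<Sum>u\<in>?U. ?w u * u x)" for x
  proof -
    have "(\<Sum>k<K. a k * g k x) = (\<Sum>u\<in>?U. \<Sum>k\<in>{k\<in>{..<K}. g k = u}. a k * g k x)"
      by (rule sum.image_gen) simp
    also have "\<dots> = (\<Sum>u\<in>?U. ?w u * u x)"
      unfolding sum_distrib_right by (intro sum.cong refl) auto
    finally show ?thesis .
  qed
  have w: "\<bar>?w u\<bar> \<le> real K * A + A" for u
  proof -
    have "\<bar>?w u\<bar> \<le> (\<Sum>k\<in>{k\<in>{..<K}. g k = u}. A)"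
      by (rule order_trans[OF sum_abs], rule sum_mono) (use assms(2) in auto)
    also have "\<dots> \<le> (\<Sum>k<K. A)"
      by (rule sum_mono2) (use assms(4) in auto)
    finally show ?thesis using assms(4) by simp
  qed
  show ?thesis
    unfolding affine_comb_def
    by (intro exI[of _ ?U] exI[of _ ?w] exI[of _ b] conjI)
       (use assms(1,3) w card_image_le[of "{..<K}" g] in \<open>auto simp: eq\<close>)
qed

lemma affine_comb_lin:
  assumes f: "affine_comb F M s f" and g: "affine_comb F M s' g" and A: "\<bar>a\<bar> \<le> A" "\<bar>b\<bar> \<le> A" "\<bar>c\<bar> \<le> A"
    and M: "M \<ge> 1"
  shows "affine_comb F (3 * A * M) (s + s') (\<lambda>x. a * f x + b * g x + c)"
proof -
  obtain U w e where U: "finite U" "U \<subseteq> F" "Suc (card U) \<le> s" "\<forall>u\<in>U. \<bar>w u\<bar> \<le> M" "\<bar>e\<bar> \<le> M"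
      "\<forall>x. f x = (\<Sum>u\<in>U. w u * u x) + e"
    using f unfolding affine_comb_def by blast
  obtain U' w' e' where U': "finite U'" "U' \<subseteq> F" "Suc (card U') \<le> s'" "\<forall>u\<in>U'. \<bar>w' u\<bar> \<le> M" "\<bar>e'\<bar> \<le> M"
      "\<forall>x. g x = (\<Sum>u\<in>U'. w' u * u x) + e'"
    using g unfolding affine_comb_def by blast
  let ?v = "\<lambda>u. (if u \<in> U then a * w u else 0) + (if u \<in> U' then b * w' u else 0)"
  have A0: "A \<ge> 0" using A by linarith
  have p: "\<bar>p * q\<bar> \<le> A * M" if "\<bar>p\<bar> \<le> A" "\<bar>q\<bar> \<le> M" for p q :: real
    unfolding abs_mult using that A0 by (intro mult_mono) auto
  have AM: "A \<le> A * M" "0 \<le> A * M" using A0 M by (simp_all add: mult_left_mono[of 1 M A, simplified])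
  have v: "\<bar>?v u\<bar> \<le> 3 * A * M" for u
  proof -
    have "\<bar>if u \<in> U then a * w u else 0\<bar> \<le> A * M" using p[of a "w u"] AM U(4) A by auto
    moreover have "\<bar>if u \<in> U' then b * w' u else 0\<bar> \<le> A * M" using p[of b "w' u"] AM U'(4) A by auto
    ultimately show ?thesis using AM(2) by linarith
  qed
  have s1: "(\<Sum>u\<in>U \<union> U'. (if u \<in> U then a * w u else 0) * u x) = a * (\<Sum>u\<in>U. w u * u x)" for x
  proof -
    have "(\<Sum>u\<in>U \<union> U'. (if u \<in> U then a * w u else 0) * u x) = (\<Sum>u\<in>U. (if u \<in> U then a * w u else 0) * u x)"
      by (rule sum.mono_neutral_right) (use U(1) U'(1) in auto)
    then show ?thesis by (simp add: sum_distrib_left algebra_simps)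
  qed
  have s2: "(\<Sum>u\<in>U \<union> U'. (if u \<in> U' then b * w' u else 0) * u x) = b * (\<Sum>u\<in>U'. w' u * u x)" for x
  proof -
    have "(\<Sum>u\<in>U \<union> U'. (if u \<in> U' then b * w' u else 0) * u x) = (\<Sum>u\<in>U'. (if u \<in> U' then b * w' u else 0) * u x)"
      by (rule sum.mono_neutral_right) (use U(1) U'(1) in auto)
    then show ?thesis by (simp add: sum_distrib_left algebra_simps)
  qed
  show ?thesis
    unfolding affine_comb_def
  proof (intro exI[of _ "U \<union> U'"] exI[of _ ?v] exI[of _ "a * e + b * e' + c"] conjI)
    show "Suc (card (U \<union> U')) \<le> s + s'" using card_Un_le[of U U'] U U' by linarith
    show "\<bar>a * e + b * e' + c\<bar> \<le> 3 * A * M" using p[of a e] p[of b e'] A AM U(5) U'(5) by linarith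
    show "\<forall>x. a * f x + b * g x + c = (\<Sum>u\<in>U \<union> U'. ?v u * u x) + (a * e + b * e' + c)"
      unfolding distrib_right sum.distrib s1 s2 using U(6) U'(6) by (simp add: algebra_simps)
  qed (use U U' v in auto)
qed

lemma hidden_weaken:
  assumes "hidden n M L S F" "M \<le> M'" shows "hidden n M' L S F"
  using assms(1)
proof induction
  case hidden_input then show ?case by (rule hidden.hidden_input)
next
  case (hidden_step L S F G s S')
  then show ?case using neuron_mono[OF _ order_refl assms(2) order_refl] by (intro hidden.hidden_step) auto
qed

lemma hidden_0D: "hidden n M 0 S F \<Longrightarrow> S = 0 \<and> F = (\<lambda>j x. x j) ` {..<n}"
  by (erule hidden.cases) auto

lemma hidden_SucE:
  assumes "hidden n M (Suc L) S G"
  obtains F s S0 where "hidden n M L S0 F" "finite G" "G \<noteq> {}" "\<forall>g\<in>G. neuron F M (s g) g"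
    "S0 + (\<Sum>g\<in>G. s g) \<le> S"
  using assms by (cases rule: hidden.cases) auto

text \<open>Every neuron of either network may read the union of the two preceding layers, because unused neurons need no weight;
both networks share the input.\<close>

lemma hidden_union:
  "\<lbrakk>hidden n M (Suc L) S F; hidden n M (Suc L) S' F'\<rbrakk> \<Longrightarrow> hidden n M (Suc L) (S + S') (F \<union> F')"
proof (induction L arbitrary: S S' F F')
  have merge: "\<exists>s''. (\<forall>g\<in>G\<union>G'. neuron (H \<union> H') M (s'' g) g) \<and> (\<Sum>g\<in>G\<union>G'. s'' g) \<le> (\<Sum>g\<in>G. s g) + (\<Sum>g\<in>G'. s' g)"
    if "finite G" "finite G'" "\<forall>g\<in>G. neuron H M (s g) g" "\<forall>g\<in>G'. neuron H' M (s' g) g"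
    for G G' H H' :: "((nat \<Rightarrow> real) \<Rightarrow> real) set" and s s' :: "_ \<Rightarrow> nat"
  proof (intro exI conjI)
    let ?s = "\<lambda>g. if g \<in> G then s g else s' g"
    show "\<forall>g\<in>G\<union>G'. neuron (H \<union> H') M (?s g) g"
      using that neuron_mono[of H M _ _ "H \<union> H'" M] neuron_mono[of H' M _ _ "H \<union> H'" M] by auto
    have "(\<Sum>g\<in>G\<union>G'. ?s g) = (\<Sum>g\<in>G. ?s g) + (\<Sum>g\<in>G'-G. ?s g)"
      using that sum.union_disjoint[of G "G' - G" ?s] by auto
    also have "(\<Sum>g\<in>G'-G. ?s g) = (\<Sum>g\<in>G'-G. s' g)" by (rule sum.cong) auto
    also have "\<dots> \<le> (\<Sum>g\<in>G'. s' g)" by (rule sum_mono2) (use that in auto)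
    finally show "(\<Sum>g\<in>G\<union>G'. ?s g) \<le> (\<Sum>g\<in>G. s g) + (\<Sum>g\<in>G'. s' g)" by simp
  qed
  {
    case 0
    obtain s where 1: "finite F" "F \<noteq> {}" "\<forall>g\<in>F. neuron ((\<lambda>j x. x j) ` {..<n}) M (s g) g" "(\<Sum>g\<in>F. s g) \<le> S"
      by (rule hidden_SucE[OF 0(1)], drule hidden_0D) auto
    obtain s' where 2: "finite F'" "F' \<noteq> {}" "\<forall>g\<in>F'. neuron ((\<lambda>j x. x j) ` {..<n}) M (s' g) g" "(\<Sum>g\<in>F'. s' g) \<le> S'"
      by (rule hidden_SucE[OF 0(2)], drule hidden_0D) auto
    from merge[OF 1(1) 2(1) 1(3) 2(3)] obtain s'' where
      3: "\<forall>g\<in>F\<union>F'. neuron ((\<lambda>j x. x j) ` {..<n}) M (s'' g) g" "(\<Sum>g\<in>F\<union>F'. s'' g) \<le> (\<Sum>g\<in>F. s g) + (\<Sum>g\<in>F'. s' g)"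
      by auto
    show ?case
      by (rule hidden_step[OF hidden_input _ _ 3(1)]) (use 1 2 3(2) in auto)
  next
    case (Suc L)
    obtain H s S1 where 1: "hidden n M (Suc L) S1 H" "finite F" "F \<noteq> {}" "\<forall>g\<in>F. neuron H M (s g) g" "S1 + (\<Sum>g\<in>F. s g) \<le> S"
      by (rule hidden_SucE[OF Suc.prems(1)])
    obtain H' s' S1' where 2: "hidden n M (Suc L) S1' H'" "finite F'" "F' \<noteq> {}" "\<forall>g\<in>F'. neuron H' M (s' g) g" "S1' + (\<Sum>g\<in>F'. s' g) \<le> S'"
      by (rule hidden_SucE[OF Suc.prems(2)])
    from merge[OF 1(2) 2(2) 1(4) 2(4)] obtain s'' where
      3: "\<forall>g\<in>F\<union>F'. neuron (H \<union> H') M (s'' g) g" "(\<Sum>g\<in>F\<union>F'. s'' g) \<le> (\<Sum>g\<in>F. s g) + (\<Sum>g\<in>F'. s' g)"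
      by auto
    show ?case
      by (rule hidden_step[OF Suc.IH[OF 1(1) 2(1)] _ _ 3(1)]) (use 1 2 3(2) in auto)
  }
qed

section \<open>Realization by weight matrices\<close>

definition layer_size :: "real mat \<times> real vec \<Rightarrow> nat" where
  "layer_size l =
     card {(i, j). i < dim_row (fst l) \<and> j < dim_col (fst l) \<and> fst l $$ (i, j) \<noteq> 0} +
     card {i. i < dim_vec (snd l) \<and> snd l $ i \<noteq> 0}"

definition layer_bounded :: "real \<Rightarrow> real mat \<times> real vec \<Rightarrow> bool" where
  "layer_bounded M l \<longleftrightarrow>
     (\<forall>i<dim_row (fst l). \<forall>j<dim_col (fst l). \<bar>fst l $$ (i, j)\<bar> \<le> M) \<and>
     (\<forall>i<dim_vec (snd l). \<bar>snd l $ i\<bar> \<le> M)"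

lemma net_size_layers: "net_size \<Phi> = sum_list (map layer_size \<Phi>)"
  unfolding net_size_def layer_size_def by (simp add: case_prod_unfold)

lemma net_max_le:
  assumes "\<Phi> \<noteq> []" and "\<And>l. l \<in> set \<Phi> \<Longrightarrow> layer_bounded M l"
    and "\<And>l. l \<in> set \<Phi> \<Longrightarrow> dim_vec (snd l) \<noteq> 0"
  shows "net_max \<Phi> \<le> M"
proof -
  let ?E = "\<Union>(W, b)\<in>set \<Phi>. elements_mat W \<union> {b $ i | i. i < dim_vec b}"
  have "finite ?E" unfolding elements_mat_def
    by (intro finite_UN_I) (auto simp: setcompr_eq_image)
  moreover have "?E \<noteq> {}"
  proof -
    obtain W b \<Psi> where "\<Phi> = (W, b) # \<Psi>" using assms(1) by (cases \<Phi>) auto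
    moreover from this have "0 < dim_vec b" using assms(3)[of "(W, b)"] by (metis list.set_intros(1) snd_conv gr0I)
    ultimately have "b $ 0 \<in> ?E" by (intro UN_I[of "(W, b)"]) auto
    then show ?thesis by blast
  qed
  moreover have "\<bar>e\<bar> \<le> M" if e: "e \<in> ?E" for e
  proof -
    obtain W b where Wb: "(W, b) \<in> set \<Phi>" "e \<in> elements_mat W \<union> {b $ i | i. i < dim_vec b}"
      using e by blast
    have "layer_bounded M (W, b)" using assms(2) Wb(1) .
    then show ?thesis using Wb(2) unfolding layer_bounded_def elements_mat_def by auto
  qed
  ultimately show ?thesis unfolding net_max_def by (subst Max_le_iff) auto
qed

text \<open>Rows of the matrix are indexed by the combinations and columns by the enumeration \<open>fs\<close> of the
layer below, so that the non-zero entries of a row correspond to functions used by one combination.\<close>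

lemma affine_layer:
  fixes fs :: "((nat \<Rightarrow> real) \<Rightarrow> real) list"
  assumes "distinct fs" and "\<And>i. i < r \<Longrightarrow> affine_comb (set fs) M (s i) (g i)" and "M \<ge> 0"
  shows "\<exists>W b. W \<in> carrier_mat r (length fs) \<and> b \<in> carrier_vec r \<and>
           (\<forall>x. W *\<^sub>v vec (length fs) (\<lambda>j. (fs ! j) x) + b = vec r (\<lambda>i. g i x)) \<and>
           layer_size (W, b) \<le> (\<Sum>i<r. s i) \<and> layer_bounded M (W, b)"
proof -
  let ?k = "length fs"
  define P where "P = (\<lambda>i U w b. finite U \<and> U \<subseteq> set fs \<and> Suc (card U) \<le> s i \<and>
      (\<forall>u\<in>U. \<bar>w u\<bar> \<le> M) \<and> \<bar>b\<bar> \<le> M \<and> (\<forall>x. g i x = (\<Sum>u\<in>U. w u * u x) + b))"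
  have "\<exists>t. i < r \<longrightarrow> P i (fst t) (fst (snd t)) (snd (snd t))" for i
  proof (cases "i < r")
    case True
    then obtain U w b where "P i U w b"
      using assms(2)[OF True] unfolding affine_comb_def P_def by blast
    then show ?thesis by (intro exI[of _ "(U, w, b)"]) simp
  qed simp
  then obtain t where "\<And>i. i < r \<Longrightarrow> P i (fst (t i)) (fst (snd (t i))) (snd (snd (t i)))"
    using choice[of "\<lambda>i t. i < r \<longrightarrow> P i (fst t) (fst (snd t)) (snd (snd t))"] by blast
  moreover define U w b where "U = fst \<circ> t" and "w = fst \<circ> snd \<circ> t" and "b = snd \<circ> snd \<circ> t"
  ultimately have "\<And>i. i < r \<Longrightarrow> P i (U i) (w i) (b i)" by simp
  then have U: "\<And>i. i < r \<Longrightarrow> finite (U i)" "\<And>i. i < r \<Longrightarrow> U i \<subseteq> set fs"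
      "\<And>i. i < r \<Longrightarrow> Suc (card (U i)) \<le> s i" "\<And>i u. i < r \<Longrightarrow> u \<in> U i \<Longrightarrow> \<bar>w i u\<bar> \<le> M"
      "\<And>i. i < r \<Longrightarrow> \<bar>b i\<bar> \<le> M" "\<And>i x. i < r \<Longrightarrow> g i x = (\<Sum>u\<in>U i. w i u * u x) + b i"
    unfolding P_def by blast+
  let ?c = "\<lambda>i u. if u \<in> U i then w i u else 0"
  define W where "W = mat r ?k (\<lambda>(i, j). ?c i (fs ! j))"
  define v where "v = vec r b"
  have bij: "bij_betw ((!) fs) {..<?k} (set fs)" using assms(1) by (intro bij_betw_nth) auto
  have row: "(\<Sum>j<?k. ?c i (fs ! j) * (fs ! j) x) + b i = g i x" if "i < r" for i x
  proof -
    have "(\<Sum>j<?k. ?c i (fs ! j) * (fs ! j) x) = (\<Sum>u\<in>set fs. ?c i u * u x)"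
      by (rule sum.reindex_bij_betw[OF bij])
    also have "\<dots> = (\<Sum>u\<in>U i. ?c i u * u x)"
      by (rule sum.mono_neutral_right) (use U(2)[OF that] in auto)
    also have "\<dots> = (\<Sum>u\<in>U i. w i u * u x)" by (rule sum.cong) auto
    finally show ?thesis using U(6)[OF that] by simp
  qed
  have eval: "W *\<^sub>v vec ?k (\<lambda>j. (fs ! j) x) + v = vec r (\<lambda>i. g i x)" for x
  proof (rule eq_vecI)
    fix i assume "i < dim_vec (vec r (\<lambda>i. g i x))"
    then have i: "i < r" by simp
    have "(W *\<^sub>v vec ?k (\<lambda>j. (fs ! j) x) + v) $ i = (\<Sum>j<?k. ?c i (fs ! j) * (fs ! j) x) + b i"
      unfolding W_def v_def using i by (simp add: scalar_prod_def lessThan_atLeast0)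
    then show "(W *\<^sub>v vec ?k (\<lambda>j. (fs ! j) x) + v) $ i = vec r (\<lambda>i. g i x) $ i"
      using row[OF i] i by simp
  qed (simp_all add: v_def)
  have "card {(i, j). i < dim_row W \<and> j < dim_col W \<and> W $$ (i, j) \<noteq> 0}
      \<le> card (SIGMA i:{..<r}. {j\<in>{..<?k}. fs ! j \<in> U i})"
    by (rule card_mono) (auto simp: W_def split: if_splits)
  also have "\<dots> = (\<Sum>i<r. card {j\<in>{..<?k}. fs ! j \<in> U i})" by simp
  also have "\<dots> \<le> (\<Sum>i<r. card (U i))"
  proof (rule sum_mono)
    fix i assume "i \<in> {..<r}"
    then have "finite (U i)" using U(1) by simp
    then show "card {j\<in>{..<?k}. fs ! j \<in> U i} \<le> card (U i)"
      by (intro card_inj_on_le[of "(!) fs"]) (use bij in \<open>auto simp: bij_betw_def intro: inj_on_subset\<close>)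
  qed
  finally have c1: "card {(i, j). i < dim_row W \<and> j < dim_col W \<and> W $$ (i, j) \<noteq> 0} \<le> (\<Sum>i<r. card (U i))" .
  have c2: "card {i. i < dim_vec v \<and> v $ i \<noteq> 0} \<le> (\<Sum>i<r. 1)"
    using card_mono[of "{..<r}" "{i. i < dim_vec v \<and> v $ i \<noteq> 0}"] by (auto simp: v_def)
  have "layer_size (W, v) \<le> (\<Sum>i<r. card (U i) + 1)"
    unfolding layer_size_def sum.distrib using c1 c2 by simp
  also have "\<dots> \<le> (\<Sum>i<r. s i)" by (rule sum_mono) (use U(3) in simp)
  finally have size: "layer_size (W, v) \<le> (\<Sum>i<r. s i)" .
  have le: "layer_bounded M (W, v)"
    unfolding layer_bounded_def W_def v_def using U(4,5) assms(3) by simp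
  show ?thesis
    by (rule exI[of _ W], rule exI[of _ v]) (use eval size le in \<open>simp add: W_def[symmetric] v_def[symmetric], simp add: W_def v_def\<close>)
qed

lemma net_layer_append:
  "i \<le> length \<Phi> \<Longrightarrow> net_layer (\<Phi> @ \<Psi>) x i = net_layer \<Phi> x i"
  by (induction i) (auto simp: nth_append)

text \<open>The connection between the two views: \<open>\<Psi>\<close> consists of the hidden layers with widths \<open>d\<close>, and the
value vector of its last layer lists the functions \<open>fs\<close>.\<close>

definition hidden_layers ::
    "nat \<Rightarrow> relu_net \<Rightarrow> (nat \<Rightarrow> nat) \<Rightarrow> ((nat \<Rightarrow> real) \<Rightarrow> real) list \<Rightarrow> bool" where
  "hidden_layers n \<Psi> d fs \<longleftrightarrow> distinct fs \<and> d 0 = n \<and> d (length \<Psi>) = length fs \<and>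
     (\<forall>i\<le>length \<Psi>. d i \<ge> 1) \<and>
     (\<forall>i<length \<Psi>. fst (\<Psi> ! i) \<in> carrier_mat (d (i + 1)) (d i) \<and> snd (\<Psi> ! i) \<in> carrier_vec (d (i + 1))) \<and>
     (\<forall>x. net_layer \<Psi> (vec n x) (length \<Psi>) = vec (length fs) (\<lambda>j. (fs ! j) x))"

lemma hidden_imp_layers:
  assumes "hidden n M L S F" and "n \<ge> 1" and "M \<ge> 0"
  shows "\<exists>\<Psi> d fs. hidden_layers n \<Psi> d fs \<and> length \<Psi> = L \<and> set fs = F \<and>
           net_size \<Psi> \<le> S \<and> (\<forall>l\<in>set \<Psi>. layer_bounded M l)"
  using assms(1)
proof induction
  case hidden_input
  let ?fs = "map (\<lambda>j x. x j) [0..<n] :: ((nat \<Rightarrow> real) \<Rightarrow> real) list"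
  have "inj (\<lambda>j (x :: nat \<Rightarrow> real). x j)"
  proof (rule injI)
    fix i j :: nat assume "(\<lambda>x :: nat \<Rightarrow> real. x i) = (\<lambda>x. x j)"
    then have "of_bool (i = i) = (of_bool (j = i) :: real)" by (rule fun_cong[where x = "\<lambda>k. of_bool (k = i)"])
    then show "i = j" by (simp split: if_splits)
  qed
  then have "distinct ?fs" unfolding distinct_map using inj_on_subset by auto
  moreover have "vec n x = vec (length ?fs) (\<lambda>j. (?fs ! j) x)" for x :: "nat \<Rightarrow> real"
    by (rule eq_vecI) simp_all
  ultimately have "hidden_layers n [] (\<lambda>_. n) ?fs"
    unfolding hidden_layers_def using assms(2) by simp
  then show ?case
    by (intro exI[of _ "[]"] exI[of _ "\<lambda>_. n"] exI[of _ ?fs]) (auto simp: net_size_layers)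
next
  case (hidden_step L S F G s S')
  obtain \<Psi> d fs where \<Psi>: "hidden_layers n \<Psi> d fs" "length \<Psi> = L" "set fs = F"
      "net_size \<Psi> \<le> S" "\<forall>l\<in>set \<Psi>. layer_bounded M l"
    using hidden_step.IH by blast
  obtain gs where gs: "set gs = G" "distinct gs" using finite_distinct_list hidden_step(2) by blast
  have "\<exists>u. \<forall>i<length gs. affine_comb F M (s (gs ! i)) (u i) \<and> gs ! i = (\<lambda>x. max 0 (u i x))"
  proof (intro choice allI)
    fix i
    show "\<exists>u. i < length gs \<longrightarrow> affine_comb F M (s (gs ! i)) u \<and> gs ! i = (\<lambda>x. max 0 (u x))"
      using hidden_step(4) gs(1) nth_mem[of i gs] unfolding neuron_def by blast
  qed
  then obtain u where u: "\<And>i. i < length gs \<Longrightarrow> affine_comb (set fs) M (s (gs ! i)) (u i)"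
      "\<And>i. i < length gs \<Longrightarrow> gs ! i = (\<lambda>x. max 0 (u i x))"
    using \<Psi>(3) by blast
  obtain W b where Wb: "W \<in> carrier_mat (length gs) (length fs)" "b \<in> carrier_vec (length gs)"
      "\<And>x. W *\<^sub>v vec (length fs) (\<lambda>j. (fs ! j) x) + b = vec (length gs) (\<lambda>i. u i x)"
      "layer_size (W, b) \<le> (\<Sum>i<length gs. s (gs ! i))" "layer_bounded M (W, b)"
    using affine_layer[of fs "length gs" M "\<lambda>i. s (gs ! i)" u] u(1) \<Psi>(1) assms(3) unfolding hidden_layers_def by blast
  let ?\<Psi> = "\<Psi> @ [(W, b)]" and ?d = "d(Suc L := length gs)"
  have lay: "net_layer ?\<Psi> (vec n x) (Suc L) = vec (length gs) (\<lambda>i. (gs ! i) x)" for x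
  proof -
    have "net_layer ?\<Psi> (vec n x) L = vec (length fs) (\<lambda>j. (fs ! j) x)"
      using net_layer_append[of L \<Psi> "[(W, b)]"] \<Psi>(1,2) unfolding hidden_layers_def by simp
    then have "net_layer ?\<Psi> (vec n x) (Suc L) = map_vec (max 0) (vec (length gs) (\<lambda>i. u i x))"
      using Wb(3)[of x] nth_append_length[of \<Psi> "(W, b)" "[]"] \<Psi>(2) by simp
    also have "\<dots> = vec (length gs) (\<lambda>i. (gs ! i) x)"
      by (rule eq_vecI) (auto simp: u(2))
    finally show ?thesis .
  qed
  have "length gs \<ge> 1" using gs(1) hidden_step(3) by (cases gs) auto
  have car: "fst (?\<Psi> ! i) \<in> carrier_mat (?d (i + 1)) (?d i) \<and> snd (?\<Psi> ! i) \<in> carrier_vec (?d (i + 1))"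
    if "i < Suc L" for i
    using that \<Psi>(1,2) Wb(1,2) unfolding hidden_layers_def by (cases "i = L") (simp_all add: nth_append)
  have "1 \<le> ?d i" if "i \<le> Suc L" for i
    using that \<Psi>(1,2) \<open>length gs \<ge> 1\<close> unfolding hidden_layers_def by (cases "i = Suc L") simp_all
  moreover have "?d 0 = n" using \<Psi>(1) unfolding hidden_layers_def by simp
  ultimately have "hidden_layers n ?\<Psi> ?d gs"
    unfolding hidden_layers_def using \<Psi>(2) gs(2) lay car by simp
  moreover have "net_size ?\<Psi> \<le> S'"
  proof -
    have "(\<Sum>i<length gs. s (gs ! i)) = (\<Sum>g\<in>G. s g)"
      using sum.reindex_bij_betw[OF bij_betw_nth[OF gs(2) refl refl], of s] gs(1) by simp
    then show ?thesis using Wb(4) \<Psi>(4) hidden_step(5) unfolding net_size_layers by simp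
  qed
  moreover have "length ?\<Psi> = Suc L" "\<forall>l\<in>set ?\<Psi>. layer_bounded M l" using \<Psi>(2,5) Wb(5) by auto
  ultimately show ?case using gs(1) by blast
qed

lemma hidden_imp_net:
  assumes h: "hidden n M L S F" and f: "affine_comb F M s f" and "n \<ge> 1" "L \<ge> 1" "M \<ge> 0"
  shows "\<exists>\<Phi>. is_relu_net n 1 \<Phi> \<and> net_depth \<Phi> = L \<and> net_size \<Phi> \<le> S + s \<and> net_max \<Phi> \<le> M \<and>
           (\<forall>x. net_fun n \<Phi> x = f x)"
proof -
  obtain \<Psi> d fs where \<Psi>: "hidden_layers n \<Psi> d fs" "length \<Psi> = L" "set fs = F"
      "net_size \<Psi> \<le> S" "\<forall>l\<in>set \<Psi>. layer_bounded M l"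
    using hidden_imp_layers[OF h] assms by blast
  obtain W b where Wb: "W \<in> carrier_mat 1 (length fs)" "b \<in> carrier_vec 1"
      "\<And>x. W *\<^sub>v vec (length fs) (\<lambda>j. (fs ! j) x) + b = vec 1 (\<lambda>i. f x)"
      "layer_size (W, b) \<le> (\<Sum>i<1::nat. s)" "layer_bounded M (W, b)"
    using affine_layer[of fs 1 M "\<lambda>_. s" "\<lambda>_. f"] f \<Psi>(1,3) assms(5) unfolding hidden_layers_def by blast
  let ?\<Phi> = "\<Psi> @ [(W, b)]" and ?d = "d(Suc L := 1)"
  have car: "fst (?\<Phi> ! i) \<in> carrier_mat (?d (i + 1)) (?d i) \<and> snd (?\<Phi> ! i) \<in> carrier_vec (?d (i + 1))"
    if "i \<le> L" for i
    using that \<Psi>(1,2) Wb(1,2) unfolding hidden_layers_def by (cases "i = L") (simp_all add: nth_append)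
  have pos: "?d i \<ge> 1" if "i \<le> L + 1" for i
    using that \<Psi>(1,2) unfolding hidden_layers_def by (cases "i = Suc L") simp_all
  have "is_relu_net n 1 ?\<Phi>"
    unfolding is_relu_net_def
  proof (intro exI conjI)
    show "?d 0 = n" using \<Psi>(1) unfolding hidden_layers_def by simp
    show "\<forall>i\<le>L. fst (?\<Phi> ! i) \<in> carrier_mat (?d (i + 1)) (?d i)
        \<and> snd (?\<Phi> ! i) \<in> carrier_vec (?d (i + 1))" using car by blast
    show "\<forall>i\<le>L + 1. 1 \<le> ?d i" using pos by blast
  qed (use \<Psi>(2) assms(4) in auto)
  moreover have "net_fun n ?\<Phi> x = f x" for x
  proof -
    have "net_layer ?\<Phi> (vec n x) L = vec (length fs) (\<lambda>j. (fs ! j) x)"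
      using net_layer_append[of L \<Psi> "[(W, b)]"] \<Psi>(1,2) unfolding hidden_layers_def by simp
    then show ?thesis
      using Wb(3)[of x] \<Psi>(2) unfolding net_fun_def net_apply_def net_depth_def by (simp add: nth_append)
  qed
  moreover have "net_max ?\<Phi> \<le> M"
  proof (rule net_max_le)
    fix l assume l: "l \<in> set ?\<Phi>"
    then show "layer_bounded M l" using \<Psi>(5) Wb(5) by auto
    have "\<exists>i<length ?\<Phi>. ?\<Phi> ! i = l" using l unfolding in_set_conv_nth by blast
    then obtain i where "i \<le> L" "l = ?\<Phi> ! i" using \<Psi>(2) by (metis Suc_eq_plus1 length_append_singleton less_Suc_eq_le)
    then have "snd l \<in> carrier_vec (?d (i + 1))" "?d (i + 1) \<ge> 1" using car[of i] pos[of "i + 1"] by simp_all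
    then show "dim_vec (snd l) \<noteq> 0" by (metis carrier_vecD not_one_le_zero)
  qed simp
  ultimately show ?thesis
    using \<Psi>(2,4) Wb(4) by (intro exI[of _ ?\<Phi>]) (simp add: net_depth_def net_size_layers)
qed

section \<open>Operations on realizable functions\<close>

text \<open>The exponent in the weight bound and the factor in the size bound are the same number \<open>C\<close>. The operations below
only ever enlarge both, and only the existence of some \<open>C\<close> matters in the end. The depth is \<open>L + 1\<close>, since a network has at
least one hidden layer.\<close>

definition realizable :: "nat \<Rightarrow> nat \<Rightarrow> nat \<Rightarrow> nat \<Rightarrow> ((nat \<Rightarrow> real) \<Rightarrow> real) \<Rightarrow> bool" where
  "realizable n N C L f \<longleftrightarrow>
     (\<exists>S F s. hidden n (real N ^ C) (Suc L) S F \<and> affine_comb F (real N ^ C) s f \<and> S + s \<le> C * N ^ (n - 1))"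

text \<open>The ramp \<open>min 1 (max 0 z)\<close>, written as a combination of two ReLU functions.\<close>

definition clamp01 :: "real \<Rightarrow> real" where
  "clamp01 z = max 0 z - max 0 (z - 1)"

lemma clamp01_simps: "z \<le> 0 \<Longrightarrow> clamp01 z = 0" "0 \<le> z \<Longrightarrow> z \<le> 1 \<Longrightarrow> clamp01 z = z" "1 \<le> z \<Longrightarrow> clamp01 z = 1"
  by (auto simp: clamp01_def)

lemma clamp01_range: "0 \<le> clamp01 z" "clamp01 z \<le> 1"
  by (auto simp: clamp01_def)

lemma three_le_square: "N \<ge> 2 \<Longrightarrow> 3 \<le> real N ^ 2"
  using power_mono[of 2 "real N" 2] by simp

lemma mesh_power_mono: "N \<ge> 2 \<Longrightarrow> a \<le> b \<Longrightarrow> real N ^ a \<le> real N ^ b"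
  by (rule power_increasing) auto

lemma affine_comb_single: "u \<in> F \<Longrightarrow> M \<ge> 1 \<Longrightarrow> affine_comb F M 2 u"
  unfolding affine_comb_def by (intro exI[of _ "{u}"] exI[of _ "\<lambda>_. 1"] exI[of _ 0]) auto

text \<open>A single hidden layer passes \<open>x\<^sub>j\<close> on as \<open>max 0 x\<^sub>j - max 0 (- x\<^sub>j)\<close>.\<close>

lemma realizable_coord:
  assumes "j < n" "N \<ge> 2"
  shows "realizable n N 12 0 (\<lambda>x. x j)"
proof -
  let ?I = "(\<lambda>j x. x j) ` {..<n} :: ((nat \<Rightarrow> real) \<Rightarrow> real) set"
  let ?p = "\<lambda>x :: nat \<Rightarrow> real. max 0 (x j)" and ?q = "\<lambda>x :: nat \<Rightarrow> real. max 0 (- x j)"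
  let ?M = "real N ^ 12"
  have M: "3 \<le> ?M" 
    by (rule order_trans[OF three_le_square[OF assms(2)] power_increasing]) (use assms(2) in auto)
  have 1: "affine_comb ?I 1 2 (\<lambda>x. x j)" by (rule affine_comb_single) (use assms in auto)
  have "affine_comb ?I ?M 4 (\<lambda>x. 1 * x j + 0 * x j + 0)" "affine_comb ?I ?M 4 (\<lambda>x. - 1 * x j + 0 * x j + 0)"
    by (rule affine_comb_mono[OF affine_comb_lin[OF 1 1, where A = 1]]; use M in simp)+
  then have n1: "neuron ?I ?M 4 ?p" "neuron ?I ?M 4 ?q" unfolding neuron_def by force+
  have h: "hidden n ?M (Suc 0) 8 {?p, ?q}"
    by (rule hidden_step[OF hidden_input, where s = "\<lambda>_. 4"]) (use n1 card_insert_le_m1[of 2 "{?q}" ?p] in auto)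
  have 2: "affine_comb {?p, ?q} 1 2 ?p" "affine_comb {?p, ?q} 1 2 ?q"
    by (rule affine_comb_single; simp)+
  have "affine_comb {?p, ?q} ?M 4 (\<lambda>x. 1 * ?p x + (- 1) * ?q x + 0)"
    by (rule affine_comb_mono[OF affine_comb_lin[OF 2, where A = 1]]) (use M in auto)
  then have "affine_comb {?p, ?q} ?M 4 (\<lambda>x. x j)"
    by (rule back_subst[where P = "affine_comb {?p, ?q} ?M 4"]) auto
  moreover have "8 + 4 \<le> 12 * N ^ (n - 1)" using assms by (simp add: Suc_le_eq)
  ultimately show ?thesis using h unfolding realizable_def by blast
qed

lemma realizable_lin:
  assumes f: "realizable n N C L f" and g: "realizable n N C' L g" and "N \<ge> 2"
    and "\<bar>a\<bar> \<le> real N ^ A" "\<bar>b\<bar> \<le> real N ^ A" "\<bar>c\<bar> \<le> real N ^ A"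
  shows "realizable n N (C + C' + A + 2) L (\<lambda>x. a * f x + b * g x + c)"
proof -
  obtain S F s where 1: "hidden n (real N ^ C) (Suc L) S F" "affine_comb F (real N ^ C) s f" "S + s \<le> C * N ^ (n - 1)"
    using f unfolding realizable_def by blast
  obtain S' F' s' where 2: "hidden n (real N ^ C') (Suc L) S' F'" "affine_comb F' (real N ^ C') s' g" "S' + s' \<le> C' * N ^ (n - 1)"
    using g unfolding realizable_def by blast
  let ?M = "real N ^ (C + C')" and ?M' = "real N ^ (C + C' + A + 2)"
  have N1: "real N \<ge> 1" using assms(3) by simp
  have M: "real N ^ C \<le> ?M" "real N ^ C' \<le> ?M" "?M \<le> ?M'" "1 \<le> ?M"
    by (rule mesh_power_mono[OF assms(3)], simp)+ (rule one_le_power[OF N1])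
  have "3 * (real N ^ A * ?M) \<le> real N ^ 2 * (real N ^ A * ?M)"
    using three_le_square[OF assms(3)] by (intro mult_right_mono) auto
  also have "\<dots> = ?M'" by (simp add: power_add power2_eq_square)
  finally have M3: "3 * real N ^ A * ?M \<le> ?M'" by (simp add: mult.assoc)
  have h: "hidden n ?M' (Suc L) (S + S') (F \<union> F')"
    by (rule hidden_union; rule hidden_weaken, rule 1 2) (use M in auto)
  have "affine_comb (F \<union> F') ?M s f" "affine_comb (F \<union> F') ?M s' g"
    by (rule affine_comb_mono[OF 1(2)] affine_comb_mono[OF 2(2)]; use M in auto)+
  from affine_comb_lin[OF this assms(4-6) M(4)]
  have "affine_comb (F \<union> F') ?M' (s + s') (\<lambda>x. a * f x + b * g x + c)"
    by (rule affine_comb_mono) (use M3 in auto)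
  moreover have "(S + S') + (s + s') \<le> (C + C' + A + 2) * N ^ (n - 1)"
    using 1(3) 2(3) by (simp add: add_mult_distrib)
  ultimately show ?thesis using h unfolding realizable_def by blast
qed

text \<open>A piecewise linear function with \<open>K\<close> breakpoints is applied to \<open>f\<close> with two additional layers. The
first one computes only the positive and the negative part of \<open>f\<close>, and the \<open>K\<close> hinges
in the second one read these two neurons. With one layer, every hinge would have to repeat all output weights of \<open>f\<close>, and
the size would be multiplied by \<open>K\<close> instead of increased by \<open>O(K)\<close>.\<close>

lemma realizable_hinges:
  assumes f: "realizable n N C L f" and N: "N \<ge> 2" and K: "0 < K" "K \<le> D * N ^ (n - 1)"
    and A: "\<And>k. k < K \<Longrightarrow> \<bar>a k\<bar> \<le> real N ^ A" "\<And>k. k < K \<Longrightarrow> \<bar>s k\<bar> \<le> real N ^ A"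
      "\<And>k. k < K \<Longrightarrow> \<bar>t k\<bar> \<le> real N ^ A"
  shows "realizable n N (4 * C + 5 * D + n + A + 2) (L + 2) (\<lambda>x. \<Sum>k<K. a k * max 0 (s k * f x + t k))"
proof -
  obtain S F s1 where 1: "hidden n (real N ^ C) (Suc L) S F" "affine_comb F (real N ^ C) s1 f" "S + s1 \<le> C * N ^ (n - 1)"
    using f unfolding realizable_def by blast
  let ?C = "4 * C + 5 * D + n + A + 2"
  let ?M = "real N ^ ?C"
  have N1: "real N \<ge> 1" using N by simp
  have M: "real N ^ C \<le> ?M" "1 \<le> real N ^ C"
    by (rule mesh_power_mono[OF N], simp) (rule one_le_power[OF N1])
  have M3: "3 * real N ^ E \<le> ?M" if "E + 2 \<le> ?C" for E
  proof -
    have "3 * real N ^ E \<le> real N ^ 2 * real N ^ E"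
      using three_le_square[OF N] by (intro mult_right_mono) auto
    also have "\<dots> \<le> ?M" unfolding power_add[symmetric] using that by (intro mesh_power_mono[OF N]) auto
    finally show ?thesis .
  qed
  (* the two neurons that carry f; the summand 0 * f only serves to reuse affine_comb_lin *)
  let ?p = "\<lambda>x. max 0 (f x)" and ?q = "\<lambda>x. max 0 (- f x)"
  have "affine_comb F ?M (s1 + s1) (\<lambda>x. 1 * f x + 0 * f x + 0)" "affine_comb F ?M (s1 + s1) (\<lambda>x. - 1 * f x + 0 * f x + 0)"
    by (rule affine_comb_mono[OF affine_comb_lin[OF 1(2) 1(2), where A = 1]]; use M M3[of C] in simp)+
  then have n1: "neuron F ?M (s1 + s1) ?p" "neuron F ?M (s1 + s1) ?q" unfolding neuron_def by force+
  have h1: "hidden n ?M (Suc (Suc L)) (S + 4 * s1) {?p, ?q}"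
  proof (rule hidden_step[where s = "\<lambda>_. s1 + s1"])
    show "hidden n ?M (Suc L) S F" using 1(1) M(1) by (rule hidden_weaken)
    have "card {?p, ?q} \<le> 2" by (simp add: card_insert_if)
    then have "card {?p, ?q} * (s1 + s1) \<le> 2 * (s1 + s1)" by (rule mult_right_mono) simp
    then show "S + (\<Sum>g\<in>{?p, ?q}. s1 + s1) \<le> S + 4 * s1" by simp
  qed (use n1 in auto)
  let ?g = "\<lambda>k x. max 0 (s k * f x + t k)"
  have n2: "neuron {?p, ?q} ?M 4 (?g k)" if "k < K" for k
  proof -
    have 2: "affine_comb {?p, ?q} 1 2 ?p" "affine_comb {?p, ?q} 1 2 ?q"
      by (rule affine_comb_single; simp)+
    have "affine_comb {?p, ?q} ?M 4 (\<lambda>x. s k * ?p x + (- s k) * ?q x + t k)"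
      by (rule affine_comb_mono[OF affine_comb_lin[OF 2, where A = "real N ^ A"]])
         (use A[OF that] M3[of A] in auto)
    moreover have "s k * ?p x + (- s k) * ?q x + t k = s k * f x + t k" for x
      by (simp add: max_def)
    ultimately show ?thesis unfolding neuron_def by force
  qed
  have h2: "hidden n ?M (Suc (Suc (Suc L))) (S + 4 * s1 + 4 * K) (?g ` {..<K})"
  proof (rule hidden_step[OF h1, where s = "\<lambda>_. 4"])
    have "card (?g ` {..<K}) \<le> K" using card_image_le[of "{..<K}" ?g] by simp
    then show "S + 4 * s1 + (\<Sum>g\<in>?g ` {..<K}. 4) \<le> S + 4 * s1 + 4 * K" by simp
  qed (use n2 K in auto)
  have "affine_comb (?g ` {..<K}) (real K * real N ^ A + real N ^ A) (Suc K) (\<lambda>x. (\<Sum>k<K. a k * ?g k x) + 0)"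
    by (rule affine_comb_sum) (use A in auto)
  then have o0: "affine_comb (?g ` {..<K}) (real K * real N ^ A + real N ^ A) (Suc K) (\<lambda>x. \<Sum>k<K. a k * ?g k x)"
    by simp
  have o: "affine_comb (?g ` {..<K}) ?M (Suc K) (\<lambda>x. \<Sum>k<K. a k * ?g k x)"
  proof (rule affine_comb_mono[OF o0 order_refl _ order_refl])
    have P1: "1 \<le> N ^ (n - 1)" using N by simp
    have "D + 1 \<le> 2 ^ D" by (induction D) auto
    also have "(2::nat) ^ D \<le> N ^ D" using N by (rule power_mono) simp
    finally have "(D + 1) * N ^ (n - 1) \<le> N ^ D * N ^ (n - 1)" by (rule mult_right_mono) simp
    moreover have "K + 1 \<le> (D + 1) * N ^ (n - 1)" using K(2) P1 by (simp add: add_mult_distrib)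
    ultimately have "K + 1 \<le> N ^ D * N ^ (n - 1)" by linarith
    then have "real (K + 1) \<le> real (N ^ D * N ^ (n - 1))" by (simp only: of_nat_le_iff)
    then have "real (K + 1) * real N ^ A \<le> real N ^ D * real N ^ (n - 1) * real N ^ A"
      by (intro mult_right_mono) auto
    also have "\<dots> \<le> ?M" unfolding power_add[symmetric] by (intro mesh_power_mono[OF N]) auto
    finally show "real K * real N ^ A + real N ^ A \<le> ?M" by (simp add: distrib_right)
  qed
  have "S + 4 * s1 + 4 * K + Suc K \<le> 4 * (C * N ^ (n - 1)) + 5 * (D * N ^ (n - 1)) + N ^ (n - 1)"
  proof -
    have "1 \<le> N ^ (n - 1)" using N by simp
    then show ?thesis using 1(3) K(2) by linarith
  qed
  also have "\<dots> \<le> ?C * N ^ (n - 1)" by (simp add: algebra_simps)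
  finally show ?thesis using h2 o unfolding realizable_def add_2_eq_Suc' by blast
qed

lemma realizable_clamps:
  assumes f: "realizable n N C L f" and N: "N \<ge> 2" and K: "0 < K" "K \<le> D * N ^ (n - 1)"
    and A: "\<And>k. k < K \<Longrightarrow> \<bar>a k\<bar> \<le> real N ^ A" "\<And>k. k < K \<Longrightarrow> \<bar>s k\<bar> \<le> real N ^ A"
      "\<And>k. k < K \<Longrightarrow> \<bar>t k\<bar> \<le> real N ^ A"
  shows "realizable n N (8 * C + 10 * D + 2 * n + 2 * A + 8) (L + 2) (\<lambda>x. \<Sum>k<K. a k * clamp01 (s k * f x + t k))"
proof -
  have le: "z \<le> real N ^ (A + 1)" if "z \<le> real N ^ A + 1" for z
  proof -
    have "1 \<le> real N ^ A" using N by (intro one_le_power) simp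
    then have "real N ^ A + 1 \<le> 2 * real N ^ A" by simp
    also have "\<dots> \<le> real N * real N ^ A" using N by (intro mult_right_mono) auto
    finally show ?thesis using that by simp
  qed
  have A': "\<bar>a k\<bar> \<le> real N ^ (A + 1)" "\<bar>s k\<bar> \<le> real N ^ (A + 1)" "\<bar>t k\<bar> \<le> real N ^ (A + 1)"
      "\<bar>t k - 1\<bar> \<le> real N ^ (A + 1)" if "k < K" for k
    by (rule le, use A[OF that] in linarith)+
  have 1: "realizable n N (4 * C + 5 * D + n + (A + 1) + 2) (L + 2) (\<lambda>x. \<Sum>k<K. a k * max 0 (s k * f x + t k))"
    by (rule realizable_hinges[OF f N K]) (use A' in blast)+
  have 2: "realizable n N (4 * C + 5 * D + n + (A + 1) + 2) (L + 2) (\<lambda>x. \<Sum>k<K. a k * max 0 (s k * f x + (t k - 1)))"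
    by (rule realizable_hinges[OF f N K]) (use A' in blast)+
  have "realizable n N (2 * (4 * C + 5 * D + n + (A + 1) + 2) + 0 + 2) (L + 2)
          (\<lambda>x. 1 * (\<Sum>k<K. a k * max 0 (s k * f x + t k)) + (- 1) * (\<Sum>k<K. a k * max 0 (s k * f x + (t k - 1))) + 0)"
    unfolding mult_2 by (rule realizable_lin[OF 1 2 N]) auto
  moreover have "1 * (\<Sum>k<K. a k * max 0 (s k * f x + t k)) + (- 1) * (\<Sum>k<K. a k * max 0 (s k * f x + (t k - 1))) + 0
      = (\<Sum>k<K. a k * clamp01 (s k * f x + t k))" for x
    by (simp add: clamp01_def right_diff_distrib sum_subtractf add_diff_eq)
  moreover have "2 * (4 * C + 5 * D + n + (A + 1) + 2) + 0 + 2 = 8 * C + 10 * D + 2 * n + 2 * A + 8" by simp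
  ultimately show ?thesis by (metis (lifting) ext)
qed

text \<open>Linear combinations need equal depths. Since \<open>f = max 0 f - max 0 (- f)\<close>, the depth can be increased by the same
step of two layers that piecewise linear functions take, so all depths that occur are odd.\<close>

lemma realizable_pad:
  assumes f: "realizable n N C L f" and N: "N \<ge> 2"
  shows "realizable n N (4 * C + n + 12) (L + 2) f"
proof -
  let ?e = "\<lambda>k :: nat. if k = 0 then 1 else - 1 :: real"
  have "realizable n N (4 * C + 5 * 2 + n + 0 + 2) (L + 2) (\<lambda>x. \<Sum>k<2. ?e k * max 0 (?e k * f x + 0))"
    by (rule realizable_hinges[OF f N]) (use N in auto)
  moreover have "(\<Sum>k<2. ?e k * max 0 (?e k * f x + 0)) = f x" for x
    by (simp add: numeral_2_eq_2 max_def)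
  ultimately show ?thesis by (simp add: add.commute add.left_commute)
qed

section \<open>Uniform families of networks\<close>

text \<open>An index \<open>i\<close> stands for a mesh size \<open>N i\<close> together with the data that the network has to
depend on, such as the set to be approximated.\<close>

locale net_family =
  fixes n :: nat and I :: "'i set" and N :: "'i \<Rightarrow> nat"
  assumes n: "n \<ge> 2" and N: "i \<in> I \<Longrightarrow> N i \<ge> 2"
begin

text \<open>One constant \<open>C\<close> serves the whole family. The networks have depth \<open>2 k + 1\<close>.\<close>

definition realized :: "nat \<Rightarrow> ('i \<Rightarrow> (nat \<Rightarrow> real) \<Rightarrow> real) \<Rightarrow> bool" where
  "realized k f \<longleftrightarrow> (\<exists>C. \<forall>i\<in>I. realizable n (N i) C (2 * k) (f i))"

definition poly_bounded :: "('i \<Rightarrow> real) \<Rightarrow> bool" where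
  "poly_bounded a \<longleftrightarrow> (\<exists>A. \<forall>i\<in>I. \<bar>a i\<bar> \<le> real (N i) ^ A)"

lemma poly_bounded_const [simp, intro]: "poly_bounded (\<lambda>_. c)"
proof -
  obtain A where "\<bar>c\<bar> < 2 ^ A" using real_arch_pow[of 2 "\<bar>c\<bar>"] by auto
  moreover have "(2::real) ^ A \<le> real (N i) ^ A" if "i \<in> I" for i
    using N[OF that] by (intro power_mono) auto
  ultimately show ?thesis unfolding poly_bounded_def by (intro exI[of _ A]) force
qed

lemma poly_bounded_power: "poly_bounded (\<lambda>i. real (N i) ^ k)"
  unfolding poly_bounded_def by (intro exI[of _ k]) auto

lemma realized_coord: "j < n \<Longrightarrow> realized 0 (\<lambda>_ x. x j)"
  unfolding realized_def using realizable_coord N by (intro exI[of _ 12]) simp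

lemma realized_lin:
  assumes "realized k f" "realized k g" "poly_bounded a" "poly_bounded b" "poly_bounded c"
  shows "realized k (\<lambda>i x. a i * f i x + b i * g i x + c i)"
proof -
  obtain C where C: "\<And>i. i \<in> I \<Longrightarrow> realizable n (N i) C (2 * k) (f i)" using assms(1) unfolding realized_def by blast
  obtain C' where C': "\<And>i. i \<in> I \<Longrightarrow> realizable n (N i) C' (2 * k) (g i)" using assms(2) unfolding realized_def by blast
  obtain A1 where A1: "\<And>i. i \<in> I \<Longrightarrow> \<bar>a i\<bar> \<le> real (N i) ^ A1" using assms(3) unfolding poly_bounded_def by blast
  obtain A2 where A2: "\<And>i. i \<in> I \<Longrightarrow> \<bar>b i\<bar> \<le> real (N i) ^ A2" using assms(4) unfolding poly_bounded_def by blast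
  obtain A3 where A3: "\<And>i. i \<in> I \<Longrightarrow> \<bar>c i\<bar> \<le> real (N i) ^ A3" using assms(5) unfolding poly_bounded_def by blast
  let ?A = "A1 + A2 + A3"
  have "realizable n (N i) (C + C' + ?A + 2) (2 * k) (\<lambda>x. a i * f i x + b i * g i x + c i)" if i: "i \<in> I" for i
    by (rule realizable_lin[OF C[OF i] C'[OF i] N[OF i]]; rule order_trans[OF A1[OF i]] order_trans[OF A2[OF i]] order_trans[OF A3[OF i]];
        rule mesh_power_mono[OF N[OF i]]; simp)
  then show ?thesis unfolding realized_def by blast
qed

lemma realized_const: "poly_bounded c \<Longrightarrow> realized 0 (\<lambda>i _. c i)"
  using realized_lin[OF realized_coord[of 0] realized_coord[of 0], of "\<lambda>_. 0" "\<lambda>_. 0" c] n by simp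

lemma realized_pad: "k \<le> k' \<Longrightarrow> realized k f \<Longrightarrow> realized k' f"
proof (induction k' rule: dec_induct)
  case (step j)
  then obtain C where "\<forall>i\<in>I. realizable n (N i) C (2 * j) (f i)" unfolding realized_def by blast
  then have "\<forall>i\<in>I. realizable n (N i) (4 * C + n + 12) (2 * Suc j) (f i)" using realizable_pad N by fastforce
  then show ?case unfolding realized_def by blast
qed simp

lemma realized_add: "realized k f \<Longrightarrow> realized k g \<Longrightarrow> realized k (\<lambda>i x. f i x + g i x)"
  using realized_lin[of k f g "\<lambda>_. 1" "\<lambda>_. 1" "\<lambda>_. 0"] by simp

lemma realized_scale: "realized k f \<Longrightarrow> poly_bounded a \<Longrightarrow> poly_bounded c \<Longrightarrow> realized k (\<lambda>i x. a i * f i x + c i)"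
  using realized_lin[of k f f a "\<lambda>_. 0" c] by simp

lemma realized_sum:
  assumes "finite T" and "\<And>t. t \<in> T \<Longrightarrow> realized k (f t)" and "\<And>t. t \<in> T \<Longrightarrow> poly_bounded (a t)"
  shows "realized k (\<lambda>i x. \<Sum>t\<in>T. a t i * f t i x)"
  using assms
proof (induction T rule: finite_induct)
  case empty then show ?case using realized_pad[OF _ realized_const[of "\<lambda>_. 0"]] by simp
next
  case (insert t T)
  have "realized k (\<lambda>i x. a t i * f t i x + 1 * (\<Sum>t\<in>T. a t i * f t i x) + 0)"
    by (rule realized_lin) (use insert in auto)
  then show ?case using insert.hyps by simp
qed

text \<open>The general building block: superpositions of \<open>O(N\<^sup>n\<^sup>-\<^sup>1)\<close> ramps of one realized function. Staircases, lookup tables, sawtooths and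
interpolants are all of this form.\<close>

lemma realized_clamps:
  assumes f: "realized k f" and K: "\<And>i. i \<in> I \<Longrightarrow> 0 < K i" "\<And>i. i \<in> I \<Longrightarrow> K i \<le> D * N i ^ (n - 1)"
    and A: "\<And>i j. i \<in> I \<Longrightarrow> j < K i \<Longrightarrow> \<bar>a i j\<bar> \<le> A * real (N i) ^ p"
      "\<And>i j. i \<in> I \<Longrightarrow> j < K i \<Longrightarrow> \<bar>s i j\<bar> \<le> A * real (N i) ^ p"
      "\<And>i j. i \<in> I \<Longrightarrow> j < K i \<Longrightarrow> \<bar>t i j\<bar> \<le> A * real (N i) ^ p"
  shows "realized (Suc k) (\<lambda>i x. \<Sum>j<K i. a i j * clamp01 (s i j * f i x + t i j))"
proof -
  obtain C where C: "\<And>i. i \<in> I \<Longrightarrow> realizable n (N i) C (2 * k) (f i)" using f unfolding realized_def by blast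
  obtain q where "\<forall>i\<in>I. \<bar>A\<bar> \<le> real (N i) ^ q" using poly_bounded_const[of A] unfolding poly_bounded_def by blast
  then have Aq: "A * real (N i) ^ p \<le> real (N i) ^ (q + p)" if "i \<in> I" for i
    unfolding power_add using that by (intro mult_right_mono) force+
  have "realizable n (N i) (8 * C + 10 * D + 2 * n + 2 * (q + p) + 8) (2 * k + 2) (\<lambda>x. \<Sum>j<K i. a i j * clamp01 (s i j * f i x + t i j))"
    if i: "i \<in> I" for i
    by (rule realizable_clamps[OF C[OF i] N[OF i] K(1)[OF i] K(2)[OF i]]; rule order_trans[OF A(1)[OF i] Aq[OF i]]
          order_trans[OF A(2)[OF i] Aq[OF i]] order_trans[OF A(3)[OF i] Aq[OF i]]; assumption)
  then show ?thesis unfolding realized_def by auto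
qed

lemma realized_clamp: 
  assumes "realized k f" "poly_bounded s" "poly_bounded t"
  shows "realized (Suc k) (\<lambda>i x. clamp01 (s i * f i x + t i))"
proof -
  have "realized k (\<lambda>i x. s i * f i x + t i)" by (rule realized_scale[OF assms])
  then have "realized (Suc k) (\<lambda>i x. \<Sum>j<(1::nat). 1 * clamp01 (1 * (s i * f i x + t i) + 0))"
  proof (rule realized_clamps[where D = 1 and A = 1 and p = 0 and K = "\<lambda>_. 1"])
    fix i assume "i \<in> I"
    then show "1 \<le> 1 * N i ^ (n - 1)" using N[of i] by simp
  qed simp_all
  then show ?thesis by simp
qed

end

section \<open>Squares and products at fixed depth\<close>

text \<open>On \<open>[0,1]\<close> this is the continuous function with \<open>w\<close> linear pieces between the values 0 and 1. The
summand \<open>- real k\<close> is kept apart from the product to match the shape \<open>s \<cdot> z + t\<close> of the arguments of ramps.\<close>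

definition sawtooth :: "nat \<Rightarrow> real \<Rightarrow> real" where
  "sawtooth w z = (\<Sum>k<w. (- 1) ^ k * clamp01 (real w * z + - real k))"

text \<open>The piecewise linear interpolant of \<open>z\<^sup>2\<close> at the multiples of \<open>1/w\<close>: between \<open>k/w\<close> and \<open>(k+1)/w\<close> the square
increases by \<open>(2k+1)/w\<^sup>2\<close>.\<close>

definition quad_interp :: "nat \<Rightarrow> real \<Rightarrow> real" where
  "quad_interp w z = (\<Sum>k<w. (2 * real k + 1) / real w ^ 2 * clamp01 (real w * z + - real k))"

text \<open>The exact recursion for the square from \<open>sawtooth_quad_interp\<close>, started with \<open>z\<close> in place of \<open>z\<^sup>2\<close>.\<close>

primrec approx_square :: "nat \<Rightarrow> nat \<Rightarrow> real \<Rightarrow> real" where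
  "approx_square w 0 z = z"
| "approx_square w (Suc q) z = quad_interp w z - sawtooth w z / real w ^ 2 + approx_square w q (sawtooth w z) / real w ^ 2"

text \<open>For \<open>y\<close> between \<open>q\<close> and \<open>q + 1\<close> the ramps before the \<open>q\<close>-th are saturated and those after it vanish.\<close>

lemma sum_clamps:
  assumes "q < w" "real q \<le> y" "y \<le> real q + 1"
  shows "(\<Sum>k<w. a k * clamp01 (y + - real k)) = (\<Sum>k<q. a k) + a q * (y - real q)"
proof -
  have 1: "clamp01 (y + - real k) = 1" if "k < q" for k
    using that assms by (intro clamp01_simps) (simp add: nat_less_real_le)
  have 2: "clamp01 (y + - real k) = 0" if "q < k" for k
    using that assms by (intro clamp01_simps) (simp add: nat_less_real_le)
  have 3: "clamp01 (y + - real q) = y - real q" using assms by (subst clamp01_simps(2)) auto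
  have "{..<w} = {..<q} \<union> {q} \<union> {Suc q..<w}" using assms(1) by auto
  then have "(\<Sum>k<w. a k * clamp01 (y + - real k)) = (\<Sum>k\<in>{..<q} \<union> {q} \<union> {Suc q..<w}. a k * clamp01 (y + - real k))"
    by simp
  also have "\<dots> = (\<Sum>k<q. a k * clamp01 (y + - real k)) + a q * clamp01 (y + - real q)
      + (\<Sum>k\<in>{Suc q..<w}. a k * clamp01 (y + - real k))"
    by (subst sum.union_disjoint, simp, simp, force)+ (simp add: sum.union_disjoint)
  also have "(\<Sum>k<q. a k * clamp01 (y + - real k)) = (\<Sum>k<q. a k)" by (rule sum.cong) (simp_all only: 1 lessThan_iff mult_1_right)
  also have "(\<Sum>k\<in>{Suc q..<w}. a k * clamp01 (y + - real k)) = 0" by (rule sum.neutral, rule ballI, subst 2) simp_all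
  finally show ?thesis by (simp only: 3 add_0_right)
qed

lemma subinterval_index:
  fixes z :: real
  assumes "0 \<le> z" "z \<le> 1" "w \<ge> 1"
  obtains q where "q < w" "real q \<le> real w * z" "real w * z \<le> real q + 1"
proof (cases "z = 1")
  case True
  then show ?thesis using that[of "w - 1"] assms(3) by simp
next
  case False
  let ?q = "nat \<lfloor>real w * z\<rfloor>"
  have "0 \<le> real w * z" "real w * z < real w" using assms False by auto
  then show ?thesis using that[of ?q] by (simp add: nat_less_iff floor_less_iff)
qed

text \<open>Let \<open>t\<close> be the fractional part of \<open>w z\<close>. The interpolation error of the square at \<open>z\<close> is \<open>t (1 - t)/w\<^sup>2\<close>. This is invariant under
\<open>t \<mapsto> 1 - t\<close>, and therefore a function of the continuous sawtooth \<open>T\<close>, whose value is \<open>t\<close> or \<open>1 - t\<close> according to the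
parity of the tooth.\<close>

lemma sawtooth_quad_interp:
  assumes "0 \<le> z" "z \<le> 1" "w \<ge> 1"
  shows "sawtooth w z \<in> {0..1}" and "quad_interp w z - sawtooth w z / real w ^ 2 + (sawtooth w z)\<^sup>2 / real w ^ 2 = z\<^sup>2"
proof -
  obtain q where q: "q < w" "real q \<le> real w * z" "real w * z \<le> real q + 1"
    using subinterval_index[OF assms] .
  define t where "t = real w * z - real q"
  have t: "0 \<le> t" "t \<le> 1" using q unfolding t_def by auto
  have alt: "(\<Sum>k<q. (- 1) ^ k) = (if even q then 0 else 1 :: real)" by (induction q) auto
  have odd: "(\<Sum>k<q. 2 * real k + 1) = real q ^ 2" by (induction q) (auto simp: power2_eq_square algebra_simps)
  have s: "sawtooth w z = (if even q then t else 1 - t)"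
    unfolding sawtooth_def sum_clamps[OF q] alt t_def by auto
  show "sawtooth w z \<in> {0..1}" using t unfolding s by auto
  have "quad_interp w z = (\<Sum>k<q. (2 * real k + 1) / real w ^ 2) + (2 * real q + 1) / real w ^ 2 * t"
    unfolding quad_interp_def sum_clamps[OF q] t_def ..
  also have "\<dots> = (real q ^ 2 + (2 * real q + 1) * t) / real w ^ 2"
    unfolding sum_divide_distrib[symmetric] odd by (simp only: add_divide_distrib[of "real q ^ 2"] times_divide_eq_left)
  finally have i: "quad_interp w z = (real q ^ 2 + (2 * real q + 1) * t) / real w ^ 2" .
  have ss: "sawtooth w z - (sawtooth w z)\<^sup>2 = t - t\<^sup>2" unfolding s by (simp add: power2_eq_square algebra_simps)
  have z: "z = (real q + t) / real w" unfolding t_def using assms(3) by simp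
  then have z2: "z\<^sup>2 = (real q + t)\<^sup>2 / real w ^ 2" by (metis power_divide)
  have "quad_interp w z - sawtooth w z / real w ^ 2 + (sawtooth w z)\<^sup>2 / real w ^ 2
      = (real q ^ 2 + (2 * real q + 1) * t - (sawtooth w z - (sawtooth w z)\<^sup>2)) / real w ^ 2"
    unfolding i by (simp add: diff_divide_distrib)
  also have "\<dots> = z\<^sup>2" unfolding ss z2 by (simp add: power2_eq_square algebra_simps)
  finally show "quad_interp w z - sawtooth w z / real w ^ 2 + (sawtooth w z)\<^sup>2 / real w ^ 2 = z\<^sup>2" .
qed

text \<open>Each step of the recursion divides the error by \<open>w\<^sup>2\<close>, because the sawtooth maps \<open>[0,1]\<close> to itself.\<close>

lemma approx_square_error:
  assumes "0 \<le> z" "z \<le> 1" "w \<ge> 1"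
  shows "\<bar>approx_square w q z - z\<^sup>2\<bar> \<le> 1 / real w ^ (2 * q)"
  using assms(1,2)
proof (induction q arbitrary: z)
  case 0
  have "z\<^sup>2 \<le> z" using 0 by (simp add: power2_eq_square mult_left_le)
  moreover have "0 \<le> z\<^sup>2" by simp
  ultimately have "\<bar>z - z\<^sup>2\<bar> \<le> 1" using 0 by linarith
  then show ?case by simp
next
  case (Suc q)
  note s = sawtooth_quad_interp[OF Suc.prems assms(3)]
  have "approx_square w (Suc q) z - z\<^sup>2 = (approx_square w q (sawtooth w z) - (sawtooth w z)\<^sup>2) / real w ^ 2"
    using s(2) by (simp add: diff_divide_distrib)
  then have "\<bar>approx_square w (Suc q) z - z\<^sup>2\<bar> = \<bar>approx_square w q (sawtooth w z) - (sawtooth w z)\<^sup>2\<bar> / real w ^ 2" by simp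
  also have "\<dots> \<le> (1 / real w ^ (2 * q)) / real w ^ 2"
    using Suc.IH[of "sawtooth w z"] s(1) by (intro divide_right_mono) auto
  also have "\<dots> = 1 / real w ^ (2 * Suc q)" by (simp add: power_add power2_eq_square)
  finally show ?case .
qed

definition clip :: "real \<Rightarrow> real" where "clip z = clamp01 z - clamp01 (- z)"

definition clip_abs :: "real \<Rightarrow> real" where "clip_abs z = clamp01 z + clamp01 (- z)"

text \<open>Polarization: \<open>a b = ((a + b)/2)\<^sup>2 - ((a - b)/2)\<^sup>2\<close>. The factors are clipped to \<open>[-1,1]\<close>, so that the
squares are only evaluated on \<open>[0,1]\<close> even if the factors are themselves approximations that leave \<open>[-1,1]\<close>.\<close>

definition approx_mult :: "nat \<Rightarrow> nat \<Rightarrow> real \<Rightarrow> real \<Rightarrow> real" where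
  "approx_mult w q a b = approx_square w q (clip_abs ((clip a + clip b) / 2)) - approx_square w q (clip_abs ((clip a - clip b) / 2))"

lemma approx_mult_error:
  assumes "\<bar>a\<bar> \<le> 1" "\<bar>b\<bar> \<le> 1" "w \<ge> 1"
  shows "\<bar>approx_mult w q a' b' - a * b\<bar> \<le> 2 / real w ^ (2 * q) + \<bar>a' - a\<bar> + \<bar>b' - b\<bar>"
proof -
  define u v where "u = clip a'" and "v = clip b'"
  have u: "\<bar>u\<bar> \<le> 1" "\<bar>u - a\<bar> \<le> \<bar>a' - a\<bar>" and v: "\<bar>v\<bar> \<le> 1" "\<bar>v - b\<bar> \<le> \<bar>b' - b\<bar>"
    using assms unfolding u_def v_def clip_def clamp01_def by (auto simp: max_def)
  have clip_abs: "clip_abs z = \<bar>z\<bar>" if "\<bar>z\<bar> \<le> 1" for z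
    using that unfolding clip_abs_def clamp01_def by (auto simp: max_def)
  have c: "\<bar>(u + v) / 2\<bar> \<le> 1" "\<bar>(u - v) / 2\<bar> \<le> 1" using u v by auto
  define E where "E = (\<lambda>z. approx_square w q (\<bar>z\<bar>) - z\<^sup>2)"
  have E: "\<bar>E z\<bar> \<le> 1 / real w ^ (2 * q)" if "\<bar>z\<bar> \<le> 1" for z
    using approx_square_error[of "\<bar>z\<bar>" w q] that assms(3) unfolding E_def by simp
  have "approx_mult w q a' b' - u * v = E ((u + v) / 2) - E ((u - v) / 2)"
    unfolding approx_mult_def E_def u_def[symmetric] v_def[symmetric] clip_abs[OF c(1)] clip_abs[OF c(2)]
    by (simp add: power2_eq_square field_simps)
  moreover note E[OF c(1)] E[OF c(2)]
  ultimately have 1: "\<bar>approx_mult w q a' b' - u * v\<bar> \<le> 2 / real w ^ (2 * q)" by linarith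
  have "u * v - a * b = (u - a) * v + a * (v - b)" by (simp add: algebra_simps)
  then have "\<bar>u * v - a * b\<bar> \<le> \<bar>u - a\<bar> * \<bar>v\<bar> + \<bar>a\<bar> * \<bar>v - b\<bar>" by (simp add: abs_mult[symmetric])
  also have "\<dots> \<le> \<bar>u - a\<bar> * 1 + 1 * \<bar>v - b\<bar>"
    using v u assms by (intro add_mono mult_mono) auto
  moreover have "\<bar>approx_mult w q a' b' - a * b\<bar> \<le> \<bar>approx_mult w q a' b' - u * v\<bar> + \<bar>u * v - a * b\<bar>" by linarith
  ultimately show ?thesis using 1 u(2) v(2) by linarith
qed

lemma divide_le_self: "1 \<le> b \<Longrightarrow> 0 \<le> a \<Longrightarrow> a / b \<le> (a :: real)"
  using divide_left_mono[of 1 b a] by simp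

lemma prod_lessThan_add:
  fixes f :: "nat \<Rightarrow> real"
  shows "(\<Prod>t<a + b. f t) = (\<Prod>t<a. f t) * (\<Prod>t<b. f (a + t))"
  by (induction b) (simp_all add: mult.assoc)

context net_family begin

lemma realized_sawtooth: "realized k f \<Longrightarrow> realized (Suc k) (\<lambda>i x. sawtooth (N i ^ (n - 1)) (f i x))"
  and realized_quad_interp: "realized k f \<Longrightarrow> realized (Suc k) (\<lambda>i x. quad_interp (N i ^ (n - 1)) (f i x))"
proof -
  assume f: "realized k f"
  have N1: "1 \<le> real (N i)" if "i \<in> I" for i using N[OF that] by simp
  have pos: "0 < N i ^ (n - 1)" if "i \<in> I" for i using N[OF that] by simp
  have p1: "1 \<le> 3 * real (N i) ^ (n - 1)" if "i \<in> I" for i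
    using one_le_power[OF N1[OF that], of "n - 1"] by linarith
  have lt: "\<bar>- real j\<bar> \<le> 3 * real (N i) ^ (n - 1)" if "j < N i ^ (n - 1)" for i j
  proof -
    have "real j \<le> real (N i) ^ (n - 1)"
      using that unfolding of_nat_power[symmetric] of_nat_le_iff by (rule less_imp_le)
    then show ?thesis by linarith
  qed
  show "realized (Suc k) (\<lambda>i x. sawtooth (N i ^ (n - 1)) (f i x))"
    unfolding sawtooth_def
    by (rule realized_clamps[OF f pos, where A = 3 and D = 1 and p = "n - 1"]) (use p1 lt in \<open>simp_all add: power_abs\<close>)
  have "\<bar>(2 * real j + 1) / real (N i ^ (n - 1)) ^ 2\<bar> \<le> 3 * real (N i) ^ (n - 1)" if ij: "i \<in> I" "j < N i ^ (n - 1)" for i j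
  proof -
    have j: "real j + 1 \<le> real (N i) ^ (n - 1)" 
    proof -
      have "real (Suc j) \<le> real (N i) ^ (n - 1)"
        using ij(2) unfolding of_nat_power[symmetric] of_nat_le_iff by (rule Suc_leI)
      then show ?thesis by simp
    qed
    have 1: "1 \<le> real (N i ^ (n - 1)) ^ 2" using N1[OF ij(1)] by (simp add: one_le_power)
    have "(2 * real j + 1) / real (N i ^ (n - 1)) ^ 2 \<le> 2 * real j + 1"
      by (rule divide_le_self[OF 1]) simp
    also have "\<dots> \<le> 3 * real (N i) ^ (n - 1)" using j by linarith
    finally show ?thesis by simp
  qed
  then show "realized (Suc k) (\<lambda>i x. quad_interp (N i ^ (n - 1)) (f i x))"
    unfolding quad_interp_def
    by (intro realized_clamps[OF f pos, where A = 3 and D = 1 and p = "n - 1"]) (use lt in auto)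
qed

lemma realized_approx_square: "realized k f \<Longrightarrow> realized (k + q) (\<lambda>i x. approx_square (N i ^ (n - 1)) q (f i x))"
proof (induction q arbitrary: k f)
  case (Suc q)
  let ?w = "\<lambda>i. N i ^ (n - 1)"
  have pb: "poly_bounded (\<lambda>i. a / real (?w i) ^ 2)" for a
  proof -
    obtain A where A: "\<And>i. i \<in> I \<Longrightarrow> \<bar>a\<bar> \<le> real (N i) ^ A" using poly_bounded_const[of a] unfolding poly_bounded_def by blast
    have "\<bar>a / real (?w i) ^ 2\<bar> \<le> real (N i) ^ A" if "i \<in> I" for i
    proof -
      have "1 \<le> real (?w i) ^ 2" using N[OF that] by (simp add: one_le_power)
      then have "\<bar>a\<bar> / real (?w i) ^ 2 \<le> \<bar>a\<bar>" by (rule divide_le_self) simp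
      then have "\<bar>a / real (?w i) ^ 2\<bar> \<le> \<bar>a\<bar>" unfolding abs_divide abs_power2 .
      then show ?thesis using A[OF that] by (rule order_trans)
    qed
    then show ?thesis unfolding poly_bounded_def by blast
  qed
  have 1: "realized (k + Suc q) (\<lambda>i x. quad_interp (?w i) (f i x))" "realized (k + Suc q) (\<lambda>i x. sawtooth (?w i) (f i x))"
    by (rule realized_pad[OF _ realized_quad_interp[OF Suc.prems]] realized_pad[OF _ realized_sawtooth[OF Suc.prems]]; simp)+
  have 2: "realized (k + Suc q) (\<lambda>i x. approx_square (?w i) q (sawtooth (?w i) (f i x)))"
    using Suc.IH[OF realized_sawtooth[OF Suc.prems]] by simp
  have "realized (k + Suc q) (\<lambda>i x. 1 * (1 * quad_interp (?w i) (f i x) + (- 1 / real (?w i) ^ 2) * sawtooth (?w i) (f i x) + 0)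
     + (1 / real (?w i) ^ 2) * approx_square (?w i) q (sawtooth (?w i) (f i x)) + 0)"
    by (intro realized_lin 1 2 pb poly_bounded_const)
  then show ?case by simp
qed simp

lemma realized_approx_mult:
  assumes "realized k f" "realized k g"
  shows "realized (k + 2 + q) (\<lambda>i x. approx_mult (N i ^ (n - 1)) q (f i x) (g i x))"
proof -
  have tr: "realized (Suc k) (\<lambda>i x. clip (f i x))" if "realized k f" for f k
    using realized_lin[OF realized_clamp[OF that, of "\<lambda>_. 1" "\<lambda>_. 0"] realized_clamp[OF that, of "\<lambda>_. -1" "\<lambda>_. 0"], of "\<lambda>_. 1" "\<lambda>_. -1" "\<lambda>_. 0"]
    by (simp add: clip_def)
  have ab: "realized (Suc k) (\<lambda>i x. clip_abs (f i x))" if "realized k f" for f k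
    using realized_add[OF realized_clamp[OF that, of "\<lambda>_. 1" "\<lambda>_. 0"] realized_clamp[OF that, of "\<lambda>_. -1" "\<lambda>_. 0"]]
    by (simp add: clip_abs_def)
  have t: "realized (Suc k) (\<lambda>i x. clip (f i x))" "realized (Suc k) (\<lambda>i x. clip (g i x))" using tr assms by auto
  have pm: "realized (Suc (Suc k)) (\<lambda>i x. clip_abs ((clip (f i x) + clip (g i x)) / 2))"
      "realized (Suc (Suc k)) (\<lambda>i x. clip_abs ((clip (f i x) - clip (g i x)) / 2))"
    using ab[OF realized_lin[OF t, of "\<lambda>_. 1/2" "\<lambda>_. 1/2" "\<lambda>_. 0"]] ab[OF realized_lin[OF t, of "\<lambda>_. 1/2" "\<lambda>_. -1/2" "\<lambda>_. 0"]]
    by (simp_all add: add_divide_distrib diff_divide_distrib)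
  show ?thesis
    using realized_lin[OF realized_approx_square[OF pm(1), of q] realized_approx_square[OF pm(2), of q], of "\<lambda>_. 1" "\<lambda>_. -1" "\<lambda>_. 0"]
    by (simp add: approx_mult_def)
qed

text \<open>A balanced tree of \<open>K\<close> rounds of pairwise products. Clipping does not increase the distance to a true factor in
\<open>[-1,1]\<close>, so in each round the errors of the factors add up, together with the error of the multiplication itself.\<close>

lemma realized_prod:
  fixes v :: "nat \<Rightarrow> 'i \<Rightarrow> (nat \<Rightarrow> real) \<Rightarrow> real"
  assumes "2 * (n - 1) * q \<ge> m"
  shows "(\<And>t. t < 2 ^ K \<Longrightarrow> realized k (v t)) \<Longrightarrow>
    \<exists>h. realized (k + K * (q + 2)) h \<and> (\<exists>c. \<forall>i\<in>I. \<forall>x. (\<forall>t<2^K. \<bar>v t i x\<bar> \<le> 1) \<longrightarrow>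
       \<bar>h i x - (\<Prod>t<2^K. v t i x)\<bar> \<le> c / real (N i) ^ m)"
proof (induction K arbitrary: v)
  case 0
  show ?case
    by (rule exI[of _ "v 0"], rule conjI, use 0[of 0] in simp, rule exI[of _ 0]) simp
next
  case (Suc K)
  obtain h c where h: "realized (k + K * (q + 2)) h" "\<forall>i\<in>I. \<forall>x. (\<forall>t<2^K. \<bar>v t i x\<bar> \<le> 1) \<longrightarrow>
       \<bar>h i x - (\<Prod>t<2^K. v t i x)\<bar> \<le> c / real (N i) ^ m"
  proof -
    have "realized k (v t)" if "t < 2 ^ K" for t using Suc.prems[of t] that by simp
    from Suc.IH[of v, OF this] show ?thesis using that by blast
  qed
  obtain h' c' where h': "realized (k + K * (q + 2)) h'" "\<forall>i\<in>I. \<forall>x. (\<forall>t<2^K. \<bar>v (2^K + t) i x\<bar> \<le> 1) \<longrightarrow>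
       \<bar>h' i x - (\<Prod>t<2^K. v (2^K + t) i x)\<bar> \<le> c' / real (N i) ^ m"
  proof -
    have "realized k (v (2^K + t))" if "t < 2 ^ K" for t using Suc.prems[of "2^K + t"] that by simp
    from Suc.IH[of "\<lambda>t. v (2^K + t)", OF this] show ?thesis using that by blast
  qed
  let ?h = "\<lambda>i x. approx_mult (N i ^ (n - 1)) q (h i x) (h' i x)"
  have "realized (k + Suc K * (q + 2)) ?h"
    using realized_approx_mult[OF h(1) h'(1), of q] by (simp add: algebra_simps)
  moreover have "\<bar>?h i x - (\<Prod>t<2^Suc K. v t i x)\<bar> \<le> (2 + c + c') / real (N i) ^ m"
    if i: "i \<in> I" and b: "\<forall>t<2^Suc K. \<bar>v t i x\<bar> \<le> 1" for i x
  proof -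
    let ?a = "\<Prod>t<2^K. v t i x" and ?b = "\<Prod>t<2^K. v (2^K + t) i x"
    have N1: "1 \<le> real (N i)" using N[OF i] by simp
    have ab: "\<bar>?a\<bar> \<le> 1" "\<bar>?b\<bar> \<le> 1" unfolding abs_prod by (rule prod_le_1; use b in auto)+
    have split: "(\<Prod>t<2^Suc K. v t i x) = ?a * ?b"
      unfolding power_Suc mult_2 by (rule prod_lessThan_add)
    have e: "2 / real (N i ^ (n - 1)) ^ (2 * q) \<le> 2 / real (N i) ^ m"
    proof (rule divide_left_mono)
      have "real (N i) ^ m \<le> real (N i) ^ ((n - 1) * (2 * q))"
        using assms by (intro mesh_power_mono[OF N[OF i]]) (simp add: ac_simps)
      then show "real (N i) ^ m \<le> real (N i ^ (n - 1)) ^ (2 * q)" by (simp add: power_mult)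
    qed (use N1 in auto)
    have "\<bar>?h i x - ?a * ?b\<bar> \<le> 2 / real (N i ^ (n - 1)) ^ (2 * q) + \<bar>h i x - ?a\<bar> + \<bar>h' i x - ?b\<bar>"
      by (rule approx_mult_error[OF ab]) (use N[OF i] in simp)
    also have "\<dots> \<le> 2 / real (N i) ^ m + c / real (N i) ^ m + c' / real (N i) ^ m"
      using e h(2) h'(2) i b by (intro add_mono) auto
    finally show ?thesis unfolding split by (simp add: add_divide_distrib)
  qed
  ultimately show ?case by blast
qed

end

section \<open>Taylor expansion coordinate by coordinate\<close>

definition multi_indices :: "nat \<Rightarrow> nat \<Rightarrow> (nat \<Rightarrow> nat) set" where
  "multi_indices d m = {\<alpha>. (\<forall>j\<ge>d. \<alpha> j = 0) \<and> (\<Sum>j<d. \<alpha> j) < m}"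

lemma cube_subset_Rn: "cube d \<subseteq> Rn d" unfolding cube_def Rn_def by (rule PiE_mono) auto

lemma Cm_open_mono: "Cm_open m d U f \<Longrightarrow> m' \<le> m \<Longrightarrow> Cm_open m' d U f"
proof (induction m' arbitrary: m f)
  case 0 then show ?case by (cases m) auto
next
  case (Suc m') then show ?case by (cases m) auto
qed

lemma Cm_open_funpow:
  "Cm_open m d U f \<Longrightarrow> b \<le> m \<Longrightarrow> k < d \<Longrightarrow> Cm_open (m - b) d U ((partial k ^^ b) f)"
proof (induction b)
  case (Suc b)
  then have "Cm_open (Suc (m - Suc b)) d U ((partial k ^^ b) f)" by (simp add: Suc_diff_Suc)
  then show ?case using Suc.prems by simp
qed simp

lemma Cm_open_mpartial:
  "Cm_open m d U f \<Longrightarrow> (\<Sum>j<k. \<alpha> j) \<le> m \<Longrightarrow> k \<le> d \<Longrightarrow> Cm_open (m - (\<Sum>j<k. \<alpha> j)) d U (mpartial k \<alpha> f)"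
proof (induction k)
  case (Suc k)
  then have "Cm_open (m - (\<Sum>j<k. \<alpha> j)) d U (mpartial k \<alpha> f)" by simp
  then have "Cm_open (m - (\<Sum>j<k. \<alpha> j) - \<alpha> k) d U ((partial k ^^ \<alpha> k) (mpartial k \<alpha> f))"
    by (rule Cm_open_funpow) (use Suc.prems in auto)
  then show ?case by simp
qed simp

lemma mpartial_cong: "(\<And>j. j < k \<Longrightarrow> \<alpha> j = \<beta> j) \<Longrightarrow> mpartial k \<alpha> f = mpartial k \<beta> f"
  by (induction k) auto

lemma mpartial_zero: "k \<le> d \<Longrightarrow> (\<And>j. k \<le> j \<Longrightarrow> \<alpha> j = 0) \<Longrightarrow> mpartial d \<alpha> f = mpartial k \<alpha> f"
  by (induction d rule: dec_induct) auto

lemma cube_upd: "y \<in> cube d \<Longrightarrow> k < d \<Longrightarrow> t \<in> {-1/2..1/2} \<Longrightarrow> y(k := t) \<in> cube d"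
  unfolding cube_def by (auto simp: PiE_iff extensional_def)

lemma partial_has_derivative:
  assumes "Cm_open (Suc r) d (Rn d) g" "k < d" "y \<in> Rn d"
  shows "((\<lambda>t. g (y(k := t))) has_real_derivative partial k g (y(k := t))) (at t)"
proof -
  have "y(k := t) \<in> Rn d" using assms(2,3) unfolding Rn_def by (auto simp: PiE_iff extensional_def)
  moreover have "\<forall>x\<in>Rn d. (\<lambda>s. g (x(k := s))) field_differentiable at (x k)"
    using assms(1,2) by simp
  ultimately have "(\<lambda>s. g ((y(k := t))(k := s))) field_differentiable at ((y(k := t)) k)" by (rule bspec[rotated])
  then show ?thesis unfolding partial_def by (simp add: DERIV_deriv_iff_field_differentiable)
qed

text \<open>Taylor's formula in the variable \<open>x\<^sub>k\<close> alone, with the Lagrange form of the remainder.\<close>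

lemma taylor_coord:
  assumes g: "Cm_open r d (Rn d) g" and r: "r \<ge> 1" and k: "k < d" and y: "y \<in> cube d" and c: "c \<in> {-1/2..1/2}"
    and B: "\<And>z. z \<in> cube d \<Longrightarrow> \<bar>(partial k ^^ r) g z\<bar> \<le> B" and h: "\<bar>y k - c\<bar> \<le> h"
  shows "\<bar>g y - (\<Sum>b<r. (partial k ^^ b) g (y(k := c)) / fact b * (y k - c) ^ b)\<bar> \<le> B * h ^ r"
proof -
  have B0: "0 \<le> B" using B[OF y] by linarith
  have h0: "0 \<le> h" using h by linarith
  have yk: "y k \<in> {-1/2..1/2}" using y k unfolding cube_def by (auto simp: PiE_iff)
  show ?thesis
  proof (cases "y k = c")
    case True
    then have yc: "y(k := c) = y" by auto
    have "(\<Sum>b<r. (partial k ^^ b) g (y(k := c)) / fact b * (y k - c) ^ b) = (\<Sum>b\<in>{0}. (partial k ^^ b) g (y(k := c)) / fact b * (y k - c) ^ b)"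
      by (rule sum.mono_neutral_right) (use True r in auto)
    then have "g y - (\<Sum>b<r. (partial k ^^ b) g (y(k := c)) / fact b * (y k - c) ^ b) = 0" by (simp add: yc)
    then show ?thesis using B0 h0 by simp
  next
    case False
    let ?D = "\<lambda>b t. (partial k ^^ b) g (y(k := t))"
    have "\<forall>b t. b < r \<and> -1/2 \<le> t \<and> t \<le> 1/2 \<longrightarrow> (?D b has_real_derivative ?D (Suc b) t) (at t)"
    proof (intro allI impI, elim conjE)
      fix b t assume b: "b < r"
      have "Cm_open (Suc (r - Suc b)) d (Rn d) ((partial k ^^ b) g)"
        using Cm_open_funpow[OF g, of b k] b k by (simp add: Suc_diff_Suc)
      from partial_has_derivative[OF this k subsetD[OF cube_subset_Rn y]]
      show "(?D b has_real_derivative ?D (Suc b) t) (at t)" by simp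
    qed
    from Taylor[of r ?D "\<lambda>t. g (y(k := t))" "-1/2" "1/2" c "y k", OF _ _ this]
    obtain t where t: "if y k < c then y k < t \<and> t < c else c < t \<and> t < y k"
      "g (y(k := y k)) = (\<Sum>b<r. ?D b c / fact b * (y k - c) ^ b) + ?D r t / fact r * (y k - c) ^ r"
      using r yk c False by auto
    have tc: "t \<in> {-1/2..1/2}" using t(1) yk c by (auto split: if_splits)
    have "\<bar>?D r t / fact r * (y k - c) ^ r\<bar> = \<bar>?D r t\<bar> / fact r * \<bar>y k - c\<bar> ^ r"
      by (simp add: abs_mult power_abs)
    also have "\<dots> \<le> B * h ^ r"
    proof (rule mult_mono)
      have "\<bar>?D r t\<bar> / fact r \<le> \<bar>?D r t\<bar>" by (rule divide_le_self) simp_all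
      then show "\<bar>?D r t\<bar> / fact r \<le> B" using B[OF cube_upd[OF y k tc]] by linarith
      show "\<bar>y k - c\<bar> ^ r \<le> h ^ r" using h by (rule power_mono) simp
    qed (use B0 in auto)
    finally show ?thesis using t(2) by simp
  qed
qed

lemma finite_multi_indices: "finite (multi_indices d m)"
proof -
  have "finite ({..<d} \<rightarrow>\<^sub>E {..m})" by (intro finite_PiE) auto
  moreover have "inj_on (\<lambda>\<alpha>. restrict \<alpha> {..<d}) (multi_indices d m)"
  proof (rule inj_onI)
    fix \<alpha> \<beta> assume a: "\<alpha> \<in> multi_indices d m" "\<beta> \<in> multi_indices d m" "restrict \<alpha> {..<d} = restrict \<beta> {..<d}"
    show "\<alpha> = \<beta>"
    proof
      fix j show "\<alpha> j = \<beta> j"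
        using fun_cong[OF a(3), of j] a(1,2) unfolding multi_indices_def by (cases "j < d") auto
    qed
  qed
  moreover have "(\<lambda>\<alpha>. restrict \<alpha> {..<d}) ` multi_indices d m \<subseteq> {..<d} \<rightarrow>\<^sub>E {..m}"
  proof (clarsimp simp: multi_indices_def)
    fix \<alpha> :: "nat \<Rightarrow> nat" and j assume a: "(\<Sum>j<d. \<alpha> j) < m" "j < d"
    have "\<alpha> j \<le> (\<Sum>j<d. \<alpha> j)" by (rule member_le_sum) (use a in auto)
    then show "\<alpha> j \<le> m" using a by simp
  qed
  ultimately show ?thesis by (metis finite_subset finite_imageD)
qed

lemma multi_indices_0: "m \<ge> 1 \<Longrightarrow> multi_indices 0 m = {\<lambda>_. 0}"
  unfolding multi_indices_def by auto

text \<open>The exponent \<open>b\<close> of the new variable is limited to the order that \<open>\<alpha>\<close> leaves.\<close>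

lemma sum_multi_indices_Suc:
  fixes T :: "(nat \<Rightarrow> nat) \<Rightarrow> real"
  shows "(\<Sum>\<alpha>\<in>multi_indices (Suc k) m. T \<alpha>) = (\<Sum>\<alpha>\<in>multi_indices k m. \<Sum>b<m - (\<Sum>j<k. \<alpha> j). T (\<alpha>(k := b)))"
proof -
  have "(\<Sum>\<alpha>\<in>multi_indices k m. \<Sum>b<m - (\<Sum>j<k. \<alpha> j). T (\<alpha>(k := b)))
      = (\<Sum>(\<alpha>, b)\<in>(SIGMA \<alpha>:multi_indices k m. {..<m - (\<Sum>j<k. \<alpha> j)}). T (\<alpha>(k := b)))"
    by (rule sum.Sigma) (use finite_multi_indices in auto)
  also have "\<dots> = (\<Sum>\<alpha>\<in>multi_indices (Suc k) m. T \<alpha>)"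
  proof (rule sum.reindex_bij_witness[where i = "\<lambda>\<alpha>. (\<alpha>(k := 0), \<alpha> k)" and j = "\<lambda>(\<alpha>, b). \<alpha>(k := b)"])
    fix \<alpha> assume "\<alpha> \<in> multi_indices (Suc k) m"
    then show "(\<alpha>(k := 0), \<alpha> k) \<in> (SIGMA \<alpha>:multi_indices k m. {..<m - (\<Sum>j<k. \<alpha> j)})"
      unfolding multi_indices_def by (auto simp: less_diff_conv)
  next
    fix p assume "p \<in> (SIGMA \<alpha>:multi_indices k m. {..<m - (\<Sum>j<k. \<alpha> j)})"
    then show "(case p of (\<alpha>, b) \<Rightarrow> \<alpha>(k := b)) \<in> multi_indices (Suc k) m"
      unfolding multi_indices_def by (auto simp: less_diff_conv)
    show "((case p of (\<alpha>, b) \<Rightarrow> \<alpha>(k := b))(k := 0), (case p of (\<alpha>, b) \<Rightarrow> \<alpha>(k := b)) k) = p"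
      using \<open>p \<in> _\<close> unfolding multi_indices_def by (auto simp: fun_upd_idem_iff)
  qed auto
  finally show ?thesis ..
qed

text \<open>The expansion point \<open>a\<close> in the variables already expanded, the argument \<open>x\<close> in the others.\<close>

definition hybrid :: "nat \<Rightarrow> (nat \<Rightarrow> real) \<Rightarrow> (nat \<Rightarrow> real) \<Rightarrow> nat \<Rightarrow> real" where
  "hybrid k a x = (\<lambda>j. if j < k then a j else x j)"

lemma hybrid_cube: "a \<in> cube d \<Longrightarrow> x \<in> cube d \<Longrightarrow> hybrid k a x \<in> cube d"
  unfolding cube_def hybrid_def by (auto simp: PiE_iff extensional_def)

lemma hybrid_Suc: "hybrid (Suc k) a x = (hybrid k a x)(k := a k)"
  unfolding hybrid_def by (auto simp: less_Suc_eq)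

lemma abs_le_of_eq_mult:
  fixes a b p q u :: real
  shows "\<lbrakk>u = p * q; \<bar>p\<bar> \<le> a; \<bar>q\<bar> \<le> b; 0 \<le> a\<rbrakk> \<Longrightarrow> \<bar>u\<bar> \<le> a * b"
  by (simp add: abs_mult mult_mono)

text \<open>Expanding the variables one after the other, to the order that is still available, only produces derivatives
of order at most \<open>m\<close> in which \<open>\<partial>\<^sub>0\<close> is applied first, \<open>\<partial>\<^sub>1\<close> next, and so on. These are
exactly the derivatives \<open>mpartial\<close> that the Sobolev norm bounds, so that no
interchange of partial derivatives is required. The \<open>k\<close>-th step turns each term
\<open>\<alpha>\<close> into a sum with error at most \<open>h\<^bsup>\<bar>\<alpha>\<bar>\<^esup> \<cdot> B h\<^bsup>m - \<bar>\<alpha>\<bar>\<^esup>\<close>.\<close>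

lemma taylor_multi:
  assumes F: "Cm_open m d (Rn d) F" and m: "m \<ge> 1"
    and B: "\<And>\<alpha> z. \<alpha> \<in> multi_indices d (Suc m) \<Longrightarrow> z \<in> cube d \<Longrightarrow> \<bar>mpartial d \<alpha> F z\<bar> \<le> B"
    and a: "a \<in> cube d" and x: "x \<in> cube d" and h: "\<And>j. j < d \<Longrightarrow> \<bar>x j - a j\<bar> \<le> h" and h0: "0 \<le> h"
  shows "k \<le> d \<Longrightarrow> \<bar>F x - (\<Sum>\<alpha>\<in>multi_indices k m. mpartial k \<alpha> F (hybrid k a x) / (\<Prod>j<k. fact (\<alpha> j)) * (\<Prod>j<k. (x j - a j) ^ \<alpha> j))\<bar>
     \<le> (\<Sum>k'<k. real (card (multi_indices k' m))) * (B * h ^ m)"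
proof (induction k)
  case 0
  show ?case using multi_indices_0[OF m] by (simp add: hybrid_def)
next
  case (Suc k)
  then have k: "k < d" by simp
  let ?P = "\<lambda>\<alpha>. (\<Prod>j<k. (x j - a j) ^ \<alpha> j) / (\<Prod>j<k. fact (\<alpha> j)) :: real"
  let ?T = "\<lambda>k \<alpha>. mpartial k \<alpha> F (hybrid k a x) / (\<Prod>j<k. fact (\<alpha> j)) * (\<Prod>j<k. (x j - a j) ^ \<alpha> j)"
  have step: "\<bar>?T k \<alpha> - (\<Sum>b<m - (\<Sum>j<k. \<alpha> j). ?T (Suc k) (\<alpha>(k := b)))\<bar> \<le> B * h ^ m" if \<alpha>: "\<alpha> \<in> multi_indices k m" for \<alpha>
  proof -
    let ?s = "\<Sum>j<k. \<alpha> j" and ?g = "mpartial k \<alpha> F" and ?y = "hybrid k a x"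
    let ?r = "m - ?s"
    have s: "?s < m" "\<And>j. k \<le> j \<Longrightarrow> \<alpha> j = 0" using \<alpha> unfolding multi_indices_def by auto
    have yk: "?y k = x k" by (simp add: hybrid_def)
    have "\<bar>?g ?y - (\<Sum>b<?r. (partial k ^^ b) ?g (?y(k := a k)) / fact b * (?y k - a k) ^ b)\<bar> \<le> B * h ^ ?r"
    proof (rule taylor_coord[OF Cm_open_mpartial[OF F] _ k hybrid_cube[OF a x]])
      show "a k \<in> {-1/2..1/2}" using a k unfolding cube_def by (auto simp: PiE_iff)
      fix z assume z: "z \<in> cube d"
      let ?\<beta> = "\<alpha>(k := ?r)"
      have "mpartial d ?\<beta> F = mpartial (Suc k) ?\<beta> F"
        by (rule mpartial_zero) (use k s in auto)
      also have "\<dots> = (partial k ^^ ?r) ?g" using mpartial_cong[of k ?\<beta> \<alpha> F] by simp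
      finally have eq: "mpartial d ?\<beta> F = (partial k ^^ ?r) ?g" .
      have "(\<Sum>j<d. ?\<beta> j) = (\<Sum>j<Suc k. ?\<beta> j)"
        by (rule sum.mono_neutral_right) (use k s in auto)
      also have "\<dots> = m" using s by simp
      finally have "?\<beta> \<in> multi_indices d (Suc m)" unfolding multi_indices_def using k s by auto
      from B[OF this z] show "\<bar>(partial k ^^ ?r) ?g z\<bar> \<le> B" unfolding eq .
    qed (use s k h[OF k] yk in auto)
    then have 1: "\<bar>?g ?y - (\<Sum>b<?r. (partial k ^^ b) ?g (?y(k := a k)) / fact b * (x k - a k) ^ b)\<bar> \<le> B * h ^ ?r"
      unfolding yk .
    have T: "?T (Suc k) (\<alpha>(k := b)) = ?P \<alpha> * ((partial k ^^ b) ?g (?y(k := a k)) / fact b * (x k - a k) ^ b)" for b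
    proof -
      have "(\<Prod>j<k. fact ((\<alpha>(k := b)) j)) = (\<Prod>j<k. fact (\<alpha> j) :: real)"
        "(\<Prod>j<k. (x j - a j) ^ (\<alpha>(k := b)) j) = (\<Prod>j<k. (x j - a j) ^ \<alpha> j)"
        by (rule prod.cong; simp)+
      then show ?thesis using mpartial_cong[of k "\<alpha>(k := b)" \<alpha> F] by (simp add: hybrid_Suc)
    qed
    have "?T k \<alpha> - (\<Sum>b<?r. ?T (Suc k) (\<alpha>(k := b)))
        = ?P \<alpha> * (?g ?y - (\<Sum>b<?r. (partial k ^^ b) ?g (?y(k := a k)) / fact b * (x k - a k) ^ b))"
      unfolding T sum_distrib_left[symmetric] by (simp add: right_diff_distrib)
    moreover have "\<bar>?P \<alpha>\<bar> \<le> h ^ ?s"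
    proof -
      have p1: "1 \<le> (\<Prod>j<k. fact (\<alpha> j) :: real)" by (rule prod_ge_1) simp
      have "\<bar>?P \<alpha>\<bar> = (\<Prod>j<k. \<bar>x j - a j\<bar> ^ \<alpha> j) / (\<Prod>j<k. fact (\<alpha> j))"
        unfolding abs_divide abs_prod power_abs by simp
      also have "\<dots> \<le> (\<Prod>j<k. \<bar>x j - a j\<bar> ^ \<alpha> j)" by (rule divide_le_self[OF p1]) (simp add: prod_nonneg)
      also have "\<dots> \<le> (\<Prod>j<k. h ^ \<alpha> j)" by (rule prod_mono) (use h k in \<open>auto intro!: power_mono\<close>)
      finally show ?thesis by (simp add: power_sum)
    qed
    ultimately have "\<bar>?T k \<alpha> - (\<Sum>b<?r. ?T (Suc k) (\<alpha>(k := b)))\<bar> \<le> h ^ ?s * (B * h ^ ?r)"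
      by (rule abs_le_of_eq_mult[OF _ _ 1]) (use h0 in simp)
    also have "\<dots> = B * h ^ m" using s by (simp add: power_add[symmetric])
    finally show ?thesis .
  qed
  have "\<bar>(\<Sum>\<alpha>\<in>multi_indices k m. ?T k \<alpha>) - (\<Sum>\<alpha>\<in>multi_indices (Suc k) m. ?T (Suc k) \<alpha>)\<bar>
      = \<bar>\<Sum>\<alpha>\<in>multi_indices k m. ?T k \<alpha> - (\<Sum>b<m - (\<Sum>j<k. \<alpha> j). ?T (Suc k) (\<alpha>(k := b)))\<bar>"
    unfolding sum_multi_indices_Suc sum_subtractf ..
  also have "\<dots> \<le> (\<Sum>\<alpha>\<in>multi_indices k m. B * h ^ m)"
    by (rule order_trans[OF sum_abs]) (rule sum_mono, rule step)
  finally have "\<bar>(\<Sum>\<alpha>\<in>multi_indices k m. ?T k \<alpha>) - (\<Sum>\<alpha>\<in>multi_indices (Suc k) m. ?T (Suc k) \<alpha>)\<bar> \<le> real (card (multi_indices k m)) * (B * h ^ m)" by simp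
  moreover have "\<bar>F x - (\<Sum>\<alpha>\<in>multi_indices k m. ?T k \<alpha>)\<bar> \<le> (\<Sum>k'<k. real (card (multi_indices k' m))) * (B * h ^ m)"
    using Suc by simp
  ultimately show ?case unfolding sum.lessThan_Suc distrib_right by linarith
qed

lemma bchoice_pair:
  assumes "\<And>t. t \<in> T \<Longrightarrow> \<exists>a b. P t a b"
  shows "\<exists>f g. \<forall>t\<in>T. P t (f t) (g t)"
proof -
  have "\<forall>t\<in>T. \<exists>a. \<exists>b. P t a b" using assms by blast
  from bchoice[OF this] obtain f where "\<forall>t\<in>T. \<exists>b. P t (f t) b" ..
  from bchoice[OF this] obtain g where "\<forall>t\<in>T. P t (f t) (g t)" ..
  then show ?thesis by blast
qed

section \<open>Localization on a mesh\<close>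

text \<open>The places where a staircase with steps of width \<open>1/M\<close> climbs. The left end points are included: at a mesh point the ramp is
still 0.\<close>

definition mesh_strips :: "nat \<Rightarrow> nat \<Rightarrow> real set" where
  "mesh_strips M m = {t. \<exists>k\<in>{1..<M}. 0 \<le> t + 1/2 - real k / real M \<and> t + 1/2 - real k / real M < 1 / real M ^ (m + 1)}"

text \<open>The slope \<open>M\<^sup>m\<^sup>+\<^sup>1\<close> makes the \<open>M - 1\<close> climbs so short that all strips together have length at
most \<open>M\<^sup>-\<^sup>m\<close>.\<close>

definition staircase :: "nat \<Rightarrow> nat \<Rightarrow> real \<Rightarrow> real" where
  "staircase M m t = (\<Sum>k<M - 1. 1 * clamp01 (real M ^ (m + 1) * t + real M ^ (m + 1) * (1/2 - real (Suc k) / real M)))"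

lemma staircase_index:
  assumes t: "t \<in> {-1/2..1/2}" "t \<notin> mesh_strips M m" and M: "M \<ge> 1"
  shows "\<exists>q<M. staircase M m t = real q \<and> real q / real M \<le> t + 1/2 \<and> t + 1/2 \<le> (real q + 1) / real M"
proof -
  obtain q where q: "q < M" "real q \<le> real M * (t + 1/2)" "real M * (t + 1/2) \<le> real q + 1"
    using subinterval_index[of "t + 1/2" M] t(1) M by auto
  have q': "real q / real M \<le> t + 1/2" "t + 1/2 \<le> (real q + 1) / real M"
    using q M by (simp_all add: field_simps)
  let ?R = "real M ^ (m + 1)"
  have R: "?R > 0" using M by simp
  have arg: "?R * t + ?R * (1/2 - real (Suc k) / real M) = ?R * (t + 1/2 - real (Suc k) / real M)" for k
    by (simp add: algebra_simps)
  have "clamp01 (?R * t + ?R * (1/2 - real (Suc k) / real M)) = (if k < q then 1 else 0)" if k: "k < M - 1" for k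
  proof (cases "k < q")
    case True
    have "real (Suc k) / real M \<le> real q / real M" using True by (intro divide_right_mono) auto
    then have "0 \<le> t + 1/2 - real (Suc k) / real M" using q' by linarith
    moreover have "Suc k \<in> {1..<M}" using k by auto
    ultimately have "1 / ?R \<le> t + 1/2 - real (Suc k) / real M" using t(2) unfolding mesh_strips_def by force
    then have "1 \<le> ?R * (t + 1/2 - real (Suc k) / real M)" using R by (simp only: pos_divide_le_eq mult.commute)
    then show ?thesis using True clamp01_simps(3) unfolding arg by simp
  next
    case False
    have "(real q + 1) / real M \<le> real (Suc k) / real M" using False by (intro divide_right_mono) auto
    then have "?R * (t + 1/2 - real (Suc k) / real M) \<le> 0" using q' R by (intro mult_nonneg_nonpos) auto
    then show ?thesis using False clamp01_simps(1) unfolding arg by simp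
  qed
  then have "staircase M m t = (\<Sum>k<M - 1. if k < q then 1 else 0)" unfolding staircase_def by (intro sum.cong) auto
  also have "\<dots> = real (card ({..<M - 1} \<inter> {k. k < q}))" by (simp add: sum.If_cases)
  also have "{..<M - 1} \<inter> {k. k < q} = {..<q}" using q(1) by auto
  finally show ?thesis using q(1) q' by auto
qed

text \<open>Increments of a table, to be summed up by ramps that are saturated up to the position that is looked up.\<close>

definition table_diff :: "(nat \<Rightarrow> real) \<Rightarrow> nat \<Rightarrow> real" where
  "table_diff c k = c k - (if k = 0 then 0 else c (k - 1))"

lemma table_lookup:
  assumes "q < K"
  shows "(\<Sum>k<K. table_diff c k * clamp01 (1 * real q + (1 - real k))) = c q"
proof -
  have "(\<Sum>k<K. table_diff c k * clamp01 (1 * real q + (1 - real k)))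
      = (\<Sum>k<K. table_diff c k * clamp01 ((real q + 1) + - real k))"
    by (simp add: algebra_simps)
  also have "\<dots> = (\<Sum>k<q. table_diff c k) + table_diff c q * (real q + 1 - real q)"
    by (rule sum_clamps) (use assms in auto)
  also have "\<dots> = (\<Sum>k<Suc q. table_diff c k)" by simp
  also have "\<dots> = c q" by (induction q) (auto simp: table_diff_def)
  finally show ?thesis .
qed

text \<open>The indices of a mesh cube are the base-\<open>M\<close> digits of its number, which is linear in the
indices and hence cheap to compute from the staircases.\<close>

lemma code_less:
  fixes q :: "nat \<Rightarrow> nat"
  assumes "\<And>j. j < d \<Longrightarrow> q j < M"
  shows "(\<Sum>l<d. q l * M ^ l) < M ^ d"
  using assms
proof (induction d)
  case (Suc d)
  then have "(\<Sum>l<d. q l * M ^ l) < M ^ d" by simp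
  moreover have "q d * M ^ d + M ^ d \<le> M * M ^ d"
    using mult_right_mono[of "q d + 1" M "M ^ d"] Suc.prems[of d] by simp
  ultimately show ?case by simp
qed simp

lemma code_digit:
  fixes q :: "nat \<Rightarrow> nat"
  assumes "\<And>j. j < d \<Longrightarrow> q j < M" and "j < d"
  shows "(\<Sum>l<d. q l * M ^ l) div M ^ j mod M = q j"
  using assms
proof (induction d)
  case (Suc d)
  let ?S = "\<Sum>l<d. q l * M ^ l"
  have M: "M > 0" using Suc.prems(1)[of 0] by simp
  have S: "?S < M ^ d" by (rule code_less) (use Suc.prems in simp)
  show ?case
  proof (cases "j = d")
    case True
    have "(?S + q d * M ^ d) div M ^ d = q d" using S M by simp
    then show ?thesis using True Suc.prems(1)[of d] by simp
  next
    case False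
    then have j: "j < d" using Suc.prems by simp
    obtain e where e: "d = j + Suc e" using j less_iff_Suc_add by auto
    (* the top digit contributes a multiple of M to the quotient by M ^ j *)
    have "q d * M ^ d = (q d * M ^ e * M) * M ^ j" unfolding e by (simp add: power_add)
    then have "(?S + q d * M ^ d) div M ^ j = (?S + (q d * M ^ e * M) * M ^ j) div M ^ j" by (simp only:)
    also have "\<dots> = q d * M ^ e * M + ?S div M ^ j" by (rule div_mult_self1) (use M in simp)
    finally have "(?S + q d * M ^ d) div M ^ j mod M = ?S div M ^ j mod M" by simp
    then show ?thesis using Suc.IH[OF Suc.prems(1) j] by simp
  qed
qed simp

lemma prod_list_replicates:
  fixes y :: "nat \<Rightarrow> real"
  shows "prod_list (map y (concat (map (\<lambda>j. replicate (\<alpha> j) j) [0..<d]))) = (\<Prod>j<d. y j ^ \<alpha> j)"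
  by (induction d) (auto simp: prod_list_replicate)

text \<open>The coefficient \<open>c\<close> comes first, each variable is then repeated according to its exponent, and the list is padded with 1 to the
length \<open>P\<close> of a full product tree.\<close>

lemma monomial_as_product:
  assumes "\<alpha> \<in> multi_indices d m" and "m \<le> P"
  shows "\<exists>js. set js \<subseteq> {..<d} \<and> (\<forall>(y :: nat \<Rightarrow> real) c. (\<Prod>t<P. if t = 0 then c else if t - 1 < length js then y (js ! (t - 1)) else 1)
           = c * (\<Prod>j<d. y j ^ \<alpha> j))"
proof (intro exI conjI allI)
  let ?js = "concat (map (\<lambda>j. replicate (\<alpha> j) j) [0..<d])"
  show "set ?js \<subseteq> {..<d}" by auto
  have len: "length ?js = (\<Sum>j<d. \<alpha> j)" by (induction d) auto
  fix y :: "nat \<Rightarrow> real" and c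
  obtain P' where P': "P = Suc P'" using assms unfolding multi_indices_def by (cases P) auto
  have le: "length ?js \<le> P'" using assms len P' unfolding multi_indices_def by simp
  have "(\<Prod>t<P. if t = 0 then c else if t - 1 < length ?js then y (?js ! (t - 1)) else 1)
      = c * (\<Prod>t<P'. if t < length ?js then y (?js ! t) else 1)"
    unfolding P' prod.lessThan_Suc_shift by (simp cong: if_cong)
  also have "(\<Prod>t<P'. if t < length ?js then y (?js ! t) else 1) = (\<Prod>t<length ?js. if t < length ?js then y (?js ! t) else 1)"
    by (rule prod.mono_neutral_right) (use le in auto)
  also have "\<dots> = (\<Prod>t<length ?js. map y ?js ! t)" by (rule prod.cong) auto
  also have "\<dots> = prod_list (map y ?js)" by (simp add: prod.list_conv_set_nth lessThan_atLeast0)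
  finally show "(\<Prod>t<P. if t = 0 then c else if t - 1 < length ?js then y (?js ! (t - 1)) else 1) = c * (\<Prod>j<d. y j ^ \<alpha> j)"
    unfolding prod_list_replicates .
qed

text \<open>The corner with minimal coordinates of the mesh cube with number \<open>\<kappa>\<close>.\<close>

definition corner :: "nat \<Rightarrow> nat \<Rightarrow> nat \<Rightarrow> nat \<Rightarrow> real" where
  "corner M d \<kappa> = (\<lambda>j. if j < d then - 1/2 + real (\<kappa> div M ^ j mod M) / real M else undefined)"

lemma corner_cube: "M \<ge> 1 \<Longrightarrow> corner M d \<kappa> \<in> cube d"
proof -
  assume M: "M \<ge> 1"
  have "- 1/2 + real (k mod M) / real M \<in> {- 1/2..1/2}" for k
  proof -
    have "real (k mod M) / real M \<le> 1" using M mod_less_divisor[of M k] by (simp add: divide_le_eq_1)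
    moreover have "0 \<le> real (k mod M) / real M" by simp
    ultimately show ?thesis unfolding atLeastAtMost_iff by linarith
  qed
  then show ?thesis unfolding corner_def cube_def PiE_iff extensional_def by simp
qed

context net_family begin

lemma realized_staircase: "j < n \<Longrightarrow> realized 1 (\<lambda>i x. staircase (N i) m (x j))"
proof -
  assume j: "j < n"
  have "realized (Suc 0) (\<lambda>i x. staircase (N i) m (x j))"
    unfolding staircase_def
  proof (rule realized_clamps[OF realized_coord[OF j], where A = 1 and D = 1 and p = "m + 1"])
    fix i assume i: "i \<in> I"
    show "0 < N i - 1" using N[OF i] by simp
    have "N i ^ 1 \<le> N i ^ (n - 1)" using N[OF i] n by (intro power_increasing) auto
    then show "N i - 1 \<le> 1 * N i ^ (n - 1)" by simp
    fix k assume k: "k < N i - 1"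
    show "\<bar>1\<bar> \<le> 1 * real (N i) ^ (m + 1)" using one_le_power[of "real (N i)" "m + 1"] N[OF i] by simp
    have "real (Suc k) / real (N i) \<le> 1" "0 \<le> real (Suc k) / real (N i)" using k by (auto simp: divide_le_eq_1)
    then have "\<bar>1/2 - real (Suc k) / real (N i)\<bar> \<le> 1" by linarith
    then have "real (N i) ^ (m + 1) * \<bar>1/2 - real (Suc k) / real (N i)\<bar> \<le> real (N i) ^ (m + 1) * 1"
      by (rule mult_left_mono) simp
    then show "\<bar>real (N i) ^ (m + 1) * (1/2 - real (Suc k) / real (N i))\<bar> \<le> 1 * real (N i) ^ (m + 1)"
      by (simp only: abs_mult mult.left_neutral mult_1_right abs_of_nonneg zero_le_power of_nat_0_le_iff)
  qed simp
  then show ?thesis by simp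
qed

text \<open>Off the strips the staircases yield the number of the mesh cube and the rescaled local coordinates
\<open>y\<^sub>j \<in> [0,1]\<close>. The Taylor coefficients, divided by \<open>B\<close> and scaled by \<open>N\<^sup>-\<^sup>|\<^sup>\<alpha>\<^sup>|\<close>, lie in \<open>[-1,1]\<close> and are
looked up. Hence only one product per multi-index has to be formed, and the number of multi-indices does not depend on \<open>N\<close>.\<close>

lemma approx_smooth:
  fixes F :: "'i \<Rightarrow> (nat \<Rightarrow> real) \<Rightarrow> real"
  assumes d: "d < n" and m: "m \<ge> 1" and K: "m \<le> 2 ^ K" and q: "2 * (n - 1) * q \<ge> m" and B0: "B > 0"
    and F: "\<And>i. i \<in> I \<Longrightarrow> Cm_open m d (Rn d) (F i)"
    and B: "\<And>i \<alpha> z. i \<in> I \<Longrightarrow> \<alpha> \<in> multi_indices d (Suc m) \<Longrightarrow> z \<in> cube d \<Longrightarrow> \<bar>mpartial d \<alpha> (F i) z\<bar> \<le> B"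
  shows "\<exists>G. realized (2 + K * (q + 2)) G \<and> (\<exists>c. \<forall>i\<in>I. \<forall>x\<in>cube n. (\<forall>j<d. x j \<notin> mesh_strips (N i) m) \<longrightarrow>
            \<bar>G i x - F i (restrict x {..<d})\<bar> \<le> c / real (N i) ^ m)"
proof -
  (* number of the mesh cube, local coordinates, order, and scaled Taylor coefficients with their lookup *)
  define \<kappa> where "\<kappa> i x = (\<Sum>j<d. real (N i) ^ j * staircase (N i) m (x j))" for i and x :: "nat \<Rightarrow> real"
  define y where "y j i x = real (N i) * x j + (- 1) * staircase (N i) m (x j) + real (N i) / 2" for j i and x :: "nat \<Rightarrow> real"
  define s where "s \<alpha> = (\<Sum>j<d. \<alpha> j)" for \<alpha> :: "nat \<Rightarrow> nat"
  define ct where "ct \<alpha> i k = mpartial d \<alpha> (F i) (corner (N i) d k) / (\<Prod>j<d. fact (\<alpha> j)) / B / real (N i) ^ s \<alpha>" for \<alpha> i k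
  define tab where "tab \<alpha> i x = (\<Sum>k<N i ^ d. table_diff (ct \<alpha> i) k * clamp01 (1 * \<kappa> i x + (1 - real k)))" for \<alpha> i x
  have N1: "1 \<le> real (N i)" if "i \<in> I" for i using N[OF that] by simp
  have MIS: "multi_indices d m \<subseteq> multi_indices d (Suc m)" unfolding multi_indices_def by auto
  have ct: "\<bar>ct \<alpha> i k\<bar> \<le> 1" if "\<alpha> \<in> multi_indices d m" "i \<in> I" for \<alpha> i k
  proof -
    let ?D = "\<bar>mpartial d \<alpha> (F i) (corner (N i) d k)\<bar>"
    have p1: "1 \<le> (\<Prod>j<d. fact (\<alpha> j) :: real)" by (rule prod_ge_1) simp
    have "\<bar>ct \<alpha> i k\<bar> = ?D / (\<Prod>j<d. fact (\<alpha> j)) / B / real (N i) ^ s \<alpha>"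
      unfolding ct_def abs_divide using p1 B0 by simp
    also have "\<dots> \<le> ?D / (\<Prod>j<d. fact (\<alpha> j)) / B"
      by (rule divide_le_self) (use one_le_power[OF N1[OF that(2)]] p1 B0 in auto)
    also have "\<dots> \<le> ?D / B" by (intro divide_right_mono divide_le_self p1) (use B0 in auto)
    also have "\<dots> \<le> 1"
      using B[OF that(2) subsetD[OF MIS that(1)] corner_cube] N[OF that(2)] B0 by simp
    finally show ?thesis .
  qed
  have nk: "realized 1 \<kappa>"
    unfolding \<kappa>_def
  proof (rule realized_sum)
    show "realized 1 (\<lambda>i x. staircase (N i) m (x j))" if "j \<in> {..<d}" for j using that d by (intro realized_staircase) simp
    show "poly_bounded (\<lambda>i. real (N i) ^ j)" for j by (rule poly_bounded_power)
  qed simp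
  have ny: "realized 1 (y j)" if "j < d" for j
    unfolding y_def
  proof (rule realized_lin)
    show "realized 1 (\<lambda>i x. x j)" by (rule realized_pad[OF _ realized_coord]) (use that d in auto)
    show "realized 1 (\<lambda>i x. staircase (N i) m (x j))" using that d by (intro realized_staircase) simp
    show "poly_bounded (\<lambda>i. real (N i))" using poly_bounded_power[of 1] by simp
    show "poly_bounded (\<lambda>i. real (N i) / 2)" unfolding poly_bounded_def by (intro exI[of _ 1]) simp
  qed (rule poly_bounded_const)
  have nt: "realized 2 (tab \<alpha>)" if \<alpha>: "\<alpha> \<in> multi_indices d m" for \<alpha>
  proof -
    have "realized (Suc 1) (\<lambda>i x. tab \<alpha> i x)"
      unfolding tab_def
    proof (rule realized_clamps[OF nk, where A = 2 and D = 1 and p = "n - 1"])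
      fix i assume i: "i \<in> I"
      show "0 < N i ^ d" using N[OF i] by simp
      have le: "N i ^ d \<le> N i ^ (n - 1)" using N[OF i] d by (intro power_increasing) auto
      then show "N i ^ d \<le> 1 * N i ^ (n - 1)" by simp
      fix k assume k: "k < N i ^ d"
      have P1: "1 \<le> real (N i) ^ (n - 1)" by (rule one_le_power[OF N1[OF i]])
      then show "\<bar>1\<bar> \<le> 2 * real (N i) ^ (n - 1)" by simp
      have "\<bar>table_diff (ct \<alpha> i) k\<bar> \<le> 2"
        unfolding table_diff_def using ct[OF \<alpha> i, of k] ct[OF \<alpha> i, of "k - 1"] by (auto split: if_splits)
      then show "\<bar>table_diff (ct \<alpha> i) k\<bar> \<le> 2 * real (N i) ^ (n - 1)" using P1 by linarith
      have "real k \<le> real (N i) ^ (n - 1)"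
        using k le unfolding of_nat_power[symmetric] of_nat_le_iff by linarith
      then show "\<bar>1 - real k\<bar> \<le> 2 * real (N i) ^ (n - 1)" using P1 by linarith
    qed
    then show ?thesis by (simp add: numeral_2_eq_2)
  qed
  define Q where "Q \<alpha> h c \<longleftrightarrow> realized (2 + K * (q + 2)) h \<and> (\<forall>i\<in>I. \<forall>x. \<bar>tab \<alpha> i x\<bar> \<le> 1 \<and> (\<forall>j<d. \<bar>y j i x\<bar> \<le> 1) \<longrightarrow>
       \<bar>h i x - tab \<alpha> i x * (\<Prod>j<d. y j i x ^ \<alpha> j)\<bar> \<le> c / real (N i) ^ m)" for \<alpha> h c
  have mon: "\<exists>h c. Q \<alpha> h c" if \<alpha>: "\<alpha> \<in> multi_indices d m" for \<alpha>
  proof -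
    obtain js where js: "set js \<subseteq> {..<d}" "\<And>(y :: nat \<Rightarrow> real) c. (\<Prod>t<2^K. if t = 0 then c else if t - 1 < length js then y (js ! (t - 1)) else 1)
           = c * (\<Prod>j<d. y j ^ \<alpha> j)" using monomial_as_product[OF \<alpha> K] by blast
    define v where "v t i x = (if t = 0 then tab \<alpha> i x else if t - 1 < length js then y (js ! (t - 1)) i x else 1)" for t i and x :: "nat \<Rightarrow> real"
    have jd: "js ! k < d" if "k < length js" for k using js(1) nth_mem[OF that] by auto
    have "realized 2 (v t)" for t
    proof (cases "t = 0 \<or> \<not> t - 1 < length js")
      case True
      then show ?thesis using nt[OF \<alpha>] realized_pad[OF _ realized_const[of "\<lambda>_. 1"], of 2]
        unfolding v_def by (cases "t = 0") simp_all
    next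
      case False
      then show ?thesis using realized_pad[OF _ ny[OF jd], of 2 "t - 1"] unfolding v_def by simp
    qed
    from realized_prod[OF q, of K 2 v, OF this] obtain h c where h: "realized (2 + K * (q + 2)) h"
      "\<forall>i\<in>I. \<forall>x. (\<forall>t<2 ^ K. \<bar>v t i x\<bar> \<le> 1) \<longrightarrow> \<bar>h i x - (\<Prod>t<2 ^ K. v t i x)\<bar> \<le> c / real (N i) ^ m" by blast
    have "\<bar>h i x - tab \<alpha> i x * (\<Prod>j<d. y j i x ^ \<alpha> j)\<bar> \<le> c / real (N i) ^ m"
      if "i \<in> I" "\<bar>tab \<alpha> i x\<bar> \<le> 1" "\<forall>j<d. \<bar>y j i x\<bar> \<le> 1" for i x
    proof -
      have "\<bar>v t i x\<bar> \<le> 1" for t unfolding v_def using that jd by auto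
      moreover have "(\<Prod>t<2 ^ K. v t i x) = tab \<alpha> i x * (\<Prod>j<d. y j i x ^ \<alpha> j)"
        unfolding v_def using js(2)[of "tab \<alpha> i x" "\<lambda>j. y j i x"] .
      ultimately show ?thesis using bspec[OF h(2) that(1), THEN spec, of x] by simp
    qed
    then have "Q \<alpha> h c" unfolding Q_def using h(1) by simp
    then show ?thesis by blast
  qed
  obtain h c where hc: "\<forall>\<alpha>\<in>multi_indices d m. Q \<alpha> (h \<alpha>) (c \<alpha>)" using bchoice_pair[of "multi_indices d m" Q, OF mon] by blast
  then have h: "\<And>\<alpha>. \<alpha> \<in> multi_indices d m \<Longrightarrow> realized (2 + K * (q + 2)) (h \<alpha>)"
    and c: "\<And>\<alpha> i x. \<lbrakk>\<alpha> \<in> multi_indices d m; i \<in> I; \<bar>tab \<alpha> i x\<bar> \<le> 1; \<forall>j<d. \<bar>y j i x\<bar> \<le> 1\<rbrakk> \<Longrightarrow>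
       \<bar>h \<alpha> i x - tab \<alpha> i x * (\<Prod>j<d. y j i x ^ \<alpha> j)\<bar> \<le> c \<alpha> / real (N i) ^ m"
    unfolding Q_def by auto
  define G where "G i x = (\<Sum>\<alpha>\<in>multi_indices d m. B * h \<alpha> i x)" for i x
  have nG: "realized (2 + K * (q + 2)) G"
    unfolding G_def by (rule realized_sum[OF finite_multi_indices h]) auto
  let ?c = "(\<Sum>\<alpha>\<in>multi_indices d m. B * c \<alpha>) + (\<Sum>k'<d. real (card (multi_indices k' m))) * B"
  have "\<bar>G i x - F i (restrict x {..<d})\<bar> \<le> ?c / real (N i) ^ m"
    if i: "i \<in> I" and x: "x \<in> cube n" and good: "\<forall>j<d. x j \<notin> mesh_strips (N i) m" for i x
  proof -
    let ?M = "N i"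
    have M: "?M \<ge> 1" using N[OF i] by simp
    have xj: "x j \<in> {-1/2..1/2}" if "j < d" for j using x d that unfolding cube_def by (auto simp: PiE_iff)
    have "\<exists>p. j < d \<longrightarrow> p < ?M \<and> staircase ?M m (x j) = real p \<and> real p / real ?M \<le> x j + 1/2 \<and> x j + 1/2 \<le> (real p + 1) / real ?M" for j
      using staircase_index[OF xj, of j ?M m] good M by (cases "j < d") auto
    then obtain p where p: "\<And>j. j < d \<Longrightarrow> p j < ?M" "\<And>j. j < d \<Longrightarrow> staircase ?M m (x j) = real (p j)"
      "\<And>j. j < d \<Longrightarrow> real (p j) / real ?M \<le> x j + 1/2" "\<And>j. j < d \<Longrightarrow> x j + 1/2 \<le> (real (p j) + 1) / real ?M"
      using choice[of "\<lambda>j p. j < d \<longrightarrow> p < ?M \<and> staircase ?M m (x j) = real p \<and> real p / real ?M \<le> x j + 1/2 \<and> x j + 1/2 \<le> (real p + 1) / real ?M"] by blast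
    define k where "k = (\<Sum>l<d. p l * ?M ^ l)"
    have kd: "k < ?M ^ d" unfolding k_def by (rule code_less) (rule p)
    have \<kappa>: "\<kappa> i x = real k" unfolding \<kappa>_def k_def by (simp add: p(2) mult.commute)
    define a where "a = corner ?M d k"
    have aj: "a j = - 1/2 + real (p j) / real ?M" if "j < d" for j
      unfolding a_def corner_def k_def using that code_digit[of d p ?M j] p(1) by simp
    define x' where "x' = restrict x {..<d}"
    have x': "x' \<in> cube d" using x d unfolding x'_def cube_def by (auto simp: PiE_iff)
    have yj: "y j i x = real ?M * (x' j - a j)" if "j < d" for j
      unfolding y_def x'_def aj[OF that] p(2)[OF that] using that M by (simp add: field_simps)
    have xa: "0 \<le> x' j - a j" "x' j - a j \<le> 1 / real ?M" if "j < d" for j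
      using p(3,4)[OF that] aj[OF that] that unfolding x'_def by (auto simp: add_divide_distrib)
    have y1: "\<forall>j<d. \<bar>y j i x\<bar> \<le> 1"
    proof (intro allI impI)
      fix j assume j: "j < d"
      have "real ?M * (x' j - a j) \<le> real ?M * (1 / real ?M)" by (rule mult_left_mono[OF xa(2)[OF j]]) simp
      then show "\<bar>y j i x\<bar> \<le> 1" unfolding yj[OF j] using xa(1)[OF j] M by (simp add: abs_mult)
    qed
    have tab: "tab \<alpha> i x = ct \<alpha> i k" for \<alpha> unfolding tab_def \<kappa> by (rule table_lookup[OF kd])
    have ma: "hybrid d a x' = a" unfolding hybrid_def a_def corner_def x'_def by auto
    have T: "B * (tab \<alpha> i x * (\<Prod>j<d. y j i x ^ \<alpha> j))
       = mpartial d \<alpha> (F i) (hybrid d a x') / (\<Prod>j<d. fact (\<alpha> j)) * (\<Prod>j<d. (x' j - a j) ^ \<alpha> j)" for \<alpha>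
    proof -
      have "(\<Prod>j<d. y j i x ^ \<alpha> j) = (\<Prod>j<d. real ?M ^ \<alpha> j * (x' j - a j) ^ \<alpha> j)"
        by (rule prod.cong) (simp_all add: yj power_mult_distrib)
      also have "\<dots> = real ?M ^ s \<alpha> * (\<Prod>j<d. (x' j - a j) ^ \<alpha> j)"
        unfolding prod.distrib s_def power_sum ..
      finally show ?thesis unfolding tab ct_def ma a_def[symmetric] using B0 M by simp
    qed
    let ?S = "\<Sum>\<alpha>\<in>multi_indices d m. mpartial d \<alpha> (F i) (hybrid d a x') / (\<Prod>j<d. fact (\<alpha> j)) * (\<Prod>j<d. (x' j - a j) ^ \<alpha> j)"
    have "\<bar>F i x' - ?S\<bar> \<le> (\<Sum>k'<d. real (card (multi_indices k' m))) * (B * (1 / real ?M) ^ m)"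
      by (rule taylor_multi[OF F[OF i] m B[OF i] _ x']) (use xa M corner_cube in \<open>auto simp: a_def\<close>)
    moreover have "\<bar>G i x - ?S\<bar> \<le> (\<Sum>\<alpha>\<in>multi_indices d m. B * c \<alpha>) / real ?M ^ m"
    proof -
      have "\<bar>G i x - ?S\<bar> = \<bar>\<Sum>\<alpha>\<in>multi_indices d m. B * (h \<alpha> i x - tab \<alpha> i x * (\<Prod>j<d. y j i x ^ \<alpha> j))\<bar>"
        unfolding G_def T[symmetric] sum_subtractf[symmetric] right_diff_distrib ..
      also have "\<dots> \<le> (\<Sum>\<alpha>\<in>multi_indices d m. B * (c \<alpha> / real ?M ^ m))"
      proof (rule order_trans[OF sum_abs], rule sum_mono)
        fix \<alpha> assume \<alpha>: "\<alpha> \<in> multi_indices d m"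
        have "\<bar>h \<alpha> i x - tab \<alpha> i x * (\<Prod>j<d. y j i x ^ \<alpha> j)\<bar> \<le> c \<alpha> / real ?M ^ m"
          by (rule c[OF \<alpha> i _ y1]) (simp add: tab ct[OF \<alpha> i])
        then show "\<bar>B * (h \<alpha> i x - tab \<alpha> i x * (\<Prod>j<d. y j i x ^ \<alpha> j))\<bar> \<le> B * (c \<alpha> / real ?M ^ m)"
          unfolding abs_mult abs_of_pos[OF B0] by (rule mult_left_mono) (use B0 in simp)
      qed
      also have "\<dots> = (\<Sum>\<alpha>\<in>multi_indices d m. B * c \<alpha>) / real ?M ^ m" by (simp add: sum_divide_distrib)
      finally show ?thesis .
    qed
    ultimately have "\<bar>G i x - F i x'\<bar> \<le> (\<Sum>\<alpha>\<in>multi_indices d m. B * c \<alpha>) / real ?M ^ m + (\<Sum>k'<d. real (card (multi_indices k' m))) * (B * (1 / real ?M) ^ m)"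
      by linarith
    also have "\<dots> = ?c / real ?M ^ m" by (simp add: add_divide_distrib power_one_over)
    finally show ?thesis unfolding x'_def .
  qed
  then show ?thesis using nG by blast
qed

end

section \<open>Measure of the exceptional set\<close>

abbreviation lborel_Rn :: "nat \<Rightarrow> (nat \<Rightarrow> real) measure" where
  "lborel_Rn n \<equiv> \<Pi>\<^sub>M i\<in>{..<n}. lborel"

lemma space_lborel_Rn: "space (lborel_Rn n) = Rn n"
  unfolding space_PiM Rn_def by simp

lemma restrict_borel: "d \<le> n \<Longrightarrow> (\<lambda>x. restrict x {..<d}) \<in> lborel_Rn n \<rightarrow>\<^sub>M borel"
proof (rule measurable_coordinatewise_then_product)
  fix i assume d: "d \<le> n"
  show "(\<lambda>x. restrict x {..<d} i) \<in> borel_measurable (lborel_Rn n)"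
  proof (cases "i < d")
    case True
    then have "(\<lambda>x. x i) \<in> lborel_Rn n \<rightarrow>\<^sub>M lborel" using d by (intro measurable_component_singleton) auto
    then show ?thesis using True by simp
  qed simp
qed

lemma continuous_measurable:
  assumes "continuous_on (Rn d) F" "d \<le> n"
  shows "(\<lambda>x. F (restrict x {..<d})) \<in> borel_measurable (lborel_Rn n)"
proof -
  have "(\<lambda>x. restrict x {..<d}) \<in> lborel_Rn n \<rightarrow>\<^sub>M restrict_space borel (Rn d)"
    by (rule measurable_restrict_space2[OF _ restrict_borel[OF assms(2)]]) (auto simp: Rn_def)
  moreover have "F \<in> borel_measurable (restrict_space borel (Rn d))"
    by (rule borel_measurable_continuous_on_restrict[OF assms(1)])
  ultimately show ?thesis by (rule measurable_compose)
qed

lemma cube_sets: "cube n \<in> sets (lborel_Rn n)"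
  unfolding cube_def by (intro sets_PiM_I_finite) auto

lemma emeasure_box: "finite J \<Longrightarrow> (\<And>j. j \<in> J \<Longrightarrow> X j \<in> sets borel) \<Longrightarrow>
    emeasure (\<Pi>\<^sub>M i\<in>J. lborel) (PiE J X) = (\<Prod>j\<in>J. emeasure lborel (X j :: real set))"
proof -
  interpret product_sigma_finite "\<lambda>_. lborel :: real measure" ..
  show "finite J \<Longrightarrow> (\<And>j. j \<in> J \<Longrightarrow> X j \<in> sets borel) \<Longrightarrow>
    emeasure (\<Pi>\<^sub>M i\<in>J. lborel) (PiE J X) = (\<Prod>j\<in>J. emeasure lborel (X j))"
    by (rule emeasure_PiM) auto
qed

text \<open>By Fubini, since the section of the cube orthogonal to direction \<open>i\<close> has measure 1. It suffices to cover
the sections of \<open>S\<close>, so that intervals can be used without computing the sections themselves.\<close>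

lemma emeasure_slices:
  assumes S: "S \<in> sets (lborel_Rn n)" "S \<subseteq> cube n" and i: "i < n"
    and T: "\<And>x. \<exists>T\<in>sets borel. {y. x(i := y) \<in> S} \<subseteq> T \<and> emeasure lborel T \<le> t"
  shows "emeasure (lborel_Rn n) S \<le> t"
proof -
  interpret product_sigma_finite "\<lambda>_. lborel :: real measure" ..
  let ?J = "{..<n} - {i}" and ?Q = "PiE ({..<n} - {i}) (\<lambda>_. {-1/2..1/2 :: real})"
  have ins: "insert i ?J = {..<n}" using i by auto
  have "emeasure (lborel_Rn n) S = (\<integral>\<^sup>+x. indicator S x \<partial>(lborel_Rn n))" using S by simp
  also have "\<dots> = (\<integral>\<^sup>+x. (\<integral>\<^sup>+y. indicator S (x(i := y)) \<partial>lborel) \<partial>(PiM ?J (\<lambda>_. lborel)))"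
    using product_nn_integral_insert[of ?J i "indicator S"] S unfolding ins by simp
  also have "\<dots> \<le> (\<integral>\<^sup>+x. t * indicator ?Q x \<partial>(PiM ?J (\<lambda>_. lborel)))"
  proof (rule nn_integral_mono)
    fix x :: "nat \<Rightarrow> real" assume x: "x \<in> space (PiM ?J (\<lambda>_. lborel))"
    show "(\<integral>\<^sup>+y. indicator S (x(i := y)) \<partial>lborel) \<le> t * indicator ?Q x"
    proof (cases "x \<in> ?Q")
      case True
      obtain T where T: "T \<in> sets borel" "{y. x(i := y) \<in> S} \<subseteq> T" "emeasure lborel T \<le> t" using T by blast
      have "(\<integral>\<^sup>+y. indicator S (x(i := y)) \<partial>lborel) \<le> (\<integral>\<^sup>+y. indicator T y \<partial>lborel)"
        by (rule nn_integral_mono) (use T(2) in \<open>auto simp: indicator_def\<close>)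
      also have "\<dots> = emeasure lborel T" using T(1) by simp
      finally show ?thesis using T(3) True by simp
    next
      case False
      have "x(i := y) \<notin> S" for y
      proof
        assume "x(i := y) \<in> S"
        then have c: "x(i := y) \<in> cube n" using S(2) by auto
        have "x j \<in> {-1/2..1/2}" if "j \<in> ?J" for j
          using c that unfolding cube_def by (auto simp: PiE_iff dest!: bspec[of _ _ j])
        then show False using False x by (auto simp: PiE_iff space_PiM)
      qed
      then show ?thesis using False by simp
    qed
  qed
  also have "\<dots> = t * emeasure (PiM ?J (\<lambda>_. lborel)) ?Q"
    by (rule nn_integral_cmult_indicator) (auto intro!: sets_PiM_I_finite)
  also have "emeasure (PiM ?J (\<lambda>_. lborel)) ?Q = 1"
    by (subst emeasure_box) auto
  finally show ?thesis by simp
qed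

text \<open>The sections in direction \<open>i\<close> are intervals of length \<open>2 \<delta>\<close>, as \<open>F\<close> depends on the coordinates before the
\<open>i\<close>-th only.\<close>

lemma emeasure_near_graph:
  assumes F: "continuous_on (Rn i) F" and i: "i < n" and \<delta>: "\<delta> \<ge> 0"
  defines "S \<equiv> {x \<in> cube n. \<bar>x i - F (restrict x {..<i})\<bar> \<le> \<delta>}"
  shows "S \<in> sets (lborel_Rn n)" and "emeasure (lborel_Rn n) S \<le> ennreal (2 * \<delta>)"
proof -
  have m: "(\<lambda>x. F (restrict x {..<i})) \<in> borel_measurable (lborel_Rn n)" by (rule continuous_measurable[OF F]) (use i in simp)
  have "(\<lambda>x. x i) \<in> lborel_Rn n \<rightarrow>\<^sub>M lborel" using i by (intro measurable_component_singleton) auto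
  then have m': "(\<lambda>x. x i) \<in> borel_measurable (lborel_Rn n)" by simp
  have "{x \<in> space (lborel_Rn n). \<bar>x i - F (restrict x {..<i})\<bar> \<le> \<delta>} \<in> sets (lborel_Rn n)"
    using m m' by measurable
  then have "cube n \<inter> {x \<in> space (lborel_Rn n). \<bar>x i - F (restrict x {..<i})\<bar> \<le> \<delta>} \<in> sets (lborel_Rn n)"
    using cube_sets by (rule sets.Int[rotated])
  moreover have "cube n \<inter> {x \<in> space (lborel_Rn n). \<bar>x i - F (restrict x {..<i})\<bar> \<le> \<delta>} = S"
    unfolding S_def space_lborel_Rn using cube_subset_Rn by auto
  ultimately show S: "S \<in> sets (lborel_Rn n)" by simp
  show "emeasure (lborel_Rn n) S \<le> ennreal (2 * \<delta>)"
  proof (rule emeasure_slices[OF S _ i])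
    fix x
    let ?c = "F (restrict x {..<i})"
    have "restrict (x(i := y)) {..<i} = restrict x {..<i}" for y by (auto simp: restrict_def)
    then have "{y. x(i := y) \<in> S} \<subseteq> {?c - \<delta>..?c + \<delta>}" unfolding S_def by (auto simp: abs_le_iff)
    moreover have "emeasure lborel {?c - \<delta>..?c + \<delta>} \<le> ennreal (2 * \<delta>)" using \<delta> by simp
    ultimately show "\<exists>T\<in>sets borel. {y. x(i := y) \<in> S} \<subseteq> T \<and> emeasure lborel T \<le> ennreal (2 * \<delta>)"
      by (intro bexI[of _ "{?c - \<delta>..?c + \<delta>}"]) auto
  qed (auto simp: S_def)
qed

lemma mesh_strips_UN:
  "mesh_strips M m = (\<Union>k\<in>{1..<M}. {real k / real M - 1/2..<real k / real M - 1/2 + 1 / real M ^ (m + 1)})"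
  unfolding mesh_strips_def by (auto simp: algebra_simps)

lemma emeasure_mesh_strips:
  assumes "M \<ge> 1"
  shows "mesh_strips M m \<in> sets borel" and "emeasure lborel (mesh_strips M m) \<le> ennreal (1 / real M ^ m)"
proof -
  show "mesh_strips M m \<in> sets borel" unfolding mesh_strips_UN by auto
  let ?A = "\<lambda>k. {real k / real M - 1/2..<real k / real M - 1/2 + 1 / real M ^ (m + 1)}"
  have "emeasure lborel (mesh_strips M m) \<le> (\<Sum>k\<in>{1..<M}. emeasure lborel (?A k))"
    unfolding mesh_strips_UN by (rule emeasure_subadditive_finite) auto
  also have "\<dots> = (\<Sum>k\<in>{1..<M}. ennreal (1 / real M ^ (m + 1)))" by (rule sum.cong) auto
  also have "\<dots> = ennreal (real (M - 1) * (1 / real M ^ (m + 1)))" by (subst sum_ennreal) simp_all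
  also have "\<dots> \<le> ennreal (real M * (1 / real M ^ (m + 1)))"
    by (intro ennreal_leI mult_right_mono) auto
  also have "real M * (1 / real M ^ (m + 1)) = 1 / real M ^ m" using assms by simp
  finally show "emeasure lborel (mesh_strips M m) \<le> ennreal (1 / real M ^ m)" .
qed

lemma emeasure_coord_in_strips:
  fixes m :: nat
  assumes M: "M \<ge> 1" and j: "j < n"
  defines "S \<equiv> {x \<in> cube n. x j \<in> mesh_strips M m}"
  shows "S \<in> sets (lborel_Rn n)" and "emeasure (lborel_Rn n) S \<le> ennreal (1 / real M ^ m)"
proof -
  have "(\<lambda>x. x j) \<in> lborel_Rn n \<rightarrow>\<^sub>M lborel" using j by (intro measurable_component_singleton) auto
  then have "(\<lambda>x. x j) -` mesh_strips M m \<inter> space (lborel_Rn n) \<in> sets (lborel_Rn n)"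
    by (rule measurable_sets) (use emeasure_mesh_strips(1)[OF M] in simp)
  then have "cube n \<inter> ((\<lambda>x. x j) -` mesh_strips M m \<inter> space (lborel_Rn n)) \<in> sets (lborel_Rn n)"
    using cube_sets by (rule sets.Int[rotated])
  moreover have "cube n \<inter> ((\<lambda>x. x j) -` mesh_strips M m \<inter> space (lborel_Rn n)) = S"
    unfolding S_def space_lborel_Rn using cube_subset_Rn by auto
  ultimately show S: "S \<in> sets (lborel_Rn n)" by simp
  show "emeasure (lborel_Rn n) S \<le> ennreal (1 / real M ^ m)"
    by (rule emeasure_slices[OF S _ j]) (use emeasure_mesh_strips[OF M] in \<open>auto simp: S_def\<close>)
qed

section \<open>Pointwise bounds from the Sobolev norm\<close>

lemma interval_pos:
  fixes c :: real
  assumes "open X" "c \<in> X" "c \<in> {-1/2..1/2}"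
  shows "emeasure lborel (X \<inter> {-1/2..1/2}) > 0"
proof -
  obtain e where e: "e > 0" "ball c e \<subseteq> X" using assms open_contains_ball by blast
  define \<delta> where "\<delta> = min (e / 2) (1/2)"
  have \<delta>: "\<delta> > 0" "\<delta> < e" "\<delta> \<le> 1/2" using e unfolding \<delta>_def by auto
  (* an interval on the side of c that faces the centre stays in [-1/2, 1/2], also if c is an end point *)
  define l where "l = (if c \<le> 0 then c else c - \<delta>)"
  have "{l..l + \<delta>} \<subseteq> X \<inter> {-1/2..1/2}"
  proof
    fix y assume y: "y \<in> {l..l + \<delta>}"
    then have "y \<in> ball c e" using \<delta> by (auto simp: dist_real_def l_def split: if_splits)
    moreover have "y \<in> {-1/2..1/2}" using y \<delta> assms(3) by (auto simp: l_def split: if_splits)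
    ultimately show "y \<in> X \<inter> {-1/2..1/2}" using e(2) by blast
  qed
  moreover have "X \<inter> {-1/2..1/2} \<in> sets lborel" using assms(1) by simp
  ultimately have "emeasure lborel {l..l + \<delta>} \<le> emeasure lborel (X \<inter> {-1/2..1/2})" by (rule emeasure_mono)
  moreover have "emeasure lborel {l..l + \<delta>} > 0" using \<delta> by simp
  ultimately show ?thesis by (rule less_le_trans[rotated])
qed

text \<open>If \<open>\<bar>g\<bar>\<close> exceeded \<open>B\<close> somewhere in the cube, it would do so on the intersection of the cube with an open box, which has
positive measure also at the boundary of the cube.\<close>

lemma continuous_le_esssup:
  assumes g: "continuous_on (Rn d) g" and B: "esssup (cube_measure d) (\<lambda>x. ereal \<bar>g x\<bar>) \<le> ereal B" and x0: "x0 \<in> cube d"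
  shows "\<bar>g x0\<bar> \<le> B"
proof (rule ccontr)
  assume "\<not> \<bar>g x0\<bar> \<le> B"
  then have gx: "\<bar>g x0\<bar> > B" by simp
  have "continuous_on (Rn d) (\<lambda>x. \<bar>g x\<bar>)" using g by (intro continuous_intros)
  then obtain T where T: "open T" "T \<inter> Rn d = (\<lambda>x. \<bar>g x\<bar>) -` {B<..} \<inter> Rn d"
    unfolding continuous_on_open_invariant using open_greaterThan by blast
  have x0R: "x0 \<in> Rn d" using x0 cube_subset_Rn by blast
  have "x0 \<in> T" using T(2) gx x0R by auto
  moreover have "openin (product_topology (\<lambda>_. euclidean) UNIV) T" using T(1) by (simp add: euclidean_product_topology)
  ultimately obtain X where X: "x0 \<in> PiE UNIV X" "\<And>i. open (X i)" "PiE UNIV X \<subseteq> T"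
    using product_topology_open_contains_basis[of "\<lambda>_. euclidean" UNIV T x0] by auto
  define Q where "Q = PiE {..<d} (\<lambda>j. X j \<inter> {-1/2..1/2})"
  have Qc: "Q \<subseteq> cube d" unfolding Q_def cube_def by (rule PiE_mono) auto
  have QT: "Q \<subseteq> T"
  proof
    fix x assume x: "x \<in> Q"
    have "x j \<in> X j" for j
    proof (cases "j < d")
      case True
      then show ?thesis using x unfolding Q_def by (auto simp: PiE_iff)
    next
      case False
      then have "x j = x0 j" using x x0 unfolding Q_def cube_def by (auto simp: PiE_iff extensional_def)
      then show ?thesis using X(1) by auto
    qed
    then show "x \<in> T" using X(3) by auto
  qed
  have Qs: "Q \<in> sets (lborel_Rn d)" unfolding Q_def using X(2) by (intro sets_PiM_I_finite) auto
  have "emeasure (lborel_Rn d) Q = (\<Prod>j<d. emeasure lborel (X j \<inter> {-1/2..1/2}))"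
    unfolding Q_def by (rule emeasure_box) (use X(2) in auto)
  also have "\<dots> > 0"
  proof -
    have "emeasure lborel (X j \<inter> {-1/2..1/2}) \<noteq> 0" if "j < d" for j
      using interval_pos[OF X(2), of "x0 j" j] X(1) x0 that unfolding cube_def by (auto simp: PiE_iff)
    then show ?thesis by (simp add: zero_less_iff_neq_zero)
  qed
  finally have pos: "emeasure (lborel_Rn d) Q > 0" .
  have "AE x in cube_measure d. ereal \<bar>g x\<bar> \<le> ereal B"
    using esssup_AE[where M = "cube_measure d" and f = "\<lambda>x. ereal \<bar>g x\<bar>"]
  proof (rule AE_mp)
    show "AE x in cube_measure d. ereal \<bar>g x\<bar> \<le> esssup (cube_measure d) (\<lambda>x. ereal \<bar>g x\<bar>) \<longrightarrow> ereal \<bar>g x\<bar> \<le> ereal B"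
      using order_trans[OF _ B] by (intro AE_I2) blast
  qed
  then obtain N where N: "{x \<in> space (cube_measure d). \<not> ereal \<bar>g x\<bar> \<le> ereal B} \<subseteq> N"
      "emeasure (cube_measure d) N = 0" "N \<in> sets (cube_measure d)" by (rule AE_E)
  have sp: "space (cube_measure d) = cube d"
    unfolding cube_measure_def space_restrict_space space_lborel_Rn using cube_subset_Rn by auto
  have "Q \<subseteq> N"
  proof
    fix x assume "x \<in> Q"
    then have "x \<in> T \<inter> Rn d" "x \<in> cube d" using QT Qc cube_subset_Rn by auto
    then show "x \<in> N" using N(1) sp T(2) by auto
  qed
  then have "emeasure (cube_measure d) Q \<le> emeasure (cube_measure d) N" using N(3) by (rule emeasure_mono)
  moreover have "emeasure (cube_measure d) Q = emeasure (lborel_Rn d) Q"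
    unfolding cube_measure_def by (rule emeasure_restrict_space) (use cube_sets Qc space_lborel_Rn cube_subset_Rn in \<open>auto simp: Int_absorb2\<close>)
  ultimately show False using pos N(2) by simp
qed

lemma mpartial_le_sobolev_norm:
  assumes F: "Cm_open m d (Rn d) F" and B: "sobolev_norm m d F \<le> ereal B" and \<alpha>: "\<alpha> \<in> multi_indices d (Suc m)" and z: "z \<in> cube d"
  shows "\<bar>mpartial d \<alpha> F z\<bar> \<le> B"
proof -
  let ?A = "{\<alpha> \<in> {..<d} \<rightarrow>\<^sub>E UNIV. (\<Sum>j<d. \<alpha> j) \<le> m} :: (nat \<Rightarrow> nat) set"
  let ?\<alpha> = "restrict \<alpha> {..<d}"
  let ?e = "\<lambda>\<alpha>. esssup (cube_measure d) (\<lambda>x. ereal \<bar>mpartial d \<alpha> F x\<bar>)"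
  have "?A \<subseteq> (\<lambda>\<alpha>. restrict \<alpha> {..<d}) ` multi_indices d (Suc m)"
  proof
    fix \<beta> assume b: "\<beta> \<in> ?A"
    let ?\<beta> = "\<lambda>j. if j < d then \<beta> j else 0"
    have "\<beta> = restrict ?\<beta> {..<d}" using b by (auto simp: PiE_iff extensional_def restrict_def)
    moreover have "?\<beta> \<in> multi_indices d (Suc m)" using b unfolding multi_indices_def by auto
    ultimately show "\<beta> \<in> (\<lambda>\<alpha>. restrict \<alpha> {..<d}) ` multi_indices d (Suc m)" by (rule image_eqI)
  qed
  then have fin: "finite ?A" using finite_multi_indices finite_subset by blast
  have "?\<alpha> \<in> ?A" using \<alpha> unfolding multi_indices_def by auto
  then have "?e ?\<alpha> \<le> sobolev_norm m d F" unfolding sobolev_norm_def using fin by (intro Max_ge) auto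
  also have "mpartial d ?\<alpha> F = mpartial d \<alpha> F" by (rule mpartial_cong) simp
  finally have "?e \<alpha> \<le> ereal B" using B by simp
  moreover have "Cm_open (m - (\<Sum>j<d. \<alpha> j)) d (Rn d) (mpartial d \<alpha> F)"
    by (rule Cm_open_mpartial[OF F]) (use \<alpha> in \<open>auto simp: multi_indices_def\<close>)
  then have "continuous_on (Rn d) (mpartial d \<alpha> F)" using Cm_open_mono[of _ d "Rn d" _ 0] by force
  ultimately show ?thesis by (intro continuous_le_esssup[OF _ _ z])
qed

section \<open>Cells described by inequalities\<close>

text \<open>The flag \<open>b\<close> distinguishes the two kinds of steps in a trace, bands and graphs.\<close>

definition fibre_cond :: "bool \<Rightarrow> ((nat \<Rightarrow> real) \<Rightarrow> real) \<Rightarrow> ((nat \<Rightarrow> real) \<Rightarrow> real) \<Rightarrow> nat \<Rightarrow> (nat \<Rightarrow> real) \<Rightarrow> bool" where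
  "fibre_cond b F G i x \<longleftrightarrow>
     (if b then F (restrict x {..<i}) < x i \<and> x i < G (restrict x {..<i}) else x i = F (restrict x {..<i}))"

definition cell :: "nat \<Rightarrow> (nat \<Rightarrow> bool) \<Rightarrow> (nat \<Rightarrow> (nat \<Rightarrow> real) \<Rightarrow> real) \<Rightarrow> (nat \<Rightarrow> (nat \<Rightarrow> real) \<Rightarrow> real) \<Rightarrow> (nat \<Rightarrow> real) set" where
  "cell n b F G = {x \<in> cube n. \<forall>i<n. fibre_cond (b i) (F i) (G i) i x}"

definition Cm_bounded :: "nat \<Rightarrow> nat \<Rightarrow> real \<Rightarrow> ((nat \<Rightarrow> real) \<Rightarrow> real) \<Rightarrow> bool" where
  "Cm_bounded m d B F \<longleftrightarrow> Cm_open m d (Rn d) F \<and> (\<forall>\<alpha>\<in>multi_indices d (Suc m). \<forall>z\<in>cube d. \<bar>mpartial d \<alpha> F z\<bar> \<le> B)"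

lemma Cm_bounded_continuous: "Cm_bounded m d B F \<Longrightarrow> continuous_on (Rn d) F"
  unfolding Cm_bounded_def using Cm_open_mono[of m d "Rn d" F 0] by simp

text \<open>Fills up the list of cells of a union to its maximal length.\<close>

lemma Cm_bounded_zero: "B \<ge> 0 \<Longrightarrow> Cm_bounded m d B (\<lambda>_. 0)"
proof -
  assume B: "B \<ge> 0"
  have p: "partial j (\<lambda>_. 0) = (\<lambda>_. 0)" for j by (rule ext) (simp add: partial_def)
  have "Cm_open m d (Rn d) (\<lambda>_. 0)" by (induction m) (auto simp: p)
  moreover have "mpartial d \<alpha> (\<lambda>_. 0) = (\<lambda>_. 0)" for \<alpha>
  proof (induction d)
    case (Suc d)
    have "(partial d ^^ k) (\<lambda>_. 0) = (\<lambda>_. 0)" for k by (induction k) (auto simp: p)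
    then show ?case using Suc by simp
  qed simp
  ultimately show ?thesis unfolding Cm_bounded_def using B by simp
qed

text \<open>The successive bases \<open>As k\<close> only enter through the conditions on the first \<open>k\<close> coordinates. Since \<open>F\<close> and \<open>G\<close> are
defined on all of \<open>\<real>\<^sup>i\<close>, these conditions can be imposed simultaneously, without reference to the bases.\<close>

lemma traces_imp_cell:
  assumes tr: "traces m n A As f g" and A: "A \<subseteq> cube n"
    and F: "\<And>i x. i < n \<Longrightarrow> x \<in> As i \<Longrightarrow> F i x = f (Suc i) x" and G: "\<And>i x. i < n \<Longrightarrow> x \<in> As i \<Longrightarrow> G i x = g (Suc i) x"
  shows "\<exists>b. A = cell n b F G"
proof -
  define b where "b i \<longleftrightarrow> (\<forall>x\<in>As i. f (Suc i) x < g (Suc i) x) \<and> As (Suc i) = band i (f (Suc i)) (g (Suc i)) (As i)" for i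
  have "k \<le> n \<Longrightarrow> As k = {x \<in> Rn k. \<forall>i<k. fibre_cond (b i) (F i) (G i) i x}" for k
  proof (induction k)
    case 0
    then show ?case using tr unfolding traces_def by simp
  next
    case (Suc k)
    have IH: "As k = {x \<in> Rn k. \<forall>i<k. fibre_cond (b i) (F i) (G i) i x}" using Suc by simp
    have "Suc k \<in> {1..n}" using Suc.prems by simp
    then have t: "(\<forall>x\<in>As k. f (Suc k) x < g (Suc k) x) \<and> As (Suc k) = band k (f (Suc k)) (g (Suc k)) (As k) \<or>
         (\<forall>x\<in>As k. f (Suc k) x = g (Suc k) x) \<and> As (Suc k) = graph_over k (f (Suc k)) (As k)"
    proof -
      note tr[unfolded traces_def, THEN conjunct2, THEN conjunct2, THEN bspec, OF \<open>Suc k \<in> {1..n}\<close>]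
      then show ?thesis by (elim conjE) simp
    qed
    have k: "k < n" using Suc.prems by simp
    have upd: "restrict (x(k := y)) {..<k} = x" "x(k := y) \<in> Rn (Suc k)" if "x \<in> As k" for x y
    proof -
      have "x \<in> Rn k" using that IH by simp
      then show "restrict (x(k := y)) {..<k} = x" "x(k := y) \<in> Rn (Suc k)"
        unfolding Rn_def by (auto simp: PiE_iff extensional_def restrict_def fun_eq_iff)
    qed
    have recomb: "(restrict x {..<k})(k := x k) = x" if "x \<in> Rn (Suc k)" for x
      using that unfolding Rn_def by (auto simp: PiE_iff extensional_def restrict_def fun_eq_iff)
    have "x \<in> As (Suc k) \<longleftrightarrow> x \<in> Rn (Suc k) \<and> restrict x {..<k} \<in> As k \<and> fibre_cond (b k) (F k) (G k) k x" for x
    proof (cases "b k")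
      case True
      then have As: "As (Suc k) = band k (f (Suc k)) (g (Suc k)) (As k)" unfolding b_def by simp
      show ?thesis
      proof
        assume "x \<in> As (Suc k)"
        then obtain x0 y where x0: "x = x0(k := y)" "x0 \<in> As k" "f (Suc k) x0 < y" "y < g (Suc k) x0"
          unfolding As band_def by blast
        then show "x \<in> Rn (Suc k) \<and> restrict x {..<k} \<in> As k \<and> fibre_cond (b k) (F k) (G k) k x"
          using upd[OF x0(2), of y] True F[OF k] G[OF k] by (simp add: fibre_cond_def)
      next
        assume x: "x \<in> Rn (Suc k) \<and> restrict x {..<k} \<in> As k \<and> fibre_cond (b k) (F k) (G k) k x"
        then have "f (Suc k) (restrict x {..<k}) < x k" "x k < g (Suc k) (restrict x {..<k})"
          using True F[OF k] G[OF k] by (auto simp: fibre_cond_def)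
        then show "x \<in> As (Suc k)"
          unfolding As band_def using x recomb[of x] by (intro CollectI exI[of _ "restrict x {..<k}"] exI[of _ "x k"]) simp
      qed
    next
      case False
      then have As: "As (Suc k) = graph_over k (f (Suc k)) (As k)" using t unfolding b_def by blast
      show ?thesis
      proof
        assume "x \<in> As (Suc k)"
        then obtain x0 where x0: "x = x0(k := f (Suc k) x0)" "x0 \<in> As k"
          unfolding As graph_over_def by blast
        then show "x \<in> Rn (Suc k) \<and> restrict x {..<k} \<in> As k \<and> fibre_cond (b k) (F k) (G k) k x"
          using upd[OF x0(2), of "f (Suc k) x0"] False F[OF k] by (simp add: fibre_cond_def)
      next
        assume x: "x \<in> Rn (Suc k) \<and> restrict x {..<k} \<in> As k \<and> fibre_cond (b k) (F k) (G k) k x"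
        then have "x k = f (Suc k) (restrict x {..<k})"
          using False F[OF k] by (auto simp: fibre_cond_def)
        then show "x \<in> As (Suc k)"
          unfolding As graph_over_def using x recomb[of x] by (intro CollectI exI[of _ "restrict x {..<k}"]) simp
      qed
    qed
    moreover have "restrict x {..<k} \<in> As k \<longleftrightarrow> (\<forall>i<k. fibre_cond (b i) (F i) (G i) i x)" for x
    proof -
      have "restrict x {..<k} \<in> Rn k" unfolding Rn_def by simp
      moreover have "fibre_cond (b i) (F i) (G i) i (restrict x {..<k}) = fibre_cond (b i) (F i) (G i) i x" if "i < k" for i
        using that unfolding fibre_cond_def by (simp add: restrict_restrict min_absorb2 Int_absorb1 lessThan_subset_iff)
      ultimately show ?thesis unfolding IH by auto
    qed
    ultimately show ?case by (auto simp: less_Suc_eq)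
  qed
  then have "A = {x \<in> Rn n. \<forall>i<n. fibre_cond (b i) (F i) (G i) i x}" using tr unfolding traces_def by simp
  then have "A = cell n b F G" unfolding cell_def using A cube_subset_Rn by blast
  then show ?thesis by blast
qed

lemma K_cells_imp_cell:
  assumes "A \<in> K_cells m n B"
  shows "\<exists>b F G. A = cell n b F G \<and> (\<forall>j<n. Cm_bounded m j B (F j) \<and> Cm_bounded m j B (G j))"
proof -
  define P where "P As f g i F G \<longleftrightarrow>
               Cm_open m (i - 1) (Rn (i - 1)) F \<and> Cm_open m (i - 1) (Rn (i - 1)) G \<and>
               (\<forall>x\<in>As (i - 1). F x = f i x) \<and> (\<forall>x\<in>As (i - 1). G x = g i x) \<and>
               sobolev_norm m (i - 1) F \<le> ereal B \<and> sobolev_norm m (i - 1) G \<le> ereal B"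
    for As :: "nat \<Rightarrow> (nat \<Rightarrow> real) set" and f g :: "nat \<Rightarrow> (nat \<Rightarrow> real) \<Rightarrow> real" and i F G
  have "A \<subseteq> cube n \<and> (\<exists>As f g. traces m n A As f g \<and> (\<forall>i\<in>{1..n}. \<exists>F G. P As f g i F G))"
    using assms unfolding K_cells_def P_def by blast
  then obtain As f g where A: "A \<subseteq> cube n" and tr: "traces m n A As f g"
    and ex: "\<And>i. i \<in> {1..n} \<Longrightarrow> \<exists>F G. P As f g i F G" by blast
  obtain F G where FG: "\<forall>i\<in>{1..n}. P As f g i (F i) (G i)" using bchoice_pair[of "{1..n}" "P As f g", OF ex] by blast
  let ?F = "\<lambda>j. F (Suc j)" and ?G = "\<lambda>j. G (Suc j)"
  have PF: "P As f g (Suc j) (?F j) (?G j)" if "j < n" for j using FG that by simp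
  have "\<exists>b. A = cell n b ?F ?G"
    by (rule traces_imp_cell[OF tr A]) (use PF in \<open>auto simp: P_def\<close>)
  moreover have "Cm_bounded m j B (?F j) \<and> Cm_bounded m j B (?G j)" if "j < n" for j
    using PF[OF that] mpartial_le_sobolev_norm unfolding P_def Cm_bounded_def by auto
  ultimately show ?thesis by blast
qed

text \<open>\<open>F k\<close> and \<open>G k\<close> are provided for all \<open>k\<close>, also for \<open>k \<ge> l\<close>, so that unions with fewer than \<open>ell\<close> cells
belong to the same family of networks.\<close>

lemma K_unions_imp_cells:
  assumes "\<Omega> \<in> K_unions m n B ell" and B: "B \<ge> 0"
  shows "\<exists>l b F G. l \<le> ell \<and> (\<forall>k. \<forall>j<n. Cm_bounded m j B (F k j) \<and> Cm_bounded m j B (G k j)) \<and>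
     disjoint_family_on (\<lambda>k. cell n (b k) (F k) (G k)) {..<l} \<and> \<Omega> = (\<Union>k<l. cell n (b k) (F k) (G k))"
proof -
  obtain l A where l: "l \<le> ell" "\<And>k. k < l \<Longrightarrow> A k \<in> K_cells m n B" "disjoint_family_on A {..<l}" "\<Omega> = (\<Union>k<l. A k)"
    using assms(1) unfolding K_unions_def by blast
  define P where "P k b F G \<longleftrightarrow> A k = cell n b F G \<and> (\<forall>j<n. Cm_bounded m j B (F j) \<and> Cm_bounded m j B (G j))" for k b F G
  have "\<exists>b. \<exists>FG. P k b (fst FG) (snd FG)" if "k \<in> {..<l}" for k
    using K_cells_imp_cell[OF l(2)] that unfolding P_def by fastforce
  from bchoice_pair[of "{..<l}" "\<lambda>k b FG. P k b (fst FG) (snd FG)", OF this]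
  obtain b FG where P: "\<forall>k\<in>{..<l}. P k (b k) (fst (FG k)) (snd (FG k))" by blast
  define F where "F k = (if k < l then fst (FG k) else (\<lambda>_ _. 0))" for k
  define G where "G k = (if k < l then snd (FG k) else (\<lambda>_ _. 0))" for k
  have A: "A k = cell n (b k) (F k) (G k)" if "k < l" for k
    using P that unfolding P_def F_def G_def by simp
  have "Cm_bounded m j B (F k j) \<and> Cm_bounded m j B (G k j)" if "j < n" for k j
    using P that Cm_bounded_zero[OF B, of m j] unfolding P_def F_def G_def by (cases "k < l") auto
  moreover have "disjoint_family_on (\<lambda>k. cell n (b k) (F k) (G k)) {..<l}"
    using l(3) A unfolding disjoint_family_on_def by simp
  moreover have "\<Omega> = (\<Union>k<l. cell n (b k) (F k) (G k))" using l(4) A by simp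
  ultimately show ?thesis using l(1) by (intro exI[of _ l] exI[of _ b] exI[of _ F] exI[of _ G]) blast
qed

lemma coord_measurable: "j < n \<Longrightarrow> (\<lambda>x. x j) \<in> borel_measurable (lborel_Rn n)"
proof -
  assume "j < n"
  then have "(\<lambda>x. x j) \<in> lborel_Rn n \<rightarrow>\<^sub>M lborel" by (intro measurable_component_singleton) auto
  then show ?thesis by simp
qed

lemma cell_sets:
  assumes "\<And>j. j < n \<Longrightarrow> Cm_bounded m j B (F j) \<and> Cm_bounded m j B (G j)"
  shows "cell n b F G \<in> sets (lborel_Rn n)"
proof -
  have "{x \<in> space (lborel_Rn n). fibre_cond (b j) (F j) (G j) j x} \<in> sets (lborel_Rn n)" if j: "j < n" for j
  proof -
    have [measurable]: "(\<lambda>x. F j (restrict x {..<j})) \<in> borel_measurable (lborel_Rn n)"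
      "(\<lambda>x. G j (restrict x {..<j})) \<in> borel_measurable (lborel_Rn n)" "(\<lambda>x. x j) \<in> borel_measurable (lborel_Rn n)"
      using assms[OF j] j by (auto intro!: continuous_measurable Cm_bounded_continuous coord_measurable)
    show ?thesis unfolding fibre_cond_def by (cases "b j") simp_all
  qed
  then have "{x \<in> space (lborel_Rn n). \<forall>j\<in>{..<n}. fibre_cond (b j) (F j) (G j) j x} \<in> sets (lborel_Rn n)"
    by (intro sets.sets_Collect_finite_All) auto
  then have "cube n \<inter> {x \<in> space (lborel_Rn n). \<forall>j\<in>{..<n}. fibre_cond (b j) (F j) (G j) j x} \<in> sets (lborel_Rn n)"
    by (rule sets.Int[OF cube_sets])
  moreover have "cube n \<inter> {x \<in> space (lborel_Rn n). \<forall>j\<in>{..<n}. fibre_cond (b j) (F j) (G j) j x} = cell n b F G"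
    unfolding cell_def space_lborel_Rn using cube_subset_Rn by auto
  ultimately show ?thesis by simp
qed

lemma hidden_measurable: "hidden n M L S F \<Longrightarrow> u \<in> F \<Longrightarrow> u \<in> borel_measurable (lborel_Rn n)"
proof (induction arbitrary: u rule: hidden.induct)
  case hidden_input
  then show ?case by (auto intro: coord_measurable)
next
  case (hidden_step L S F G s S')
  have "neuron F M (s u) u" using hidden_step by blast
  then obtain v where v: "affine_comb F M (s u) v" "u = (\<lambda>x. max 0 (v x))" unfolding neuron_def by blast
  obtain U w b where U: "U \<subseteq> F" "\<forall>x. v x = (\<Sum>v\<in>U. w v * v x) + b"
    using v(1) unfolding affine_comb_def by blast
  have ueq: "u = (\<lambda>x. max 0 ((\<Sum>v\<in>U. w v * v x) + b))" using v(2) U(2) by simp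
  have "(\<lambda>x. w v * v x) \<in> borel_measurable (lborel_Rn n)" if "v \<in> U" for v
    using hidden_step.IH[of v] that U(1) by auto
  then have "(\<lambda>x. \<Sum>v\<in>U. w v * v x) \<in> borel_measurable (lborel_Rn n)" by (rule borel_measurable_sum)
  then show ?case unfolding ueq by measurable
qed

lemma realizable_measurable: "realizable n N C L f \<Longrightarrow> f \<in> borel_measurable (lborel_Rn n)"
proof -
  assume "realizable n N C L f"
  then obtain M S F s where h: "hidden n M (Suc L) S F" "affine_comb F M s f" unfolding realizable_def by blast
  obtain U w b where U: "U \<subseteq> F" "\<forall>x. f x = (\<Sum>v\<in>U. w v * v x) + b"
    using h(2) unfolding affine_comb_def by blast
  have feq: "f = (\<lambda>x. (\<Sum>v\<in>U. w v * v x) + b)" using U(2) by (intro ext) simp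
  have "(\<lambda>x. w v * v x) \<in> borel_measurable (lborel_Rn n)" if "v \<in> U" for v
    using hidden_measurable[OF h(1), of v] that U(1) by auto
  then have "(\<lambda>x. \<Sum>v\<in>U. w v * v x) \<in> borel_measurable (lborel_Rn n)" by (rule borel_measurable_sum)
  then show ?thesis unfolding feq by measurable
qed

section \<open>Networks for cells and their unions\<close>

lemma emeasure_UN_bound:
  assumes "finite T" and "\<And>t. t \<in> T \<Longrightarrow> S t \<in> sets M" and "\<And>t. t \<in> T \<Longrightarrow> emeasure M (S t) \<le> ennreal e" and "e \<ge> 0"
  shows "(\<Union>t\<in>T. S t) \<in> sets M" and "emeasure M (\<Union>t\<in>T. S t) \<le> ennreal (real (card T) * e)"
proof -
  show "(\<Union>t\<in>T. S t) \<in> sets M" using assms by auto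
  have "emeasure M (\<Union>t\<in>T. S t) \<le> (\<Sum>t\<in>T. emeasure M (S t))"
    by (rule emeasure_subadditive_finite) (use assms in auto)
  also have "\<dots> \<le> (\<Sum>t\<in>T. ennreal e)" by (rule sum_mono) (rule assms)
  also have "\<dots> = ennreal (real (card T) * e)" using assms(4) by (subst sum_ennreal) simp_all
  finally show "emeasure M (\<Union>t\<in>T. S t) \<le> ennreal (real (card T) * e)" .
qed

context net_family begin

lemma realized_plain_sum:
  assumes "finite T" and "\<And>t. t \<in> T \<Longrightarrow> realized k (f t)"
  shows "realized k (\<lambda>i x. \<Sum>t\<in>T. f t i x)"
  using realized_sum[where a = "\<lambda>_ _. 1", OF assms] by simp

text \<open>The truth values of the \<open>2 n\<close> inequalities sum to \<open>2 n\<close> if all of them hold and to at most \<open>2 n - 1\<close> otherwise. A cell with a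
graph condition does not meet the set considered here, because \<open>x\<^sub>j = F\<^sub>j\<close> is excluded; its network is zero.\<close>

lemma approx_cell:
  fixes F G :: "'i \<Rightarrow> nat \<Rightarrow> (nat \<Rightarrow> real) \<Rightarrow> real" and b :: "'i \<Rightarrow> nat \<Rightarrow> bool"
  assumes m: "m \<ge> 1" and K: "m \<le> 2 ^ K" and q: "2 * (n - 1) * q \<ge> m" and B: "B > 0"
    and F: "\<And>i j. i \<in> I \<Longrightarrow> j < n \<Longrightarrow> Cm_bounded m j B (F i j)"
    and G: "\<And>i j. i \<in> I \<Longrightarrow> j < n \<Longrightarrow> Cm_bounded m j B (G i j)"
  shows "\<exists>H c. realized (4 + K * (q + 2)) H \<and> c \<ge> 0 \<and>
    (\<forall>i\<in>I. \<forall>x\<in>cube n. (\<forall>j<n. x j \<notin> mesh_strips (N i) m \<and> \<bar>x j - F i j (restrict x {..<j})\<bar> > c / real (N i) ^ m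
        \<and> \<bar>x j - G i j (restrict x {..<j})\<bar> > c / real (N i) ^ m) \<longrightarrow>
        H i x = indicator (cell n (b i) (F i) (G i)) x)"
proof -
  let ?k = "2 + K * (q + 2)"
  define P where "P E j A c \<longleftrightarrow> realized ?k A \<and> (\<forall>i\<in>I. \<forall>x\<in>cube n. (\<forall>l<j. x l \<notin> mesh_strips (N i) m) \<longrightarrow>
            \<bar>A i x - E i j (restrict x {..<j})\<bar> \<le> c / real (N i) ^ m)"
    for E :: "'i \<Rightarrow> nat \<Rightarrow> (nat \<Rightarrow> real) \<Rightarrow> real" and j A c
  have ex: "\<exists>A c. P E j A c" if "j \<in> {..<n}" "\<And>i j. i \<in> I \<Longrightarrow> j < n \<Longrightarrow> Cm_bounded m j B (E i j)" for E j
    unfolding P_def using approx_smooth[of j m K q B "\<lambda>i. E i j"] that m K q B unfolding Cm_bounded_def by auto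
  obtain A c where A: "\<forall>j\<in>{..<n}. P F j (A j) (c j)" using bchoice_pair[of "{..<n}" "P F", OF ex[OF _ F]] by blast
  obtain A' c' where A': "\<forall>j\<in>{..<n}. P G j (A' j) (c' j)" using bchoice_pair[of "{..<n}" "P G", OF ex[OF _ G]] by blast
  (* the additional 1 makes room for the slope of the ramps *)
  define C where "C = (\<Sum>j<n. \<bar>c j\<bar> + \<bar>c' j\<bar>) + 1"
  have C: "c j + 1 \<le> C" "c' j + 1 \<le> C" if "j < n" for j
  proof -
    have "\<bar>c j\<bar> + \<bar>c' j\<bar> \<le> (\<Sum>j<n. \<bar>c j\<bar> + \<bar>c' j\<bar>)" by (rule member_le_sum) (use that in auto)
    then show "c j + 1 \<le> C" "c' j + 1 \<le> C" unfolding C_def by linarith+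
  qed
  have C0: "0 \<le> C" unfolding C_def by (simp add: sum_nonneg add_nonneg_nonneg)
  define u where "u j i x = clamp01 (real (N i) ^ m * (1 * x j + (- 1) * A j i x + 0) + 0)" for j i and x :: "nat \<Rightarrow> real"
  define u' where "u' j i x = clamp01 (real (N i) ^ m * (1 * A' j i x + (- 1) * x j + 0) + 0)" for j i and x :: "nat \<Rightarrow> real"
  have nu: "realized (Suc ?k) (u j)" "realized (Suc ?k) (u' j)" if "j < n" for j
  proof -
    have 1: "realized ?k (\<lambda>i x. x j)" by (rule realized_pad[OF _ realized_coord[OF that]]) simp
    have 2: "realized ?k (A j)" "realized ?k (A' j)" using A A' that unfolding P_def by auto
    show "realized (Suc ?k) (u j)" unfolding u_def
      by (rule realized_clamp[OF realized_lin[OF 1 2(1)] poly_bounded_power]) simp_all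
    show "realized (Suc ?k) (u' j)" unfolding u'_def
      by (rule realized_clamp[OF realized_lin[OF 2(2) 1] poly_bounded_power]) simp_all
  qed
  (* switches the network off if some condition is of graph type *)
  define \<beta> :: "'i \<Rightarrow> real" where "\<beta> i = (if \<forall>j<n. b i j then 1 else 0)" for i
  define H where "H i x = \<beta> i * clamp01 (1 * (\<Sum>j<n. u j i x + u' j i x) + (1 - 2 * real n)) + 0" for i x
  have "realized (Suc (Suc ?k)) H"
    unfolding H_def
  proof (rule realized_scale[OF realized_clamp])
    show "realized (Suc ?k) (\<lambda>i x. \<Sum>j<n. u j i x + u' j i x)"
      by (rule realized_plain_sum) (use nu in \<open>auto intro: realized_add\<close>)
    show "poly_bounded \<beta>" unfolding poly_bounded_def \<beta>_def by (intro exI[of _ 0]) auto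
  qed simp_all
  moreover have "Suc (Suc ?k) = 4 + K * (q + 2)" by simp
  ultimately have "realized (4 + K * (q + 2)) H" by (simp only:)
  moreover have "H i x = indicator (cell n (b i) (F i) (G i)) x"
    if i: "i \<in> I" and x: "x \<in> cube n" and good: "\<And>j. j < n \<Longrightarrow> x j \<notin> mesh_strips (N i) m"
      "\<And>j. j < n \<Longrightarrow> \<bar>x j - F i j (restrict x {..<j})\<bar> > C / real (N i) ^ m"
      "\<And>j. j < n \<Longrightarrow> \<bar>x j - G i j (restrict x {..<j})\<bar> > C / real (N i) ^ m" for i x
  proof (cases "\<forall>j<n. b i j")
    case False
    then obtain j where j: "j < n" "\<not> b i j" by blast
    have "x j \<noteq> F i j (restrict x {..<j})"
    proof
      assume "x j = F i j (restrict x {..<j})"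
      then have "0 > C / real (N i) ^ m" using good(2)[OF j(1)] by simp
      then show False using C0 by (simp add: divide_less_0_iff)
    qed
    then have "x \<notin> cell n (b i) (F i) (G i)" using j unfolding cell_def fibre_cond_def by auto
    moreover have "\<beta> i = 0" unfolding \<beta>_def by (rule if_not_P[OF False])
    ultimately show ?thesis unfolding H_def by simp
  next
    case True
    let ?M = "real (N i) ^ m"
    have M: "?M > 0" using N[OF i] by simp
    (* s approximates s', which keeps a distance from 0 that exceeds the error e / ?M by at least 1 / ?M *)
    have steep: "clamp01 (?M * s) = of_bool (0 < s')" if "\<bar>s - s'\<bar> \<le> e / ?M" "\<bar>s'\<bar> > C / ?M" "e + 1 \<le> C" for s s' e
    proof (cases "0 < s'")
      case True
      have "(e + 1) / ?M \<le> C / ?M" by (rule divide_right_mono) (use that M in auto)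
      then have "e / ?M + 1 / ?M \<le> C / ?M" unfolding add_divide_distrib .
      then have "1 / ?M \<le> s" using that True by linarith
      then have "1 \<le> ?M * s" using M by (simp only: pos_divide_le_eq mult.commute)
      then show ?thesis using clamp01_simps(3) True by simp
    next
      case False
      have "e / ?M \<le> C / ?M" by (rule divide_right_mono) (use that M in auto)
      then have "s \<le> 0" using that False by linarith
      then have "?M * s \<le> 0" using M by (intro mult_nonneg_nonpos) auto
      then show ?thesis using clamp01_simps(1) False by simp
    qed
    have uj: "u j i x = of_bool (F i j (restrict x {..<j}) < x j)" "u' j i x = of_bool (x j < G i j (restrict x {..<j}))"
      if j: "j < n" for j
    proof -
      have a: "\<bar>A j i x - F i j (restrict x {..<j})\<bar> \<le> c j / ?M" "\<bar>A' j i x - G i j (restrict x {..<j})\<bar> \<le> c' j / ?M"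
        using A A' j i x good(1) unfolding P_def by auto
      show "u j i x = of_bool (F i j (restrict x {..<j}) < x j)"
        using steep[of "x j - A j i x" "x j - F i j (restrict x {..<j})" "c j"] a(1) good(2)[OF j] C(1)[OF j]
        unfolding u_def by (simp add: abs_minus_commute)
      show "u' j i x = of_bool (x j < G i j (restrict x {..<j}))"
        using steep[of "A' j i x - x j" "G i j (restrict x {..<j}) - x j" "c' j"] a(2) good(3)[OF j] C(2)[OF j]
        unfolding u'_def by (simp add: abs_minus_commute)
    qed
    define L where "L j \<longleftrightarrow> fibre_cond (b i j) (F i j) (G i j) j x" for j
    have s2: "u j i x + u' j i x \<le> 2" "L j \<Longrightarrow> u j i x + u' j i x = 2" "\<not> L j \<Longrightarrow> u j i x + u' j i x \<le> 1" if "j < n" for j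
      using True that unfolding L_def fibre_cond_def uj[OF that] by auto
    have xin: "x \<in> cell n (b i) (F i) (G i) \<longleftrightarrow> (\<forall>j<n. L j)" unfolding cell_def L_def using x by simp
    have "clamp01 ((\<Sum>j<n. u j i x + u' j i x) + (1 - 2 * real n)) = indicator (cell n (b i) (F i) (G i)) x"
    proof (cases "\<forall>j<n. L j")
      case True
      then have "(\<Sum>j<n. u j i x + u' j i x) = (\<Sum>j<n. 2)" by (intro sum.cong) (use s2 in auto)
      then show ?thesis using True xin by (simp add: clamp01_simps)
    next
      case False
      then obtain l where l: "l < n" "\<not> L l" by blast
      have "(\<Sum>j<n. u j i x + u' j i x) = (u l i x + u' l i x) + (\<Sum>j\<in>{..<n} - {l}. u j i x + u' j i x)"
        by (rule sum.remove) (use l in auto)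
      also have "\<dots> \<le> 1 + (\<Sum>j\<in>{..<n} - {l}. 2)"
        by (intro add_mono sum_mono s2) (use l in auto)
      also have "\<dots> = 2 * real n - 1" using l by (simp add: of_nat_diff)
      finally have "clamp01 ((\<Sum>j<n. u j i x + u' j i x) + (1 - 2 * real n)) = 0" by (intro clamp01_simps) linarith
      then show ?thesis using False xin by simp
    qed
    moreover have "\<beta> i = 1" unfolding \<beta>_def by (rule if_P[OF True])
    ultimately show ?thesis unfolding H_def by simp
  qed
  ultimately show ?thesis using C0 by (intro exI[of _ H] exI[of _ C]) blast
qed

text \<open>The exceptional set consists of the points with a coordinate in a strip and of the layers around the
graphs of all \<open>F\<close> and \<open>G\<close>. Off this set the networks of the cells are exact, and as the cells are disjoint, so is their sum. The
final ramp keeps the values in \<open>[0,1]\<close> on the exceptional set.\<close>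

lemma approx_union_of_cells:
  fixes F G :: "'i \<Rightarrow> nat \<Rightarrow> nat \<Rightarrow> (nat \<Rightarrow> real) \<Rightarrow> real" and b :: "'i \<Rightarrow> nat \<Rightarrow> nat \<Rightarrow> bool"
    and l :: "'i \<Rightarrow> nat" and \<Omega> :: "'i \<Rightarrow> (nat \<Rightarrow> real) set"
  assumes m: "m \<ge> 1" and K: "m \<le> 2 ^ K" and q: "2 * (n - 1) * q \<ge> m" and B: "B > 0"
    and FG: "\<And>i k j. i \<in> I \<Longrightarrow> j < n \<Longrightarrow> Cm_bounded m j B (F i k j) \<and> Cm_bounded m j B (G i k j)"
    and l: "\<And>i. i \<in> I \<Longrightarrow> l i \<le> ell"
    and disj: "\<And>i. i \<in> I \<Longrightarrow> disjoint_family_on (\<lambda>k. cell n (b i k) (F i k) (G i k)) {..<l i}"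
    and \<Omega>: "\<And>i. i \<in> I \<Longrightarrow> \<Omega> i = (\<Union>k<l i. cell n (b i k) (F i k) (G i k))"
  shows "\<exists>\<Phi> c. realized (5 + K * (q + 2)) \<Phi> \<and> c \<ge> 0 \<and> (\<forall>i\<in>I. (\<forall>x. \<Phi> i x \<in> {0..1}) \<and>
     (\<exists>E\<in>sets (lborel_Rn n). emeasure (lborel_Rn n) E \<le> ennreal (c / real (N i) ^ m) \<and>
        (\<forall>x\<in>cube n - E. \<Phi> i x = indicator (\<Omega> i) x)))"
proof -
  define P where "P k H c \<longleftrightarrow> realized (4 + K * (q + 2)) H \<and> c \<ge> 0 \<and>
    (\<forall>i\<in>I. \<forall>x\<in>cube n. (\<forall>j<n. x j \<notin> mesh_strips (N i) m \<and> \<bar>x j - F i k j (restrict x {..<j})\<bar> > c / real (N i) ^ m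
        \<and> \<bar>x j - G i k j (restrict x {..<j})\<bar> > c / real (N i) ^ m) \<longrightarrow>
        H i x = indicator (cell n (b i k) (F i k) (G i k)) x)" for k H c
  have ex: "\<exists>H c. P k H c" for k
    unfolding P_def
    by (rule approx_cell[OF m K q B, of "\<lambda>i. F i k" "\<lambda>i. G i k" "\<lambda>i. b i k"]) (use FG in auto)
  obtain H c where H: "\<forall>k\<in>{..<ell}. P k (H k) (c k)" using bchoice_pair[of "{..<ell}" P, OF ex] by blast
  define C where "C = (\<Sum>k<ell. c k)"
  have c0: "0 \<le> c k" if "k < ell" for k using H that unfolding P_def by auto
  have C0: "0 \<le> C" unfolding C_def by (rule sum_nonneg) (use c0 in auto)
  have cC: "c k \<le> C" if "k < ell" for k
    unfolding C_def by (rule member_le_sum) (use that c0 in auto)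
  define \<gamma> :: "nat \<Rightarrow> 'i \<Rightarrow> real" where "\<gamma> k i = of_bool (k < l i)" for k i
  define \<Phi> where "\<Phi> i x = clamp01 (1 * (\<Sum>k<ell. \<gamma> k i * H k i x) + 0)" for i x
  have "realized (Suc (4 + K * (q + 2))) \<Phi>"
    unfolding \<Phi>_def
  proof (rule realized_clamp)
    show "realized (4 + K * (q + 2)) (\<lambda>i x. \<Sum>k<ell. \<gamma> k i * H k i x)"
    proof (rule realized_sum)
      show "realized (4 + K * (q + 2)) (H k)" if "k \<in> {..<ell}" for k using H that unfolding P_def by blast
      show "poly_bounded (\<gamma> k)" for k unfolding poly_bounded_def \<gamma>_def by (intro exI[of _ 0]) simp
    qed simp
  qed simp_all
  moreover have "Suc (4 + K * (q + 2)) = 5 + K * (q + 2)" by simp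
  ultimately have n\<Phi>: "realized (5 + K * (q + 2)) \<Phi>" by (simp only:)
  let ?c = "real n + 4 * real (ell * n) * C"
  have bad: "\<exists>E\<in>sets (lborel_Rn n). emeasure (lborel_Rn n) E \<le> ennreal (?c / real (N i) ^ m) \<and>
        (\<forall>x\<in>cube n - E. \<Phi> i x = indicator (\<Omega> i) x)" if i: "i \<in> I" for i
  proof -
    let ?M = "real (N i) ^ m"
    have M: "?M > 0" "N i \<ge> 1" using N[OF i] by auto
    define \<delta> where "\<delta> = C / ?M"
    have \<delta>: "\<delta> \<ge> 0" unfolding \<delta>_def using C0 M by simp
    define S1 where "S1 j = {x \<in> cube n. x j \<in> mesh_strips (N i) m}" for j
    define S2 where "S2 = (\<lambda>(k, j). {x \<in> cube n. \<bar>x j - F i k j (restrict x {..<j})\<bar> \<le> \<delta>})"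
    define S3 where "S3 = (\<lambda>(k, j). {x \<in> cube n. \<bar>x j - G i k j (restrict x {..<j})\<bar> \<le> \<delta>})"
    let ?T = "{..<ell} \<times> {..<n}"
    define E where "E = (\<Union>j\<in>{..<n}. S1 j) \<union> ((\<Union>t\<in>?T. S2 t) \<union> (\<Union>t\<in>?T. S3 t))"
    have 1: "S1 j \<in> sets (lborel_Rn n)" "emeasure (lborel_Rn n) (S1 j) \<le> ennreal (1 / ?M)" if "j \<in> {..<n}" for j
      unfolding S1_def using emeasure_coord_in_strips[OF M(2), of j n m] that by auto
    have 2: "S2 t \<in> sets (lborel_Rn n)" "emeasure (lborel_Rn n) (S2 t) \<le> ennreal (2 * \<delta>)" if "t \<in> ?T" for t
      unfolding S2_def using that FG[OF i] \<delta> by (auto intro!: emeasure_near_graph Cm_bounded_continuous)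
    have 3: "S3 t \<in> sets (lborel_Rn n)" "emeasure (lborel_Rn n) (S3 t) \<le> ennreal (2 * \<delta>)" if "t \<in> ?T" for t
      unfolding S3_def using that FG[OF i] \<delta> by (auto intro!: emeasure_near_graph Cm_bounded_continuous)
    have U1: "(\<Union>j\<in>{..<n}. S1 j) \<in> sets (lborel_Rn n)" "emeasure (lborel_Rn n) (\<Union>j\<in>{..<n}. S1 j) \<le> ennreal (real (card {..<n}) * (1 / ?M))"
      by (rule emeasure_UN_bound[where e = "1 / ?M", OF _ 1]; use M in simp)+
    have U2: "(\<Union>t\<in>?T. S2 t) \<in> sets (lborel_Rn n)" "emeasure (lborel_Rn n) (\<Union>t\<in>?T. S2 t) \<le> ennreal (real (card ?T) * (2 * \<delta>))"
      by (rule emeasure_UN_bound[where e = "2 * \<delta>", OF _ 2]; use \<delta> in simp)+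
    have U3: "(\<Union>t\<in>?T. S3 t) \<in> sets (lborel_Rn n)" "emeasure (lborel_Rn n) (\<Union>t\<in>?T. S3 t) \<le> ennreal (real (card ?T) * (2 * \<delta>))"
      by (rule emeasure_UN_bound[where e = "2 * \<delta>", OF _ 3]; use \<delta> in simp)+
    have E: "E \<in> sets (lborel_Rn n)" unfolding E_def by (intro sets.Un U1(1) U2(1) U3(1))
    have "emeasure (lborel_Rn n) E \<le> emeasure (lborel_Rn n) (\<Union>j\<in>{..<n}. S1 j) + (emeasure (lborel_Rn n) (\<Union>t\<in>?T. S2 t) + emeasure (lborel_Rn n) (\<Union>t\<in>?T. S3 t))"
      unfolding E_def
      by (rule order_trans[OF emeasure_subadditive[OF U1(1) sets.Un[OF U2(1) U3(1)]]])
         (rule add_left_mono, rule emeasure_subadditive[OF U2(1) U3(1)])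
    also have "\<dots> \<le> ennreal (real (card {..<n}) * (1 / ?M)) + (ennreal (real (card ?T) * (2 * \<delta>)) + ennreal (real (card ?T) * (2 * \<delta>)))"
      by (intro add_mono U1(2) U2(2) U3(2))
    also have "\<dots> = ennreal (real (card {..<n}) * (1 / ?M) + (real (card ?T) * (2 * \<delta>) + real (card ?T) * (2 * \<delta>)))"
      using M \<delta> by (subst ennreal_plus[symmetric]; simp)+
    also have "real (card {..<n}) * (1 / ?M) + (real (card ?T) * (2 * \<delta>) + real (card ?T) * (2 * \<delta>)) = ?c / ?M"
      unfolding \<delta>_def by (simp add: card_cartesian_product add_divide_distrib)
    finally have eE: "emeasure (lborel_Rn n) E \<le> ennreal (?c / ?M)" .
    have "\<Phi> i x = indicator (\<Omega> i) x" if x: "x \<in> cube n - E" for x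
    proof -
      have Hx: "H k i x = indicator (cell n (b i k) (F i k) (G i k)) x" if k: "k < ell" for k
      proof -
        have "c k / ?M \<le> \<delta>" unfolding \<delta>_def by (rule divide_right_mono[OF cC[OF k]]) (use M in simp)
        moreover have "x j \<notin> mesh_strips (N i) m" "\<not> \<bar>x j - F i k j (restrict x {..<j})\<bar> \<le> \<delta>" "\<not> \<bar>x j - G i k j (restrict x {..<j})\<bar> \<le> \<delta>"
          if "j < n" for j using x k that unfolding E_def S1_def S2_def S3_def by auto
        ultimately have "\<forall>j<n. x j \<notin> mesh_strips (N i) m \<and> \<bar>x j - F i k j (restrict x {..<j})\<bar> > c k / ?M
             \<and> \<bar>x j - G i k j (restrict x {..<j})\<bar> > c k / ?M" by (meson not_le order_le_less_trans)
        moreover have "P k (H k) (c k)" using H k by simp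
        ultimately show ?thesis unfolding P_def using i x by simp
      qed
      have "(\<Sum>k<ell. \<gamma> k i * H k i x) = (\<Sum>k<l i. \<gamma> k i * H k i x)"
        by (rule sum.mono_neutral_right) (use l[OF i] in \<open>auto simp: \<gamma>_def\<close>)
      also have "\<dots> = (\<Sum>k<l i. indicator (cell n (b i k) (F i k) (G i k)) x)"
        by (rule sum.cong) (use l[OF i] Hx in \<open>auto simp: \<gamma>_def\<close>)
      also have "\<dots> = indicator (\<Omega> i) x"
        unfolding \<Omega>[OF i] by (rule indicator_UN_disjoint[symmetric, OF _ disj[OF i]]) simp
      finally show ?thesis unfolding \<Phi>_def by (cases "x \<in> \<Omega> i") (simp_all add: clamp01_simps)
    qed
    then show ?thesis using E eE by blast
  qed
  have "\<Phi> i x \<in> {0..1}" for i x unfolding \<Phi>_def using clamp01_range by simp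
  moreover have "?c \<ge> 0" using C0 by simp
  ultimately show ?thesis using n\<Phi> bad by blast
qed

end

section \<open>Choice of the mesh size\<close>

text \<open>Up to constants \<open>N = \<epsilon>\<^sup>-\<^sup>p\<^sup>/\<^sup>m\<close>. A constant factor in the weight bound is absorbed into a power of
\<open>1/\<epsilon>\<close> because \<open>1/\<epsilon> > 2\<close>.\<close>

lemma choose_mesh:
  fixes p c :: real and m n C :: nat
  assumes m: "m \<ge> 1" and p: "p \<ge> 0" and c: "c \<ge> 0" and n: "n \<ge> 1"
  shows "\<exists>c'>0. \<exists>s>0. \<forall>\<epsilon>::real. 0 < \<epsilon> \<and> \<epsilon> < 1/2 \<longrightarrow> (\<exists>N\<ge>2. c / real N ^ m < \<epsilon> powr p \<and>
     real (C * N ^ (n - 1)) \<le> c' * \<epsilon> powr (- (p * (real n - 1) / real m)) \<and> real N ^ C \<le> \<epsilon> powr (- s))"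
proof -
  (* strictly larger than c, for the strict inequality, and at least 1 *)
  define a where "a = c + 1"
  define Y where "Y = a powr (1 / real m)"
  have a: "a \<ge> 1" "a > c" using c unfolding a_def by auto
  have Y: "Y \<ge> 1" unfolding Y_def using a by (intro ge_one_powr_ge_zero) auto
  define t where "t = log 2 ((3 * Y) ^ C) + 1"
  have Y3: "(3 * Y) ^ C \<ge> 1" using Y by (intro one_le_power) simp
  have t: "t \<ge> 1" unfolding t_def using Y3 by simp
  let ?c' = "real (C + 1) * (3 * Y) ^ (n - 1)" and ?s = "t + p / real m * real C"
  have c'0: "?c' > 0" using Y by simp
  have s0: "?s > 0" using t p by (simp add: add_pos_nonneg)
  have "\<exists>N\<ge>2. c / real N ^ m < \<epsilon> powr p \<and>
     real (C * N ^ (n - 1)) \<le> ?c' * \<epsilon> powr (- (p * (real n - 1) / real m)) \<and> real N ^ C \<le> \<epsilon> powr (- ?s)"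
    if \<epsilon>: "0 < \<epsilon>" "\<epsilon> < 1/2" for \<epsilon> :: real
  proof -
    define Z where "Z = \<epsilon> powr (- (p / real m))"
    have Z: "Z \<ge> 1"
    proof -
      have "\<epsilon> powr 0 \<le> Z" unfolding Z_def by (rule powr_mono') (use \<epsilon> p in auto)
      then show ?thesis using \<epsilon> by simp
    qed
    define X where "X = Y * Z"
    have X: "X \<ge> 1" unfolding X_def using mult_mono[OF Y Z] Y by simp
      (* the summand 1 ensures N >= 2 *)
    define N where "N = nat \<lceil>X\<rceil> + 1"
    have N: "N \<ge> 2" "X \<le> real N" "real N \<le> 3 * X"
      using X unfolding N_def by linarith+
    have Zp: "Z ^ k = \<epsilon> powr (- (p / real m) * real k)" for k
      unfolding Z_def using \<epsilon> by (simp add: powr_powr flip: powr_realpow)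
    have "Y ^ m = a" unfolding Y_def using a m by (simp add: powr_powr flip: powr_realpow)
    then have Xm: "X ^ m = a * \<epsilon> powr (- p)"
      unfolding X_def power_mult_distrib Zp using m by simp
    have "c / real N ^ m \<le> c / X ^ m"
      using N(2) X c by (intro divide_left_mono power_mono mult_pos_pos zero_less_power) auto
    also have "\<dots> = (c / a) * \<epsilon> powr p" unfolding Xm using \<epsilon> by (simp add: powr_minus field_simps)
    also have "\<dots> < 1 * \<epsilon> powr p" using a c \<epsilon> by (intro mult_strict_right_mono) (auto simp: divide_less_eq_1)
    finally have 1: "c / real N ^ m < \<epsilon> powr p" by simp
    have Nk: "real N ^ k \<le> (3 * Y) ^ k * \<epsilon> powr (- (p / real m) * real k)" for k
    proof -
      have "real N ^ k \<le> (3 * X) ^ k" by (rule power_mono[OF N(3)]) simp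
      also have "\<dots> = (3 * Y) ^ k * Z ^ k" unfolding X_def by (simp add: power_mult_distrib)
      finally show ?thesis unfolding Zp .
    qed
    have e: "- (p / real m) * real (n - 1) = - (p * (real n - 1) / real m)" using n by (simp add: of_nat_diff)
    have "real (C * N ^ (n - 1)) = real C * real N ^ (n - 1)" by simp
    also have "\<dots> \<le> real (C + 1) * ((3 * Y) ^ (n - 1) * \<epsilon> powr (- (p / real m) * real (n - 1)))"
      by (rule mult_mono[OF _ Nk]) auto
    finally have 2: "real (C * N ^ (n - 1)) \<le> ?c' * \<epsilon> powr (- (p * (real n - 1) / real m))"
      unfolding e by (simp add: mult.assoc)
    have "(3 * Y) ^ C \<le> \<epsilon> powr (- t)"
    proof -
      have "(3 * Y) ^ C = 2 powr (log 2 ((3 * Y) ^ C))" using Y3 by simp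
      also have "\<dots> \<le> 2 powr t" unfolding t_def by (intro powr_mono) auto
      also have "\<dots> \<le> (1 / \<epsilon>) powr t" using \<epsilon> t by (intro powr_mono2) (auto simp: field_simps)
      also have "\<dots> = \<epsilon> powr (- t)" using \<epsilon> by (simp add: powr_divide powr_minus_divide)
      finally show ?thesis .
    qed
    then have "real N ^ C \<le> \<epsilon> powr (- t) * \<epsilon> powr (- (p / real m) * real C)"
      by (intro order_trans[OF Nk] mult_right_mono) auto
    also have "\<dots> = \<epsilon> powr (- ?s)" unfolding powr_add[symmetric] by simp
    finally have 3: "real N ^ C \<le> \<epsilon> powr (- ?s)" .
    show ?thesis using N(1) 1 2 3 by blast
  qed
  then show ?thesis using c'0 s0 by blast
qed

text \<open>The error is at most 1 everywhere and vanishes on the cube outside \<open>E\<close>, so its \<open>p\<close>-th power integrates to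
at most the measure of \<open>E\<close>.\<close>

lemma Lp_norm_less:
  assumes f: "f \<in> borel_measurable (lborel_Rn n)" "\<And>x. f x \<in> {0..1}" and \<Omega>: "\<Omega> \<in> sets (lborel_Rn n)"
    and E: "E \<in> sets (lborel_Rn n)" "emeasure (lborel_Rn n) E \<le> ennreal e" "\<And>x. x \<in> cube n - E \<Longrightarrow> f x = indicator \<Omega> x"
    and e: "0 \<le> e" "e < \<epsilon> powr p" and p: "p \<ge> 1" and \<epsilon>: "\<epsilon> > 0"
  shows "Lp_norm p (cube_measure n) (\<lambda>x. f x - indicator \<Omega> x) < ereal \<epsilon>"
proof -
  let ?M = "cube_measure n" and ?g = "\<lambda>x. f x - indicator \<Omega> x :: real"
  have sp: "space ?M = cube n"
    unfolding cube_measure_def space_restrict_space space_lborel_Rn using cube_subset_Rn by auto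
  have cs: "cube n \<inter> space (lborel_Rn n) \<in> sets (lborel_Rn n)" using cube_sets sets.Int[OF _ sets.top] by auto
  have em: "emeasure ?M A = emeasure (lborel_Rn n) A" if "A \<subseteq> cube n" for A
    unfolding cube_measure_def by (rule emeasure_restrict_space[OF cs that])
  have "emeasure (lborel_Rn n) (cube n) = 1"
    unfolding cube_def by (subst emeasure_box) auto
  then have "emeasure ?M (space ?M) = 1" using em[of "cube n"] sp by simp
  then interpret finite_measure ?M by (intro finite_measureI) simp
  have g: "?g \<in> borel_measurable ?M"
    unfolding cube_measure_def by (rule measurable_restrict_space1) (use f(1) \<Omega> in measurable)
  have le1: "\<bar>?g x\<bar> \<le> 1" for x using f(2)[of x] by (auto simp: indicator_def)
  have gp: "\<bar>?g x\<bar> powr p \<le> 1" for x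
    using powr_mono2[of p "\<bar>?g x\<bar>" 1] le1[of x] p by simp
  have int: "integrable ?M (\<lambda>x. \<bar>?g x\<bar> powr p)"
    by (rule integrable_const_bound[where B = 1]) (use gp g in auto)
  have Es: "E \<inter> cube n \<in> sets ?M"
    unfolding cube_measure_def using E(1) cube_sets by (subst sets_restrict_space_iff[OF cs]) auto
  have "(\<integral>x. \<bar>?g x\<bar> powr p \<partial>?M) \<le> (\<integral>x. indicator (E \<inter> cube n) x \<partial>?M)"
  proof (rule integral_mono[OF int])
    show "integrable ?M (indicator (E \<inter> cube n) :: _ \<Rightarrow> real)"
      using Es by (simp add: less_top[symmetric])
    fix x assume "x \<in> space ?M"
    then show "\<bar>?g x\<bar> powr p \<le> indicator (E \<inter> cube n) x"
      using gp[of x] E(3)[of x] sp p by (cases "x \<in> E") auto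
  qed
  also have "\<dots> = measure ?M (E \<inter> cube n)" using Es sets.sets_into_space[OF Es] by (simp add: Int_absorb2)
  also have "\<dots> \<le> e"
  proof -
    have "emeasure ?M (E \<inter> cube n) \<le> emeasure (lborel_Rn n) E" unfolding em[OF Int_lower2] by (rule emeasure_mono[OF _ E(1)]) auto
    then have "emeasure ?M (E \<inter> cube n) \<le> ennreal e" using E(2) by (rule order_trans)
    then show ?thesis using e(1) by (simp add: emeasure_eq_measure)
  qed
  finally have I: "(\<integral>x. \<bar>?g x\<bar> powr p \<partial>?M) < \<epsilon> powr p" using e(2) by simp
  have "(\<integral>x. \<bar>?g x\<bar> powr p \<partial>?M) powr (1 / p) < (\<epsilon> powr p) powr (1 / p)"
    by (rule powr_less_mono2[OF _ _ I]) (use p in auto)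
  also have "(\<epsilon> powr p) powr (1 / p) = \<epsilon>" using \<epsilon> p by (simp add: powr_powr)
  finally show ?thesis unfolding Lp_norm_def using g int by simp
qed

lemma nat_ceiling_log2: "m \<ge> 1 \<Longrightarrow> m \<le> 2 ^ nat \<lceil>log 2 (real m)\<rceil>"
proof -
  assume m: "m \<ge> 1"
  have "real m = 2 powr (log 2 (real m))" using m by simp
  also have "\<dots> \<le> 2 powr (real (nat \<lceil>log 2 (real m)\<rceil>))" by (intro powr_mono) (simp_all, linarith)
  also have "\<dots> = real (2 ^ nat \<lceil>log 2 (real m)\<rceil>)" by (simp add: powr_realpow)
  finally show ?thesis by (simp only: of_nat_le_iff)
qed

theorem theorem3p3:
  fixes m n ell :: nat and p B :: real
  assumes "m \<ge> 1" and "p \<ge> 1" and "n \<ge> 2" and "B > 0"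
  shows "\<exists>c>0. \<exists>s>0. \<forall>\<Omega>\<in>K_unions m n B ell. \<forall>\<epsilon>::real. 0 < \<epsilon> \<and> \<epsilon> < 1/2 \<longrightarrow>
    (\<exists>\<Phi>. is_relu_net n 1 \<Phi> \<and> (\<forall>x\<in>Rn n. net_fun n \<Phi> x \<in> {0..1}) \<and>
         net_max \<Phi> \<le> \<epsilon> powr (- s) \<and>
         real (net_depth \<Phi>) \<le> real_of_int \<lceil>log 2 (real ((ell + 1) * n))\<rceil>
           + (3 + real_of_int \<lceil>log 2 (real m)\<rceil>) * (14 + 2 * real m / real n) \<and>
         real (net_size \<Phi>) \<le> c * \<epsilon> powr (- (p * (real n - 1) / real m)) \<and>
         Lp_norm p (cube_measure n) (\<lambda>x. net_fun n \<Phi> x - indicator \<Omega> x) < ereal \<epsilon>)"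
proof -
  define K where "K = nat \<lceil>log 2 (real m)\<rceil>"
  (* K rounds of products; q steps of the squaring recursion make w ^ (2 q) at least N ^ m for w = N ^ (n - 1) *)
  define q where "q = nat \<lceil>real m / (2 * (real n - 1))\<rceil>"
  have K: "m \<le> 2 ^ K" unfolding K_def by (rule nat_ceiling_log2[OF assms(1)])
  have n1: "real n - 1 > 0" using assms(3) by simp
  have "real m / (2 * (real n - 1)) \<le> real q" unfolding q_def by linarith
  then have "real m \<le> 2 * (real n - 1) * real q" using n1 by (simp add: pos_divide_le_eq mult.commute)
  also have "\<dots> = real (2 * (n - 1) * q)" using assms(3) by (simp add: of_nat_diff)
  finally have q: "2 * (n - 1) * q \<ge> m" by (simp only: of_nat_le_iff)
  have depth: "real (Suc (2 * (5 + K * (q + 2)))) \<le> real_of_int \<lceil>log 2 (real ((ell + 1) * n))\<rceil>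
           + (3 + real_of_int \<lceil>log 2 (real m)\<rceil>) * (14 + 2 * real m / real n)"
  proof -
    have l0: "0 \<le> real_of_int \<lceil>log 2 (real ((ell + 1) * n))\<rceil>"
    proof -
      have "1 \<le> (ell + 1) * n" using assms(3) by simp
      then have "1 \<le> real ((ell + 1) * n)" by (simp only: of_nat_1[symmetric, where 'a = real] of_nat_le_iff)
      then have "0 \<le> log 2 (real ((ell + 1) * n))" by simp
      then show ?thesis by linarith
    qed
    have lm: "0 \<le> log 2 (real m)" using assms(1) by simp
    have Kr: "real_of_int \<lceil>log 2 (real m)\<rceil> = real K" unfolding K_def using lm by simp
    have "real m / (2 * (real n - 1)) \<le> real m / real n"
      using assms(3) by (intro divide_left_mono) auto
    moreover have "real q \<le> real m / (2 * (real n - 1)) + 1"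
    proof -
      have "0 \<le> real m / (2 * (real n - 1))" using n1 by simp
      then show ?thesis unfolding q_def by linarith
    qed
    moreover have "2 * real m / real n = 2 * (real m / real n)" "0 \<le> real m / real n" by simp_all
    moreover define D where "D = 14 + 2 * real m / real n"
    ultimately have D: "2 * real q + 4 \<le> D" "14 \<le> D" by linarith+
    define u where "u = real K * (2 * real q + 4)"
    have "u \<le> real K * D" unfolding u_def using D(1) by (rule mult_left_mono) simp
    moreover have "real (Suc (2 * (5 + K * (q + 2)))) = 11 + u" unfolding u_def by (simp add: algebra_simps)
    moreover have "(3 + real K) * D = 3 * D + real K * D" by (rule distrib_right)
    ultimately show ?thesis using l0 D(2) unfolding Kr D_def[symmetric] by linarith
  qed
  let ?KU = "K_unions m n B ell"
  define P where "P \<Omega> l b F G \<longleftrightarrow> l \<le> ell \<and> (\<forall>k. \<forall>j<n. Cm_bounded m j B (F k j) \<and> Cm_bounded m j B (G k j)) \<and>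
     disjoint_family_on (\<lambda>k. cell n (b k) (F k) (G k)) {..<l} \<and> \<Omega> = (\<Union>k<l. cell n (b k) (F k) (G k))"
    for \<Omega> l b F G
  have "\<forall>\<Omega>\<in>?KU. \<exists>l b F G. P \<Omega> l b F G"
    unfolding P_def using K_unions_imp_cells[of _ m n B ell] assms(4) by simp
  from bchoice[OF this] obtain l where "\<forall>\<Omega>\<in>?KU. \<exists>b F G. P \<Omega> (l \<Omega>) b F G" ..
  from bchoice[OF this] obtain b where "\<forall>\<Omega>\<in>?KU. \<exists>F G. P \<Omega> (l \<Omega>) (b \<Omega>) F G" ..
  from bchoice[OF this] obtain F where "\<forall>\<Omega>\<in>?KU. \<exists>G. P \<Omega> (l \<Omega>) (b \<Omega>) (F \<Omega>) G" ..
  from bchoice[OF this] obtain G where P: "\<forall>\<Omega>\<in>?KU. P \<Omega> (l \<Omega>) (b \<Omega>) (F \<Omega>) (G \<Omega>)" ..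
  define I where "I = {(M :: nat, \<Omega>). M \<ge> 2 \<and> \<Omega> \<in> ?KU}"
  have IP: "P (snd i) (l (snd i)) (b (snd i)) (F (snd i)) (G (snd i))" if "i \<in> I" for i
    using P that unfolding I_def by auto
  interpret net_family n I fst
    by unfold_locales (use assms(3) in \<open>auto simp: I_def\<close>)
  obtain \<Phi> c0 where \<Phi>: "realized (5 + K * (q + 2)) \<Phi>" and c0: "c0 \<ge> 0"
    and appr: "\<forall>i\<in>I. (\<forall>x. \<Phi> i x \<in> {0..1}) \<and> (\<exists>E\<in>sets (lborel_Rn n). emeasure (lborel_Rn n) E \<le> ennreal (c0 / real (fst i) ^ m) \<and>
        (\<forall>x\<in>cube n - E. \<Phi> i x = indicator (snd i) x))"
  proof -
    have "\<exists>\<Phi> c. realized (5 + K * (q + 2)) \<Phi> \<and> c \<ge> 0 \<and> (\<forall>i\<in>I. (\<forall>x. \<Phi> i x \<in> {0..1}) \<and>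
     (\<exists>E\<in>sets (lborel_Rn n). emeasure (lborel_Rn n) E \<le> ennreal (c / real (fst i) ^ m) \<and>
        (\<forall>x\<in>cube n - E. \<Phi> i x = indicator (snd i) x)))"
      by (rule approx_union_of_cells[OF assms(1) K q assms(4), where F = "\<lambda>i. F (snd i)" and G = "\<lambda>i. G (snd i)"
        and b = "\<lambda>i. b (snd i)" and l = "\<lambda>i. l (snd i)" and ell = ell]) (use IP in \<open>unfold P_def, blast\<close>)+
    then show ?thesis using that by blast
  qed
  obtain C where C: "\<forall>i\<in>I. realizable n (fst i) C (2 * (5 + K * (q + 2))) (\<Phi> i)" using \<Phi> unfolding realized_def by blast
  obtain c s where cs: "c > 0" "s > 0" and mesh: "\<forall>\<epsilon>::real. 0 < \<epsilon> \<and> \<epsilon> < 1/2 \<longrightarrow> (\<exists>N\<ge>2. c0 / real N ^ m < \<epsilon> powr p \<and>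
     real (C * N ^ (n - 1)) \<le> c * \<epsilon> powr (- (p * (real n - 1) / real m)) \<and> real N ^ C \<le> \<epsilon> powr (- s))"
    using choose_mesh[OF assms(1) _ c0, of p n C] assms(2,3) by auto
  have "\<exists>\<Psi>. is_relu_net n 1 \<Psi> \<and> (\<forall>x\<in>Rn n. net_fun n \<Psi> x \<in> {0..1}) \<and>
         net_max \<Psi> \<le> \<epsilon> powr (- s) \<and>
         real (net_depth \<Psi>) \<le> real_of_int \<lceil>log 2 (real ((ell + 1) * n))\<rceil>
           + (3 + real_of_int \<lceil>log 2 (real m)\<rceil>) * (14 + 2 * real m / real n) \<and>
         real (net_size \<Psi>) \<le> c * \<epsilon> powr (- (p * (real n - 1) / real m)) \<and>
         Lp_norm p (cube_measure n) (\<lambda>x. net_fun n \<Psi> x - indicator \<Omega> x) < ereal \<epsilon>"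
    if \<Omega>: "\<Omega> \<in> ?KU" and \<epsilon>: "0 < \<epsilon>" "\<epsilon> < 1/2" for \<Omega> and \<epsilon> :: real
  proof -
    obtain M where M: "M \<ge> 2" "c0 / real M ^ m < \<epsilon> powr p"
      "real (C * M ^ (n - 1)) \<le> c * \<epsilon> powr (- (p * (real n - 1) / real m))" "real M ^ C \<le> \<epsilon> powr (- s)"
    proof -
      have "\<exists>N\<ge>2. c0 / real N ^ m < \<epsilon> powr p \<and>
         real (C * N ^ (n - 1)) \<le> c * \<epsilon> powr (- (p * (real n - 1) / real m)) \<and> real N ^ C \<le> \<epsilon> powr (- s)"
        by (rule mesh[THEN spec, THEN mp]) (use \<epsilon> in simp)
      then show ?thesis using that by (elim exE conjE)
    qed
    define i where "i = (M, \<Omega>)"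
    have i: "i \<in> I" "fst i = M" "snd i = \<Omega>" unfolding i_def I_def using M(1) \<Omega> by auto
    have realizable: "realizable n M C (2 * (5 + K * (q + 2))) (\<Phi> i)" using bspec[OF C i(1)] unfolding i .
    then obtain S H t where h: "hidden n (real M ^ C) (Suc (2 * (5 + K * (q + 2)))) S H"
      "affine_comb H (real M ^ C) t (\<Phi> i)" "S + t \<le> C * M ^ (n - 1)" unfolding realizable_def by blast
    obtain \<Psi> where \<Psi>: "is_relu_net n 1 \<Psi>" "net_depth \<Psi> = Suc (2 * (5 + K * (q + 2)))" "net_size \<Psi> \<le> S + t"
      "net_max \<Psi> \<le> real M ^ C" "\<forall>x. net_fun n \<Psi> x = \<Phi> i x"
      using hidden_imp_net[OF h(1,2)] assms(3) by auto
    obtain E where E: "E \<in> sets (lborel_Rn n)" "emeasure (lborel_Rn n) E \<le> ennreal (c0 / real M ^ m)"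
      "\<And>x. x \<in> cube n - E \<Longrightarrow> \<Phi> i x = indicator \<Omega> x" and r: "\<And>x. \<Phi> i x \<in> {0..1}"
      using bspec[OF appr i(1)] unfolding i by blast
    have "\<Omega> \<in> sets (lborel_Rn n)"
    proof -
      have "P \<Omega> (l \<Omega>) (b \<Omega>) (F \<Omega>) (G \<Omega>)" using P \<Omega> by blast
      then have "\<Omega> = (\<Union>k<l \<Omega>. cell n (b \<Omega> k) (F \<Omega> k) (G \<Omega> k))"
        and *: "\<And>k j. j < n \<Longrightarrow> Cm_bounded m j B (F \<Omega> k j) \<and> Cm_bounded m j B (G \<Omega> k j)" unfolding P_def by blast+
      moreover have "(\<Union>k<l \<Omega>. cell n (b \<Omega> k) (F \<Omega> k) (G \<Omega> k)) \<in> sets (lborel_Rn n)"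
        by (intro sets.finite_UN cell_sets[of n m B] *) simp_all
      ultimately show ?thesis by simp
    qed
    then have "Lp_norm p (cube_measure n) (\<lambda>x. \<Phi> i x - indicator \<Omega> x) < ereal \<epsilon>"
      by (rule Lp_norm_less[OF realizable_measurable[OF realizable] r _ E _ M(2) assms(2) \<epsilon>(1)]) (use c0 in auto)
    moreover have "real (net_size \<Psi>) \<le> c * \<epsilon> powr (- (p * (real n - 1) / real m))"
    proof -
      have "real (net_size \<Psi>) \<le> real (C * M ^ (n - 1))" using \<Psi>(3) h(3) by (simp only: of_nat_le_iff) 
      then show ?thesis using M(3) by (rule order_trans)
    qed
    moreover have "net_max \<Psi> \<le> \<epsilon> powr (- s)" using \<Psi>(4) M(4) by (rule order_trans)
    ultimately show ?thesis
      using \<Psi>(1,2,5) depth r by (intro exI[of _ \<Psi>]) simp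
  qed
  then show ?thesis using cs by blast
qed

end
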